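(* Let $A$ be a commutative noetherian ring and $\mathfrak a$ an ideal of $A$. If $\mathcal{M}(A,\mathfrak a)_{\rm cof}$ is an abelian subcategory of $\operatorname{Mod} A$, then $\mathcal{L}(A,\mathfrak a)_{\rm cof}$ is a thick subcategory of $\operatorname{Mod} A$.
   Context: $\mathcal{M}(A,\mathfrak a)_{\rm cof}$ is the full subcategory of $\operatorname{Mod}A$ of $\mathfrak a$-cofinite modules, i.e. modules $M$ with $\operatorname{Supp}_A M\subseteq V(\mathfrak a)$ and $\operatorname{Ext}^i_A(A/\mathfrak a,M)$ finitely generated for all $i\ge 0$. It is an abelian subcategory if it is closed under kernels and cokernels of its morphisms. $\mathcal{L}(A,\mathfrak a)_{\rm cof}$ is the full subcategory of modules $M$ such that the local cohomology module $H^i_{\mathfrak a}(M)$ is $\mathfrak a$-cofinite for all $i$. A full subcategory of $\operatorname{Mod} A$ is thick if it is closed under direct summands, extensions, kernels of epimorphisms and cokernels of monomorphisms. *)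

theory Defs
  imports "HOL-Algebra.Module" "HOL-Algebra.Ring_Divisibility" "HOL-Algebra.Ideal_Product" "HOL-Library.Equipollence"
begin

text \<open>
  Size convention. HOL has no class of all modules, so \<open>Mod A\<close> is the category of all
  \<open>A\<close>-modules whose carrier is a subset of a type \<open>'u\<close>, which acts as a universe. The theorem
  assumes of \<open>'u\<close> that it is infinite and that \<open>'a \<Rightarrow> 'u\<close> injects into it; then \<open>Mod A\<close> is closed,
  up to isomorphism, under submodules, quotients, finite sums and coinduced modules, and so is an
  abelian category with enough injectives. The next two lemmas show that every
  type \<open>'m\<close> of module elements can be embedded in such a universe.
\<close>

lemma universe_type_exists:
  shows "infinite (UNIV :: (('a + 'm) list set) set)"
    and "(UNIV :: ('a \<Rightarrow> ('a + 'm) list set) set) \<lesssim> (UNIV :: (('a + 'm) list set) set)"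
proof -
  have "infinite (UNIV :: ('a + 'm) list set)"
    by (rule infinite_UNIV_listI)
  then show "infinite (UNIV :: (('a + 'm) list set) set)"
    by (simp add: Finite_Set.finite_set)
  define h :: "('a \<Rightarrow> ('a + 'm) list set) \<Rightarrow> ('a + 'm) list set"
    where "h = (\<lambda>f. {Inl r # l | r l. l \<in> f r})"
  have "f = g" if "h f = h g" for f g
  proof (rule ext)
    fix r
    have *: "k r = {l. Inl r # l \<in> h k}" for k
      by (auto simp: h_def)
    show "f r = g r"
      using *[of f] *[of g] that by simp
  qed
  then have "inj h"
    by (rule injI)
  then show "(UNIV :: ('a \<Rightarrow> ('a + 'm) list set) set) \<lesssim> (UNIV :: (('a + 'm) list set) set)"
    unfolding lepoll_def by blast
qed

lemma universe_type_embeds: "(UNIV :: 'm set) \<lesssim> (UNIV :: (('a + 'm) list set) set)"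
proof -
  have "inj (\<lambda>x :: 'm. {[Inr x :: 'a + 'm]})"
    by (rule injI) simp
  then show ?thesis
    unfolding lepoll_def by blast
qed


section \<open>Modules and homomorphisms\<close>

definition mod_hom :: "'a ring \<Rightarrow> ('a, 'x) module \<Rightarrow> ('a, 'y) module \<Rightarrow> ('x \<Rightarrow> 'y) set" where
  "mod_hom A M N = {f \<in> carrier M \<rightarrow>\<^sub>E carrier N.
     (\<forall>x\<in>carrier M. \<forall>y\<in>carrier M. f (x \<oplus>\<^bsub>M\<^esub> y) = f x \<oplus>\<^bsub>N\<^esub> f y) \<and>
     (\<forall>r\<in>carrier A. \<forall>x\<in>carrier M. f (r \<odot>\<^bsub>M\<^esub> x) = r \<odot>\<^bsub>N\<^esub> f x)}"

definition mod_iso :: "'a ring \<Rightarrow> ('a, 'x) module \<Rightarrow> ('a, 'y) module \<Rightarrow> bool" where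
  "mod_iso A M N \<longleftrightarrow> (\<exists>f\<in>mod_hom A M N. bij_betw f (carrier M) (carrier N))"

text \<open>The record fields \<open>mult\<close> and \<open>one\<close> play no role in the locale \<open>module\<close>; they are left
  \<open>undefined\<close> where a value has to be supplied.\<close>

definition self_module :: "'a ring \<Rightarrow> ('a, 'a) module" where
  "self_module A = ring.extend A (module.fields (\<lambda>r x. r \<otimes>\<^bsub>A\<^esub> x))"

definition quotient_module :: "('a, 'x) module \<Rightarrow> 'x set \<Rightarrow> ('a, 'x set) module" where
  "quotient_module M N = \<lparr>carrier = a_rcosets\<^bsub>M\<^esub> N, mult = undefined, one = undefined,
     zero = N, add = set_add M, smult = (\<lambda>r P. \<Union>x\<in>P. N +>\<^bsub>M\<^esub> (r \<odot>\<^bsub>M\<^esub> x))\<rparr>"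

definition hom_module :: "'a ring \<Rightarrow> ('a, 'x) module \<Rightarrow> ('a, 'y) module \<Rightarrow> ('a, 'x \<Rightarrow> 'y) module" where
  "hom_module A N M = \<lparr>carrier = mod_hom A N M, mult = undefined, one = undefined,
     zero = (\<lambda>x\<in>carrier N. \<zero>\<^bsub>M\<^esub>), add = (\<lambda>f g. \<lambda>x\<in>carrier N. f x \<oplus>\<^bsub>M\<^esub> g x),
     smult = (\<lambda>r f. \<lambda>x\<in>carrier N. r \<odot>\<^bsub>M\<^esub> f x)\<rparr>"

definition fin_gen_module :: "'a ring \<Rightarrow> ('a, 'x) module \<Rightarrow> bool" where
  "fin_gen_module A M \<longleftrightarrow> (\<exists>S. finite S \<and> S \<subseteq> carrier M \<and>
     (\<forall>x\<in>carrier M. \<exists>c. c \<in> S \<rightarrow> carrier A \<and> x = (\<Oplus>\<^bsub>M\<^esub>s\<in>S. c s \<odot>\<^bsub>M\<^esub> s)))"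

definition short_exact ::
  "'a ring \<Rightarrow> ('a, 'x) module \<Rightarrow> ('a, 'y) module \<Rightarrow> ('a, 'z) module \<Rightarrow> ('x \<Rightarrow> 'y) \<Rightarrow> ('y \<Rightarrow> 'z) \<Rightarrow> bool" where
  "short_exact A P Q T f g \<longleftrightarrow> module A P \<and> module A Q \<and> module A T \<and>
     f \<in> mod_hom A P Q \<and> g \<in> mod_hom A Q T \<and> inj_on f (carrier P) \<and>
     f ` carrier P = a_kernel Q T g \<and> g ` carrier Q = carrier T"


section \<open>Support\<close>

definition fraction_rel :: "('a, 'x) module \<Rightarrow> 'a set \<Rightarrow> (('x \<times> 'a) \<times> ('x \<times> 'a)) set" where
  "fraction_rel M S = {((x, s), (y, t)). x \<in> carrier M \<and> s \<in> S \<and> y \<in> carrier M \<and> t \<in> S \<and>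
     (\<exists>u\<in>S. u \<odot>\<^bsub>M\<^esub> (t \<odot>\<^bsub>M\<^esub> x) = u \<odot>\<^bsub>M\<^esub> (s \<odot>\<^bsub>M\<^esub> y))}"

text \<open>Only the set of fractions \<open>x/s\<close> in \<open>S\<^sup>-\<^sup>1M\<close> is needed: for \<open>S = A - p\<close> the localization is
  nonzero iff that set is not \<open>{0/1}\<close>.\<close>

definition localization :: "('a, 'x) module \<Rightarrow> 'a set \<Rightarrow> ('x \<times> 'a) set set" where
  "localization M S = (carrier M \<times> S) // fraction_rel M S"

definition supp :: "'a ring \<Rightarrow> ('a, 'x) module \<Rightarrow> 'a set set" where
  "supp A M = {p. primeideal p A \<and>
     localization M (carrier A - p) \<noteq> {fraction_rel M (carrier A - p) `` {(\<zero>\<^bsub>M\<^esub>, \<one>\<^bsub>A\<^esub>)}}}"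

definition vanishing :: "'a ring \<Rightarrow> 'a set \<Rightarrow> 'a set set" where
  "vanishing A \<aa> = {p. primeideal p A \<and> \<aa> \<subseteq> p}"


section \<open>Right derived functors, Ext and local cohomology\<close>

definition injective_module :: "'a ring \<Rightarrow> ('a, 'u) module \<Rightarrow> bool" where
  "injective_module A E \<longleftrightarrow> module A E \<and>
     (\<forall>(P :: ('a, 'u) module) (Q :: ('a, 'u) module) i f.
        module A P \<and> module A Q \<and> i \<in> mod_hom A P Q \<and> inj_on i (carrier P) \<and> f \<in> mod_hom A P E
        \<longrightarrow> (\<exists>g\<in>mod_hom A Q E. \<forall>x\<in>carrier P. g (i x) = f x))"

definition injective_resolution ::
  "'a ring \<Rightarrow> ('a, 'u) module \<Rightarrow> (nat \<Rightarrow> ('a, 'u) module) \<Rightarrow> (nat \<Rightarrow> 'u \<Rightarrow> 'u) \<Rightarrow> ('u \<Rightarrow> 'u) \<Rightarrow> bool" where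
  "injective_resolution A M I d \<epsilon> \<longleftrightarrow>
     (\<forall>n. injective_module A (I n)) \<and>
     \<epsilon> \<in> mod_hom A M (I 0) \<and> (\<forall>n. d n \<in> mod_hom A (I n) (I (Suc n))) \<and>
     inj_on \<epsilon> (carrier M) \<and> \<epsilon> ` carrier M = a_kernel (I 0) (I 1) (d 0) \<and>
     (\<forall>n. d n ` carrier (I n) = a_kernel (I (Suc n)) (I (Suc (Suc n))) (d (Suc n)))"

definition cohomology ::
  "(nat \<Rightarrow> ('a, 'x) module) \<Rightarrow> (nat \<Rightarrow> 'x \<Rightarrow> 'x) \<Rightarrow> nat \<Rightarrow> ('a, 'x set) module" where
  "cohomology C d i = quotient_module ((C i)\<lparr>carrier := a_kernel (C i) (C (Suc i)) (d i)\<rparr>)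
     (case i of 0 \<Rightarrow> {\<zero>\<^bsub>C 0\<^esub>} | Suc j \<Rightarrow> d j ` carrier (C j))"

text \<open>\<open>F\<close> and \<open>\<Phi>\<close> are the actions of a functor on objects and on morphisms. The derived functor
  is computed from an arbitrary but fixed injective resolution of \<open>M\<close>; another choice gives an
  isomorphic module.\<close>

definition right_derived ::
  "'a ring \<Rightarrow> (('a, 'u) module \<Rightarrow> ('a, 'v) module) \<Rightarrow>
   (('a, 'u) module \<Rightarrow> ('a, 'u) module \<Rightarrow> ('u \<Rightarrow> 'u) \<Rightarrow> 'v \<Rightarrow> 'v) \<Rightarrow>
   nat \<Rightarrow> ('a, 'u) module \<Rightarrow> ('a, 'v set) module" where
  "right_derived A F \<Phi> i M =
     (let (I, d) = (SOME (I, d). \<exists>\<epsilon>. injective_resolution A M I d \<epsilon>)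
      in cohomology (\<lambda>n. F (I n)) (\<lambda>n. \<Phi> (I n) (I (Suc n)) (d n)) i)"

definition Ext_module ::
  "'a ring \<Rightarrow> nat \<Rightarrow> ('a, 'x) module \<Rightarrow> ('a, 'u) module \<Rightarrow> ('a, ('x \<Rightarrow> 'u) set) module" where
  "Ext_module A i N M = right_derived A (hom_module A N)
     (\<lambda>E E' h. \<lambda>f\<in>mod_hom A N E. compose (carrier N) h f) i M"

definition torsion :: "'a ring \<Rightarrow> 'a set \<Rightarrow> ('a, 'x) module \<Rightarrow> ('a, 'x) module" where
  "torsion A \<aa> M = M\<lparr>carrier := {x \<in> carrier M. \<exists>n::nat. \<forall>r\<in>\<aa> [^]\<^bsub>ideals_set A\<^esub> n. r \<odot>\<^bsub>M\<^esub> x = \<zero>\<^bsub>M\<^esub>}\<rparr>"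

definition local_cohomology ::
  "'a ring \<Rightarrow> 'a set \<Rightarrow> nat \<Rightarrow> ('a, 'u) module \<Rightarrow> ('a, 'u set) module" where
  "local_cohomology A \<aa> i M = right_derived A (torsion A \<aa>)
     (\<lambda>E E' h. restrict h (carrier (torsion A \<aa> E))) i M"


section \<open>Full subcategories of \<open>Mod A\<close>, given by their classes of objects\<close>

definition M_cof :: "'a ring \<Rightarrow> 'a set \<Rightarrow> ('a, 'u) module set" where
  "M_cof A \<aa> = {M. module A M \<and> supp A M \<subseteq> vanishing A \<aa> \<and>
     (\<forall>i. fin_gen_module A (Ext_module A i (quotient_module (self_module A) \<aa>) M))}"

text \<open>\<open>local_cohomology A \<aa> i M\<close> consists of cosets, so its carrier has type \<open>'u set\<close>; that it is
  cofinite is expressed through an isomorphic copy in the universe \<open>'u\<close>.\<close>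

definition L_cof :: "'a ring \<Rightarrow> 'a set \<Rightarrow> ('a, 'u) module set" where
  "L_cof A \<aa> = {M. module A M \<and>
     (\<forall>i. \<exists>H \<in> (M_cof A \<aa> :: ('a, 'u) module set). mod_iso A H (local_cohomology A \<aa> i M))}"

text \<open>Kernels and cokernels are given up to isomorphism, by the exact sequences
  \<open>0 \<rightarrow> K \<rightarrow> M \<rightarrow> N\<close> and \<open>M \<rightarrow> N \<rightarrow> C \<rightarrow> 0\<close>.\<close>

definition abelian_subcategory :: "'a ring \<Rightarrow> ('a, 'u) module set \<Rightarrow> bool" where
  "abelian_subcategory A \<C> \<longleftrightarrow> \<C> \<subseteq> {M. module A M} \<and>
     (\<forall>M\<in>\<C>. \<forall>N\<in>\<C>. \<forall>f\<in>mod_hom A M N.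
        (\<forall>K k. module A K \<and> k \<in> mod_hom A K M \<and> inj_on k (carrier K) \<and>
               k ` carrier K = a_kernel M N f \<longrightarrow> K \<in> \<C>) \<and>
        (\<forall>C q. module A C \<and> q \<in> mod_hom A N C \<and> q ` carrier N = carrier C \<and>
               a_kernel N C q = f ` carrier M \<longrightarrow> C \<in> \<C>))"

definition is_direct_sum ::
  "'a ring \<Rightarrow> ('a, 'x) module \<Rightarrow> ('a, 'y) module \<Rightarrow> ('a, 'z) module \<Rightarrow> bool" where
  "is_direct_sum A P Q M \<longleftrightarrow> (\<exists>i\<in>mod_hom A P M. \<exists>j\<in>mod_hom A Q M.
     bij_betw (\<lambda>(x, y). i x \<oplus>\<^bsub>M\<^esub> j y) (carrier P \<times> carrier Q) (carrier M))"

definition thick_subcategory :: "'a ring \<Rightarrow> ('a, 'u) module set \<Rightarrow> bool" where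
  "thick_subcategory A \<C> \<longleftrightarrow> \<C> \<subseteq> {M. module A M} \<and>
     (\<forall>M\<in>\<C>. \<forall>(P :: ('a, 'u) module) (Q :: ('a, 'u) module).
        module A P \<and> module A Q \<and> is_direct_sum A P Q M \<longrightarrow> P \<in> \<C>) \<and>
     (\<forall>(P :: ('a, 'u) module) (Q :: ('a, 'u) module) (T :: ('a, 'u) module) f g.
        short_exact A P Q T f g \<longrightarrow>
          (P \<in> \<C> \<and> T \<in> \<C> \<longrightarrow> Q \<in> \<C>) \<and>
          (Q \<in> \<C> \<and> T \<in> \<C> \<longrightarrow> P \<in> \<C>) \<and>
          (P \<in> \<C> \<and> Q \<in> \<C> \<longrightarrow> T \<in> \<C>))"

end

theory Submission
  imports Defs "HOL-Algebra.Free_Abelian_Groups"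
begin

text \<open>
  A short exact sequence induces a long exact sequence of local cohomology modules, so each of the three
  terms is, in every degree, the middle of a five-term exact sequence whose outer terms are cofinite as soon
  as the other two modules are in \<open>L_cof\<close>. By hypothesis, kernels and cokernels of maps of cofinite modules
  are cofinite; and cofinite modules are closed under extensions, by the long exact sequence of Ext over
  a noetherian ring. Hence the middle term is cofinite. For a direct summand \<open>P\<close> of \<open>M\<close>, the local cohomology
  of \<open>P\<close> is the kernel of an endomorphism of that of \<open>M\<close>.

  Both long exact sequences come from one construction: for \<open>0 \<rightarrow> P \<rightarrow> Q \<rightarrow> T \<rightarrow> 0\<close>, the shifted mapping cone of a map between
  injective resolutions of \<open>Q\<close> and \<open>T\<close> is an injective resolution of \<open>P\<close>, and it is degreewise a split
  extension, so it stays exact under an additive functor. Injective modules inside the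
  universe \<open>'u\<close> are coinduced from divisible abelian groups.
\<close>

section \<open>Modules\<close>

text \<open>The obstacle is size. Cohomology consists of cosets, so derived functors leave the
  universe \<open>'u\<close>, while \<open>M_cof\<close> collects modules inside it. Cohomology is
  therefore handled through \<open>coh_rep\<close>, which accepts any module, of any type, that
  receives the cocycles with kernel the coboundaries; copies inside \<open>'u\<close> exist because
  such a quotient is no larger than the cocycles. Moreover \<open>right_derived\<close> fixes its
  resolution by \<open>SOME\<close>, so nothing can be computed before independence of the
  resolution is known; lifts and homotopies serve this purpose. The cone needs a single lift of
  \<open>Q -> T\<close>, but it rotates the sequence: its terms are \<open>T\<close> shifted by one
  degree, \<open>P\<close> and \<open>Q\<close>. The connecting map of complexes thus induces
  \<open>Q -> T\<close> on cohomology, and the inclusion of the shifted complex becomes the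
  connecting map from \<open>T\<close> to \<open>P\<close>. Closure under kernels and cokernels
  alone does not reach the middle \<open>H\<close> of \<open>X -> Y -> H -> Z -> W\<close>: it
  yields the two ends of an extension, the cokernel of \<open>X -> Y\<close> and the kernel of
  \<open>Z -> W\<close>. This is why closure under extensions is needed.\<close>

lemma mod_hom_closed: "f \<in> mod_hom A M N \<Longrightarrow> x \<in> carrier M \<Longrightarrow> f x \<in> carrier N"
  by (auto simp: mod_hom_def)

lemma mod_hom_add:
  "f \<in> mod_hom A M N \<Longrightarrow> x \<in> carrier M \<Longrightarrow> y \<in> carrier M \<Longrightarrow> f (x \<oplus>\<^bsub>M\<^esub> y) = f x \<oplus>\<^bsub>N\<^esub> f y"
  by (auto simp: mod_hom_def)

lemma mod_hom_smult:
  "f \<in> mod_hom A M N \<Longrightarrow> r \<in> carrier A \<Longrightarrow> x \<in> carrier M \<Longrightarrow> f (r \<odot>\<^bsub>M\<^esub> x) = r \<odot>\<^bsub>N\<^esub> f x"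
  by (auto simp: mod_hom_def)

lemma mod_hom_zero:
  assumes "module A M" "module A N" "f \<in> mod_hom A M N"
  shows "f \<zero>\<^bsub>M\<^esub> = \<zero>\<^bsub>N\<^esub>"
proof -
  interpret M: module A M by fact
  interpret N: module A N by fact
  have "f \<zero>\<^bsub>M\<^esub> \<oplus>\<^bsub>N\<^esub> f \<zero>\<^bsub>M\<^esub> = f \<zero>\<^bsub>M\<^esub>"
    using mod_hom_add[OF assms(3), of "\<zero>\<^bsub>M\<^esub>" "\<zero>\<^bsub>M\<^esub>"] by simp
  then show ?thesis
    using mod_hom_closed[OF assms(3), of "\<zero>\<^bsub>M\<^esub>"] by simp
qed

lemma mod_hom_uminus:
  assumes "module A M" "module A N" "f \<in> mod_hom A M N" "x \<in> carrier M"
  shows "f (\<ominus>\<^bsub>M\<^esub> x) = \<ominus>\<^bsub>N\<^esub> f x"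
proof -
  interpret M: module A M by fact
  interpret N: module A N by fact
  have "f (\<ominus>\<^bsub>M\<^esub> x) \<oplus>\<^bsub>N\<^esub> f x = \<zero>\<^bsub>N\<^esub>"
    using mod_hom_add[OF assms(3), of "\<ominus>\<^bsub>M\<^esub> x" x] assms by (simp add: M.l_neg mod_hom_zero)
  then show ?thesis
    using mod_hom_closed[OF assms(3)] assms by (simp add: N.add.inv_equality)
qed

lemma mod_hom_minus:
  assumes "module A M" "module A N" "f \<in> mod_hom A M N" "x \<in> carrier M" "y \<in> carrier M"
  shows "f (x \<ominus>\<^bsub>M\<^esub> y) = f x \<ominus>\<^bsub>N\<^esub> f y"
proof -
  interpret M: module A M by fact
  interpret N: module A N by fact
  show ?thesis
    using assms by (simp add: M.minus_eq N.minus_eq mod_hom_add mod_hom_uminus)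
qed

lemma mod_hom_ext:
  assumes "f \<in> mod_hom A M N" "g \<in> mod_hom A M N" "\<And>x. x \<in> carrier M \<Longrightarrow> f x = g x"
  shows "f = g"
  using assms unfolding mod_hom_def by (blast intro: PiE_ext)

lemma restrict_mod_homI:
  assumes "module A M"
    and "\<And>x. x \<in> carrier M \<Longrightarrow> f x \<in> carrier N"
    and "\<And>x y. x \<in> carrier M \<Longrightarrow> y \<in> carrier M \<Longrightarrow> f (x \<oplus>\<^bsub>M\<^esub> y) = f x \<oplus>\<^bsub>N\<^esub> f y"
    and "\<And>r x. r \<in> carrier A \<Longrightarrow> x \<in> carrier M \<Longrightarrow> f (r \<odot>\<^bsub>M\<^esub> x) = r \<odot>\<^bsub>N\<^esub> f x"
  shows "restrict f (carrier M) \<in> mod_hom A M N"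
proof -
  interpret M: module A M by fact
  show ?thesis
    using assms unfolding mod_hom_def by simp
qed

lemma mod_hom_comp:
  assumes "module A M" "f \<in> mod_hom A M N" "g \<in> mod_hom A N K"
  shows "(\<lambda>x\<in>carrier M. g (f x)) \<in> mod_hom A M K"
  by (rule restrict_mod_homI[OF assms(1)])
    (use assms in \<open>simp_all add: mod_hom_add mod_hom_smult mod_hom_closed\<close>)

lemma mod_hom_id:
  assumes "module A M"
  shows "(\<lambda>x\<in>carrier M. x) \<in> mod_hom A M M"
  by (rule restrict_mod_homI[OF assms(1)]) simp_all

lemma mod_hom_null:
  assumes "module A M" "module A N"
  shows "(\<lambda>x\<in>carrier M. \<zero>\<^bsub>N\<^esub>) \<in> mod_hom A M N"
proof -
  interpret N: module A N by fact
  show ?thesis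
    by (rule restrict_mod_homI[OF assms(1)]) simp_all
qed

lemma mod_hom_sum:
  assumes "module A M" "module A N" "f \<in> mod_hom A M N" "g \<in> mod_hom A M N"
  shows "(\<lambda>x\<in>carrier M. f x \<oplus>\<^bsub>N\<^esub> g x) \<in> mod_hom A M N"
proof -
  interpret N: module A N by fact
  show ?thesis
    by (rule restrict_mod_homI[OF assms(1)])
      (use assms in \<open>simp_all add: mod_hom_add mod_hom_smult mod_hom_closed N.smult_r_distr N.add.m_ac\<close>)
qed

lemma mod_hom_diff:
  assumes "module A M" "module A N" "f \<in> mod_hom A M N" "g \<in> mod_hom A M N"
  shows "(\<lambda>x\<in>carrier M. f x \<ominus>\<^bsub>N\<^esub> g x) \<in> mod_hom A M N"
proof -
  interpret N: module A N by fact
  show ?thesis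
    by (rule restrict_mod_homI[OF assms(1)])
      (use assms in \<open>simp_all add: mod_hom_add mod_hom_smult mod_hom_closed N.smult_r_distr
        N.minus_eq N.minus_add N.smult_r_minus N.add.m_ac\<close>)
qed

lemma (in abelian_group) minus_cancel:
  assumes "x \<in> carrier G" "y \<in> carrier G"
  shows "(x \<ominus> y) \<oplus> y = x" "(x \<oplus> y) \<ominus> y = x" "y \<oplus> (x \<ominus> y) = x" "(y \<oplus> x) \<ominus> y = x"
    "x \<ominus> (x \<ominus> y) = y"
proof -
  show 1: "(x \<ominus> y) \<oplus> y = x" and 2: "(x \<oplus> y) \<ominus> y = x"
    using assms by (simp_all add: minus_eq a_assoc l_neg r_neg)
  show "y \<oplus> (x \<ominus> y) = x" using 1 assms by (simp add: a_comm[of y])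
  show "(y \<oplus> x) \<ominus> y = x" using 2 assms by (simp add: a_comm[of y])
  show "x \<ominus> (x \<ominus> y) = y" using assms by (simp add: minus_eq minus_add a_assoc[symmetric] r_neg)
qed

lemma (in abelian_group) minus_eq_zero_iff:
  assumes "x \<in> carrier G" "y \<in> carrier G"
  shows "x \<ominus> y = \<zero> \<longleftrightarrow> x = y"
  using minus_cancel(1)[OF assms] assms by (auto simp: minus_eq r_neg)

section \<open>Submodules, factorization through surjections, transport of structure,
  quotients\<close>

lemma submoduleI':
  assumes "module A M" "H \<subseteq> carrier M" "\<zero>\<^bsub>M\<^esub> \<in> H"
    and "\<And>x y. x \<in> H \<Longrightarrow> y \<in> H \<Longrightarrow> x \<oplus>\<^bsub>M\<^esub> y \<in> H"
    and "\<And>r x. r \<in> carrier A \<Longrightarrow> x \<in> H \<Longrightarrow> r \<odot>\<^bsub>M\<^esub> x \<in> H"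
  shows "submodule H A M"
proof -
  interpret M: module A M by fact
  have "\<ominus>\<^bsub>M\<^esub> x \<in> H" if "x \<in> H" for x
    using assms(5)[of "\<ominus>\<^bsub>A\<^esub> \<one>\<^bsub>A\<^esub>" x] assms(2) that by (simp add: M.smult_l_minus subset_iff)
  then show ?thesis
    using assms by (intro M.submoduleI) auto
qed

lemma submoduleD:
  assumes "module A M" "submodule H A M"
  shows "H \<subseteq> carrier M" "\<zero>\<^bsub>M\<^esub> \<in> H" "\<And>x y. x \<in> H \<Longrightarrow> y \<in> H \<Longrightarrow> x \<oplus>\<^bsub>M\<^esub> y \<in> H"
    "\<And>r x. r \<in> carrier A \<Longrightarrow> x \<in> H \<Longrightarrow> r \<odot>\<^bsub>M\<^esub> x \<in> H" "\<And>x. x \<in> H \<Longrightarrow> \<ominus>\<^bsub>M\<^esub> x \<in> H"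
    "\<And>x y. x \<in> H \<Longrightarrow> y \<in> H \<Longrightarrow> x \<ominus>\<^bsub>M\<^esub> y \<in> H"
proof -
  interpret M: module A M by fact
  note E = M.submoduleE[OF assms(2)]
  show "H \<subseteq> carrier M" "\<And>x y. x \<in> H \<Longrightarrow> y \<in> H \<Longrightarrow> x \<oplus>\<^bsub>M\<^esub> y \<in> H"
    "\<And>r x. r \<in> carrier A \<Longrightarrow> x \<in> H \<Longrightarrow> r \<odot>\<^bsub>M\<^esub> x \<in> H" "\<And>x. x \<in> H \<Longrightarrow> \<ominus>\<^bsub>M\<^esub> x \<in> H"
    "\<And>x y. x \<in> H \<Longrightarrow> y \<in> H \<Longrightarrow> x \<ominus>\<^bsub>M\<^esub> y \<in> H"
    using E by (auto simp: M.minus_eq)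
  obtain x where "x \<in> H" using E(2) by blast
  then show "\<zero>\<^bsub>M\<^esub> \<in> H"
    using E(1,3,5) M.r_neg by (metis subsetD)
qed

lemma submodule_image:
  assumes "module A M" "module A N" "f \<in> mod_hom A M N"
  shows "submodule (f ` carrier M) A N"
proof -
  interpret M: module A M by fact
  interpret N: module A N by fact
  show ?thesis
  proof (rule submoduleI')
    show "\<zero>\<^bsub>N\<^esub> \<in> f ` carrier M"
      using mod_hom_zero[OF assms] by (metis M.zero_closed imageI)
  next
    fix x y assume "x \<in> f ` carrier M" "y \<in> f ` carrier M"
    then show "x \<oplus>\<^bsub>N\<^esub> y \<in> f ` carrier M"
      using mod_hom_add[OF assms(3)] by (auto simp: image_iff) (metis M.add.m_closed)
  next
    fix r x assume "r \<in> carrier A" "x \<in> f ` carrier M"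
    then show "r \<odot>\<^bsub>N\<^esub> x \<in> f ` carrier M"
      using mod_hom_smult[OF assms(3)] by (auto simp: image_iff) (metis M.smult_closed)
  qed (use assms mod_hom_closed in auto)
qed

lemma submodule_kernel:
  assumes "module A M" "module A N" "f \<in> mod_hom A M N"
  shows "submodule (a_kernel M N f) A M"
proof -
  interpret M: module A M by fact
  interpret N: module A N by fact
  show ?thesis
    by (rule submoduleI')
      (use assms mod_hom_zero[OF assms] in \<open>auto simp: a_kernel_def' mod_hom_add mod_hom_smult\<close>)
qed

lemma submodule_zero:
  assumes "module A M"
  shows "submodule {\<zero>\<^bsub>M\<^esub>} A M"
proof -
  interpret M: module A M by fact
  show ?thesis
    by (rule submoduleI') (use assms in auto)
qed

text \<open>\<open>a_inv\<close> is a definite description over the carrier, so its value in a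
  submodule is not by definition the one in \<open>M\<close>; uniqueness of inverses in the
  submodule identifies them.\<close>

lemma a_inv_carrier_update [simp]:
  assumes "module A M" "submodule H A M" "x \<in> H"
  shows "a_inv (M\<lparr>carrier := H\<rparr>) x = a_inv M x"
proof -
  interpret M: module A M by fact
  interpret H: module A "M\<lparr>carrier := H\<rparr>"
    using assms by (simp add: submodule.submodule_is_module)
  note S = submoduleD[OF assms(1,2)]
  have "x \<in> carrier M" using S(1) assms(3) by auto
  then have "\<ominus>\<^bsub>M\<^esub> x \<oplus>\<^bsub>M\<^esub> x = \<zero>\<^bsub>M\<^esub>" by (rule M.l_neg)
  then show ?thesis
    using H.add.inv_equality[of "\<ominus>\<^bsub>M\<^esub> x" x] S(5) assms(3) by simp
qed

lemma mod_hom_submodule: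
  assumes "f \<in> mod_hom A M N" "H \<subseteq> carrier M" "\<And>x. x \<in> H \<Longrightarrow> f x \<in> K" "module A M" "submodule H A M"
  shows "restrict f H \<in> mod_hom A (M\<lparr>carrier := H\<rparr>) (N\<lparr>carrier := K\<rparr>)"
  using restrict_mod_homI[OF submodule.submodule_is_module[OF assms(5,4)], of f "N\<lparr>carrier := K\<rparr>"]
  using assms by (auto simp: mod_hom_add mod_hom_smult subset_iff)

text \<open>Universal property of a quotient, phrased for an arbitrary surjection
  \<open>\<pi>\<close> so that it serves cokernels, images and cohomology alike. The map is
  \<open>f\<close> after a set-theoretic section of \<open>\<pi>\<close>; the kernel condition makes
  the choice of preimage irrelevant, and linearity follows from that.\<close>

lemma mod_hom_factor:
  assumes Z: "module A Z" and H: "module A H" and K: "module A K"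
    and \<pi>: "\<pi> \<in> mod_hom A Z H" "\<pi> ` carrier Z = carrier H"
    and f: "f \<in> mod_hom A Z K"
    and le: "\<And>z. z \<in> carrier Z \<Longrightarrow> \<pi> z = \<zero>\<^bsub>H\<^esub> \<Longrightarrow> f z = \<zero>\<^bsub>K\<^esub>"
  shows "\<exists>h\<in>mod_hom A H K. \<forall>z\<in>carrier Z. h (\<pi> z) = f z"
proof -
  interpret Z: module A Z by fact
  interpret H: module A H by fact
  interpret K: module A K by fact
  define s where "s y = (SOME z. z \<in> carrier Z \<and> \<pi> z = y)" for y
  have s: "s y \<in> carrier Z \<and> \<pi> (s y) = y" if "y \<in> carrier H" for y
    unfolding s_def by (rule someI_ex) (use that \<pi>(2)[symmetric] in auto)
  have eq: "f z = f z'" if "z \<in> carrier Z" "z' \<in> carrier Z" "\<pi> z = \<pi> z'" for z z'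
  proof -
    have "\<pi> (z \<ominus>\<^bsub>Z\<^esub> z') = \<zero>\<^bsub>H\<^esub>"
      using that mod_hom_closed[OF \<pi>(1)] by (simp add: mod_hom_minus[OF Z H \<pi>(1)] H.minus_eq_zero_iff)
    then have "f (z \<ominus>\<^bsub>Z\<^esub> z') = \<zero>\<^bsub>K\<^esub>" using that by (simp add: le)
    then show ?thesis
      using that mod_hom_closed[OF f] by (simp add: mod_hom_minus[OF Z K f] K.minus_eq_zero_iff)
  qed
  define h where "h = (\<lambda>y\<in>carrier H. f (s y))"
  have h: "h (\<pi> z) = f z" if "z \<in> carrier Z" for z
    using that s[of "\<pi> z"] mod_hom_closed[OF \<pi>(1)] eq[of "s (\<pi> z)" z] by (simp add: h_def)
  have "h \<in> mod_hom A H K"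
    unfolding h_def
  proof (rule restrict_mod_homI[OF H])
    fix y assume "y \<in> carrier H"
    then show "f (s y) \<in> carrier K" using s mod_hom_closed[OF f] by blast
  next
    fix y y' assume y: "y \<in> carrier H" "y' \<in> carrier H"
    have "f (s (y \<oplus>\<^bsub>H\<^esub> y')) = f (s y \<oplus>\<^bsub>Z\<^esub> s y')"
      by (rule eq) (use s y in \<open>auto simp: mod_hom_add[OF \<pi>(1)]\<close>)
    then show "f (s (y \<oplus>\<^bsub>H\<^esub> y')) = f (s y) \<oplus>\<^bsub>K\<^esub> f (s y')"
      using s y by (simp add: mod_hom_add[OF f])
  next
    fix r y assume y: "r \<in> carrier A" "y \<in> carrier H"
    have "f (s (r \<odot>\<^bsub>H\<^esub> y)) = f (r \<odot>\<^bsub>Z\<^esub> s y)"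
      by (rule eq) (use s y in \<open>auto simp: mod_hom_smult[OF \<pi>(1)]\<close>)
    then show "f (s (r \<odot>\<^bsub>H\<^esub> y)) = r \<odot>\<^bsub>K\<^esub> f (s y)"
      using s y by (simp add: mod_hom_smult[OF f])
  qed
  then show ?thesis using h by blast
qed

lemma mod_iso_inverse:
  assumes "module A M" "module A N" "f \<in> mod_hom A M N" "bij_betw f (carrier M) (carrier N)"
  obtains g where "g \<in> mod_hom A N M" "bij_betw g (carrier N) (carrier M)"
    "\<And>x. x \<in> carrier M \<Longrightarrow> g (f x) = x" "\<And>y. y \<in> carrier N \<Longrightarrow> f (g y) = y"
proof -
  have inj: "inj_on f (carrier M)" and surj: "f ` carrier M = carrier N"
    using assms(4) by (auto simp: bij_betw_def)
  \<comment> \<open>The inverse is the identity of \<open>M\<close> factored through the surjection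
    \<open>f\<close>.\<close>
  have "\<exists>g\<in>mod_hom A N M. \<forall>x\<in>carrier M. g (f x) = restrict (\<lambda>x. x) (carrier M) x"
  proof (rule mod_hom_factor[OF assms(1,2,1,3) surj mod_hom_id[OF assms(1)]])
    interpret M: module A M by fact
    fix z assume "z \<in> carrier M" "f z = \<zero>\<^bsub>N\<^esub>"
    then have "z = \<zero>\<^bsub>M\<^esub>"
      using inj mod_hom_zero[OF assms(1-3)] by (metis M.zero_closed inj_onD)
    then show "restrict (\<lambda>x. x) (carrier M) z = \<zero>\<^bsub>M\<^esub>" by simp
  qed
  then obtain g where g: "g \<in> mod_hom A N M" "\<And>x. x \<in> carrier M \<Longrightarrow> g (f x) = x" by auto
  have fg: "f (g y) = y" if "y \<in> carrier N" for y
    using that g(2) surj[symmetric] by auto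
  have "bij_betw g (carrier N) (carrier M)"
    by (rule bij_betwI'[of "carrier N"])
      (use fg g mod_hom_closed[OF assms(3)] mod_hom_closed[OF g(1)] in \<open>metis+\<close>)
  then show ?thesis using that g fg by blast
qed

lemma mod_iso_comp:
  assumes "module A M" "module A N" "mod_iso A M N" "mod_iso A N K"
  shows "mod_iso A M K"
proof -
  obtain f g where f: "f \<in> mod_hom A M N" "bij_betw f (carrier M) (carrier N)"
    and g: "g \<in> mod_hom A N K" "bij_betw g (carrier N) (carrier K)"
    using assms by (auto simp: mod_iso_def)
  have "bij_betw (\<lambda>x\<in>carrier M. g (f x)) (carrier M) (carrier K)"
    using bij_betw_trans[OF f(2) g(2)] by (rule iffD1[OF bij_betw_cong, rotated]) simp
  then show ?thesis
    using mod_hom_comp[OF assms(1) f(1) g(1)] unfolding mod_iso_def by blast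
qed

lemma mod_iso_sym:
  assumes "module A M" "module A N" "mod_iso A M N"
  shows "mod_iso A N M"
  using assms mod_iso_inverse[OF assms(1,2)] by (metis mod_iso_def)

text \<open>Structure is carried along an injection of the carrier into another type; this is how
  pairs, cosets and coinduced modules are brought back into the universe.\<close>

lemma module_transport:
  fixes M :: "('a, 'x) module" and e :: "'x \<Rightarrow> 'y"
  assumes M: "module A M" and inj: "inj_on e (carrier M)"
  obtains N :: "('a, 'y) module" where "module A N" "carrier N = e ` carrier M"
    "restrict e (carrier M) \<in> mod_hom A M N" "bij_betw (restrict e (carrier M)) (carrier M) (carrier N)"
proof -
  interpret M: module A M by fact
  define i where "i = the_inv_into (carrier M) e"
  have i: "i (e x) = x" if "x \<in> carrier M" for x
    using the_inv_into_f_f[OF inj that] by (simp add: i_def)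
  define N :: "('a, 'y) module" where
    "N = \<lparr>carrier = e ` carrier M, monoid.mult = undefined, one = undefined, ring.zero = e \<zero>\<^bsub>M\<^esub>,
       add = (\<lambda>x y. e (i x \<oplus>\<^bsub>M\<^esub> i y)), smult = (\<lambda>r x. e (r \<odot>\<^bsub>M\<^esub> i x))\<rparr>"
  have N: "module A N"
  proof (rule moduleI)
    show "cring A" by (rule M.R.is_cring)
    show "abelian_group N"
    proof (rule abelian_groupI)
      fix x assume "x \<in> carrier N"
      then obtain y where "y \<in> carrier M" "x = e y" by (auto simp: N_def)
      then show "\<exists>y\<in>carrier N. y \<oplus>\<^bsub>N\<^esub> x = \<zero>\<^bsub>N\<^esub>"
        by (intro bexI[of _ "e (\<ominus>\<^bsub>M\<^esub> y)"]) (auto simp: N_def i M.l_neg)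
    qed (auto simp: N_def i M.add.m_ac)
  qed (auto simp: N_def i M.smult_l_distr M.smult_r_distr M.smult_assoc1)
  moreover have "restrict e (carrier M) \<in> mod_hom A M N"
    by (rule restrict_mod_homI[OF M]) (auto simp: N_def i)
  moreover have "bij_betw (restrict e (carrier M)) (carrier M) (carrier N)"
    using inj by (simp add: N_def inj_on_imp_bij_betw)
  ultimately show ?thesis using that by (simp add: N_def)
qed

text \<open>The surjection bounds the size of \<open>H\<close>: picking one preimage of each element
  injects the carrier of \<open>H\<close> into the element type of \<open>Z\<close>.\<close>

lemma module_copy:
  fixes Z :: "('a, 'u) module" and H :: "('a, 'x) module"
  assumes "module A Z" "module A H" "\<pi> ` carrier Z = carrier H"
  obtains H' :: "('a, 'u) module" where "module A H'" "mod_iso A H H'"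
proof -
  define s where "s y = (SOME z. z \<in> carrier Z \<and> \<pi> z = y)" for y
  have s: "\<pi> (s y) = y" if "y \<in> carrier H" for y
    using someI_ex[of "\<lambda>z. z \<in> carrier Z \<and> \<pi> z = y"] that assms(3)[symmetric] by (auto simp: s_def)
  have "inj_on s (carrier H)"
    by (metis s inj_on_inverseI)
  then show ?thesis
    using module_transport[OF assms(2)] that unfolding mod_iso_def by metis
qed

lemma quotient_module:
  assumes M: "module A M" and N: "submodule N A M"
  shows "module A (quotient_module M N)"
    and "(\<lambda>x\<in>carrier M. N +>\<^bsub>M\<^esub> x) \<in> mod_hom A M (quotient_module M N)"
    and "(\<lambda>x. N +>\<^bsub>M\<^esub> x) ` carrier M = carrier (quotient_module M N)"
    and "x \<in> carrier M \<Longrightarrow> N +>\<^bsub>M\<^esub> x = \<zero>\<^bsub>quotient_module M N\<^esub> \<longleftrightarrow> x \<in> N"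
proof -
  interpret M: module A M by fact
  have sg: "subgroup N (add_monoid M)"
    using N by (simp add: submodule_def)
  interpret S: abelian_subgroup N M
    by (rule abelian_subgroupI3) (auto intro: additive_subgroupI sg M.abelian_group_axioms)
  note S = submoduleD[OF M N]
  let ?Q = "quotient_module M N"
  have carr: "carrier ?Q = (\<lambda>x. N +>\<^bsub>M\<^esub> x) ` carrier M"
    by (auto simp: quotient_module_def A_RCOSETS_def')
  have add: "(N +>\<^bsub>M\<^esub> x) \<oplus>\<^bsub>?Q\<^esub> (N +>\<^bsub>M\<^esub> y) = N +>\<^bsub>M\<^esub> (x \<oplus>\<^bsub>M\<^esub> y)"
    if "x \<in> carrier M" "y \<in> carrier M" for x y
    using that by (simp add: quotient_module_def S.a_rcos_sum)
  have coset_eqI: "N +>\<^bsub>M\<^esub> y = N +>\<^bsub>M\<^esub> x" if "x \<in> carrier M" "n \<in> N" "y = n \<oplus>\<^bsub>M\<^esub> x" for x y n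
  proof -
    have "y \<in> N +>\<^bsub>M\<^esub> x" using that by (auto simp: a_r_coset_def')
    then show ?thesis using M.a_repr_independence[OF _ that(1) sg] by simp
  qed
  have smult: "r \<odot>\<^bsub>?Q\<^esub> (N +>\<^bsub>M\<^esub> x) = N +>\<^bsub>M\<^esub> (r \<odot>\<^bsub>M\<^esub> x)" if "r \<in> carrier A" "x \<in> carrier M" for r x
  proof -
    \<comment> \<open>Scaling respects cosets, so the union in the definition of
      \<open>smult\<close> runs over equal sets; it is not empty because a coset contains its
      representative.\<close>
    have "N +>\<^bsub>M\<^esub> (r \<odot>\<^bsub>M\<^esub> y) = N +>\<^bsub>M\<^esub> (r \<odot>\<^bsub>M\<^esub> x)" if y: "y \<in> N +>\<^bsub>M\<^esub> x" for y
    proof -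
      from y obtain n where n: "n \<in> N" "y = n \<oplus>\<^bsub>M\<^esub> x" by (auto simp: a_r_coset_def')
      show ?thesis
        by (rule coset_eqI[of _ "r \<odot>\<^bsub>M\<^esub> n"])
          (use n S \<open>x \<in> carrier M\<close> \<open>r \<in> carrier A\<close> in \<open>auto simp: M.smult_r_distr subset_iff\<close>)
    qed
    then have "(\<Union>y\<in>N +>\<^bsub>M\<^esub> x. N +>\<^bsub>M\<^esub> (r \<odot>\<^bsub>M\<^esub> y)) = (\<Union>y\<in>N +>\<^bsub>M\<^esub> x. N +>\<^bsub>M\<^esub> (r \<odot>\<^bsub>M\<^esub> x))"
      by (rule SUP_cong[OF refl])
    also have "\<dots> = N +>\<^bsub>M\<^esub> (r \<odot>\<^bsub>M\<^esub> x)"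
      using S.a_rcos_self[OF \<open>x \<in> carrier M\<close>] by (intro SUP_const) blast
    finally show ?thesis by (simp add: quotient_module_def)
  qed
  have zero: "\<zero>\<^bsub>?Q\<^esub> = N +>\<^bsub>M\<^esub> \<zero>\<^bsub>M\<^esub>"
    by (simp add: quotient_module_def S)
  show Q: "module A ?Q"
  proof (rule moduleI)
    show "cring A" by (rule M.R.is_cring)
    show "abelian_group ?Q"
    proof (rule abelian_groupI)
      fix X assume "X \<in> carrier ?Q"
      then obtain y where "y \<in> carrier M" "X = N +>\<^bsub>M\<^esub> y" by (auto simp: carr)
      then show "\<exists>Y\<in>carrier ?Q. Y \<oplus>\<^bsub>?Q\<^esub> X = \<zero>\<^bsub>?Q\<^esub>"
        by (intro bexI[of _ "N +>\<^bsub>M\<^esub> (\<ominus>\<^bsub>M\<^esub> y)"]) (auto simp: carr add zero M.l_neg)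
    qed (auto simp: carr add zero M.add.m_ac)
  qed (auto simp: carr add smult M.smult_l_distr M.smult_r_distr M.smult_assoc1)
  show "(\<lambda>x\<in>carrier M. N +>\<^bsub>M\<^esub> x) \<in> mod_hom A M ?Q"
    by (rule restrict_mod_homI[OF M]) (auto simp: carr add smult)
  show "(\<lambda>x. N +>\<^bsub>M\<^esub> x) ` carrier M = carrier ?Q"
    by (simp add: carr)
  show "N +>\<^bsub>M\<^esub> x = \<zero>\<^bsub>?Q\<^esub> \<longleftrightarrow> x \<in> N" if "x \<in> carrier M"
  proof -
    have "\<zero>\<^bsub>?Q\<^esub> = N" by (simp add: quotient_module_def)
    then show ?thesis
      using M.a_coset_join1[OF _ that sg] M.a_coset_join2[OF that sg] by metis
  qed
qed

section \<open>Cohomology of complexes\<close>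

definition is_complex :: "'a ring \<Rightarrow> (nat \<Rightarrow> ('a, 'x) module) \<Rightarrow> (nat \<Rightarrow> 'x \<Rightarrow> 'x) \<Rightarrow> bool" where
  "is_complex A C d \<longleftrightarrow> (\<forall>n. module A (C n)) \<and> (\<forall>n. d n \<in> mod_hom A (C n) (C (Suc n))) \<and>
     (\<forall>n. \<forall>x\<in>carrier (C n). d (Suc n) (d n x) = \<zero>\<^bsub>C (Suc (Suc n))\<^esub>)"

definition cocyc :: "(nat \<Rightarrow> ('a, 'x) module) \<Rightarrow> (nat \<Rightarrow> 'x \<Rightarrow> 'x) \<Rightarrow> nat \<Rightarrow> 'x set" where
  "cocyc C d n = a_kernel (C n) (C (Suc n)) (d n)"

definition cobound :: "(nat \<Rightarrow> ('a, 'x) module) \<Rightarrow> (nat \<Rightarrow> 'x \<Rightarrow> 'x) \<Rightarrow> nat \<Rightarrow> 'x set" where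
  "cobound C d n = (case n of 0 \<Rightarrow> {\<zero>\<^bsub>C 0\<^esub>} | Suc m \<Rightarrow> d m ` carrier (C m))"

abbreviation cocyc_module ::
  "(nat \<Rightarrow> ('a, 'x) module) \<Rightarrow> (nat \<Rightarrow> 'x \<Rightarrow> 'x) \<Rightarrow> nat \<Rightarrow> ('a, 'x) module" where
  "cocyc_module C d n \<equiv> (C n)\<lparr>carrier := cocyc C d n\<rparr>"

text \<open>A presentation of degree \<open>n\<close> cohomology by cocycles modulo coboundaries.
  The elements of \<open>cohomology\<close> itself are cosets; a presentation allows
  \<open>H\<close> to be any isomorphic copy, in particular one inside the universe.\<close>

definition coh_rep :: "'a ring \<Rightarrow> (nat \<Rightarrow> ('a, 'x) module) \<Rightarrow> (nat \<Rightarrow> 'x \<Rightarrow> 'x) \<Rightarrow> nat \<Rightarrow>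
    ('a, 'y) module \<Rightarrow> ('x \<Rightarrow> 'y) \<Rightarrow> bool" where
  "coh_rep A C d n H \<pi> \<longleftrightarrow> module A H \<and> \<pi> \<in> mod_hom A (cocyc_module C d n) H \<and>
     \<pi> ` cocyc C d n = carrier H \<and>
     (\<forall>z\<in>cocyc C d n. \<pi> z = \<zero>\<^bsub>H\<^esub> \<longleftrightarrow> z \<in> cobound C d n)"

lemma cohomology_eq:
  "cohomology C d n = quotient_module (cocyc_module C d n) (cobound C d n)"
  by (simp add: cohomology_def cocyc_def cobound_def)

lemma cocyc_iff: "x \<in> cocyc C d n \<longleftrightarrow> x \<in> carrier (C n) \<and> d n x = \<zero>\<^bsub>C (Suc n)\<^esub>"
  by (simp add: cocyc_def a_kernel_def')

lemma cobound_0 [simp]: "cobound C d 0 = {\<zero>\<^bsub>C 0\<^esub>}"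
  and cobound_Suc [simp]: "cobound C d (Suc m) = d m ` carrier (C m)"
  by (simp_all add: cobound_def)

lemma is_complexD:
  assumes "is_complex A C d"
  shows "module A (C n)" "d n \<in> mod_hom A (C n) (C (Suc n))"
    "x \<in> carrier (C n) \<Longrightarrow> d (Suc n) (d n x) = \<zero>\<^bsub>C (Suc (Suc n))\<^esub>"
  using assms by (auto simp: is_complex_def)

lemma cocyc_submodule:
  assumes "is_complex A C d"
  shows "submodule (cocyc C d n) A (C n)"
  unfolding cocyc_def by (intro submodule_kernel is_complexD[OF assms])

lemma cocyc_module:
  assumes "is_complex A C d"
  shows "module A (cocyc_module C d n)"
  by (rule submodule.submodule_is_module[OF cocyc_submodule[OF assms] is_complexD(1)[OF assms]])

lemma cobound_submodule:
  assumes "is_complex A C d"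
  shows "submodule (cobound C d n) A (C n)"
proof (cases n)
  case 0
  then show ?thesis using submodule_zero is_complexD(1)[OF assms] by auto
next
  case (Suc m)
  then show ?thesis using submodule_image is_complexD[OF assms] by (metis cobound_Suc)
qed

lemma cobound_le_cocyc:
  assumes "is_complex A C d"
  shows "cobound C d n \<subseteq> cocyc C d n"
proof (cases n)
  case 0
  interpret C: module A "C k" for k by (rule is_complexD(1)[OF assms])
  show ?thesis
    using 0 mod_hom_zero[OF is_complexD(1,1,2)[OF assms], of 0] by (simp add: cocyc_iff)
next
  case (Suc m)
  then show ?thesis
    using is_complexD(3)[OF assms] mod_hom_closed[OF is_complexD(2)[OF assms]] by (auto simp: cocyc_iff)
qed

lemma cohomology_coh_rep:
  assumes C: "is_complex A C d"
  shows "\<exists>\<pi>. coh_rep A C d n (cohomology C d n) \<pi>"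
proof -
  interpret C: module A "C k" for k by (rule is_complexD(1)[OF C])
  note Z = cocyc_module[OF C, of n]
  note B = submoduleD[OF C.module_axioms cobound_submodule[OF C]]
  have sub: "submodule (cobound C d n) A (cocyc_module C d n)"
    by (rule submoduleI'[OF Z]) (use cobound_le_cocyc[OF C] B in auto)
  note Q = quotient_module[OF Z sub]
  define \<pi> where "\<pi> = (\<lambda>x\<in>carrier (cocyc_module C d n). cobound C d n +>\<^bsub>cocyc_module C d n\<^esub> x)"
  have "coh_rep A C d n (cohomology C d n) \<pi>"
    unfolding coh_rep_def cohomology_eq
  proof (intro conjI ballI)
    fix z assume "z \<in> cocyc C d n"
    then show "\<pi> z = \<zero>\<^bsub>quotient_module (cocyc_module C d n) (cobound C d n)\<^esub> \<longleftrightarrow> z \<in> cobound C d n"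
      using Q(4)[of z] by (simp add: \<pi>_def)
  qed (use Q(1-3) in \<open>simp_all add: \<pi>_def\<close>)
  then show ?thesis by blast
qed

lemma coh_repD:
  assumes "coh_rep A C d n H \<pi>"
  shows "module A H" "\<pi> \<in> mod_hom A (cocyc_module C d n) H" "\<pi> ` cocyc C d n = carrier H"
    "z \<in> cocyc C d n \<Longrightarrow> \<pi> z = \<zero>\<^bsub>H\<^esub> \<longleftrightarrow> z \<in> cobound C d n"
    "z \<in> cocyc C d n \<Longrightarrow> \<pi> z \<in> carrier H"
    "y \<in> carrier H \<Longrightarrow> \<exists>z\<in>cocyc C d n. \<pi> z = y"
proof -
  show *: "module A H" "\<pi> \<in> mod_hom A (cocyc_module C d n) H" "\<pi> ` cocyc C d n = carrier H"
    "z \<in> cocyc C d n \<Longrightarrow> \<pi> z = \<zero>\<^bsub>H\<^esub> \<longleftrightarrow> z \<in> cobound C d n"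
    using assms by (auto simp: coh_rep_def)
  show "z \<in> cocyc C d n \<Longrightarrow> \<pi> z \<in> carrier H" "y \<in> carrier H \<Longrightarrow> \<exists>z\<in>cocyc C d n. \<pi> z = y"
    unfolding *(3)[symmetric] by blast+
qed

lemma coh_rep_iso:
  assumes "coh_rep A C d n H \<pi>" "is_complex A C d" "module A H'" "mod_iso A H H'"
  shows "\<exists>\<pi>'. coh_rep A C d n H' \<pi>'"
proof -
  note H = coh_repD[OF assms(1)]
  interpret H: module A H by (rule H)
  obtain f where f: "f \<in> mod_hom A H H'" "bij_betw f (carrier H) (carrier H')"
    using assms by (auto simp: mod_iso_def)
  have surj: "f ` carrier H = carrier H'" and inj: "inj_on f (carrier H)"
    using f(2) by (auto simp: bij_betw_def)
  have f0: "f \<zero>\<^bsub>H\<^esub> = \<zero>\<^bsub>H'\<^esub>"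
    by (rule mod_hom_zero[OF H(1) assms(3) f(1)])
  define \<pi>' where "\<pi>' = (\<lambda>x\<in>carrier (cocyc_module C d n). f (\<pi> x))"
  have "coh_rep A C d n H' \<pi>'"
    unfolding coh_rep_def
  proof (intro conjI ballI)
    show "module A H'" by fact
    show "\<pi>' \<in> mod_hom A (cocyc_module C d n) H'"
      unfolding \<pi>'_def by (rule mod_hom_comp[OF cocyc_module[OF assms(2)] H(2) f(1)])
    show "\<pi>' ` cocyc C d n = carrier H'"
      unfolding \<pi>'_def surj[symmetric] H(3)[symmetric] by (simp add: image_image)
    fix z assume z: "z \<in> cocyc C d n"
    show "\<pi>' z = \<zero>\<^bsub>H'\<^esub> \<longleftrightarrow> z \<in> cobound C d n"
      using inj_onD[OF inj, of "\<pi> z" "\<zero>\<^bsub>H\<^esub>"] H(5)[OF z] H(4)[OF z] f0 z by (auto simp: \<pi>'_def)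
  qed
  then show ?thesis by blast
qed

text \<open>The two degrees are independent so that the connecting map, which raises the degree by
  one, is an instance.\<close>

lemma coh_rep_map:
  assumes C: "is_complex A C d" and C': "is_complex A C' d'"
    and H: "coh_rep A C d n H \<pi>" and H': "coh_rep A C' d' m H' \<pi>'"
    and f: "f \<in> mod_hom A (C n) (C' m)"
    and Z: "\<And>z. z \<in> cocyc C d n \<Longrightarrow> f z \<in> cocyc C' d' m"
    and B: "\<And>z. z \<in> cobound C d n \<Longrightarrow> f z \<in> cobound C' d' m"
  shows "\<exists>h\<in>mod_hom A H H'. \<forall>z\<in>cocyc C d n. h (\<pi> z) = \<pi>' (f z)"
proof -
  note H = coh_repD[OF H] and H' = coh_repD[OF H']
  have f': "restrict f (cocyc C d n) \<in> mod_hom A (cocyc_module C d n) (cocyc_module C' d' m)"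
    by (rule mod_hom_submodule[OF f]) (use Z cocyc_submodule[OF C] is_complexD(1)[OF C] in \<open>auto simp: cocyc_iff\<close>)
  have "\<exists>h\<in>mod_hom A H H'. \<forall>z\<in>carrier (cocyc_module C d n). h (\<pi> z) =
      (\<lambda>z\<in>carrier (cocyc_module C d n). \<pi>' (restrict f (cocyc C d n) z)) z"
    by (rule mod_hom_factor[OF cocyc_module[OF C] H(1) H'(1) H(2) _ mod_hom_comp[OF cocyc_module[OF C] f' H'(2)]])
      (use H(3,4) H'(4) Z B in auto)
  then show ?thesis by auto
qed

text \<open>Here \<open>i\<close> and \<open>p\<close> are chain maps, whereas \<open>q\<close> and
  \<open>j\<close> split the sequence in each degree separately and need not commute with the
  differentials. Every condition is an equation between composites and sums of morphisms, so an
  additive functor preserves it; plain exactness would not survive a functor that is only left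
  exact.\<close>

locale split_ses =
  fixes A :: "'a ring" and W :: "nat \<Rightarrow> ('a, 'w) module" and dW
    and Z :: "nat \<Rightarrow> ('a, 'z) module" and dZ
    and X :: "nat \<Rightarrow> ('a, 'x) module" and dX
    and i p q j
  assumes W: "is_complex A W dW" and Z: "is_complex A Z dZ" and X: "is_complex A X dX"
    and i: "i n \<in> mod_hom A (W n) (Z n)" and p: "p n \<in> mod_hom A (Z n) (X n)"
    and q: "q n \<in> mod_hom A (Z n) (W n)" and j: "j n \<in> mod_hom A (X n) (Z n)"
    and i_chain: "w \<in> carrier (W n) \<Longrightarrow> dZ n (i n w) = i (Suc n) (dW n w)"
    and p_chain: "z \<in> carrier (Z n) \<Longrightarrow> dX n (p n z) = p (Suc n) (dZ n z)"
    and qi: "w \<in> carrier (W n) \<Longrightarrow> q n (i n w) = w"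
    and pj: "x \<in> carrier (X n) \<Longrightarrow> p n (j n x) = x"
    and pi: "w \<in> carrier (W n) \<Longrightarrow> p n (i n w) = \<zero>\<^bsub>X n\<^esub>"
    and split: "z \<in> carrier (Z n) \<Longrightarrow> i n (q n z) \<oplus>\<^bsub>Z n\<^esub> j n (p n z) = z"
begin

sublocale W: module A "W n" for n by (rule is_complexD(1)[OF W])
sublocale Z: module A "Z n" for n by (rule is_complexD(1)[OF Z])
sublocale X: module A "X n" for n by (rule is_complexD(1)[OF X])

lemmas hom_rules =
  mod_hom_closed[OF i] mod_hom_closed[OF p] mod_hom_closed[OF q] mod_hom_closed[OF j]
  mod_hom_closed[OF is_complexD(2)[OF W]] mod_hom_closed[OF is_complexD(2)[OF Z]] mod_hom_closed[OF is_complexD(2)[OF X]]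
  mod_hom_zero[OF W.module_axioms Z.module_axioms i] mod_hom_zero[OF Z.module_axioms X.module_axioms p]
  mod_hom_zero[OF Z.module_axioms W.module_axioms q] mod_hom_zero[OF X.module_axioms Z.module_axioms j]
  mod_hom_zero[OF W.module_axioms W.module_axioms is_complexD(2)[OF W]]
  mod_hom_zero[OF Z.module_axioms Z.module_axioms is_complexD(2)[OF Z]]
  mod_hom_zero[OF X.module_axioms X.module_axioms is_complexD(2)[OF X]]

lemmas hom_add_rules =
  mod_hom_uminus[OF Z.module_axioms Z.module_axioms is_complexD(2)[OF Z]]
  mod_hom_add[OF i] mod_hom_add[OF p] mod_hom_add[OF q] mod_hom_add[OF j]
  mod_hom_add[OF is_complexD(2)[OF W]] mod_hom_add[OF is_complexD(2)[OF Z]] mod_hom_add[OF is_complexD(2)[OF X]]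
  mod_hom_minus[OF W.module_axioms Z.module_axioms i] mod_hom_minus[OF Z.module_axioms X.module_axioms p]
  mod_hom_minus[OF Z.module_axioms W.module_axioms q] mod_hom_minus[OF X.module_axioms Z.module_axioms j]
  mod_hom_minus[OF W.module_axioms W.module_axioms is_complexD(2)[OF W]]
  mod_hom_minus[OF Z.module_axioms Z.module_axioms is_complexD(2)[OF Z]]
  mod_hom_minus[OF X.module_axioms X.module_axioms is_complexD(2)[OF X]]

lemmas dd_rules = is_complexD(3)[OF W] is_complexD(3)[OF Z] is_complexD(3)[OF X]

lemma i_cancel: "w \<in> carrier (W n) \<Longrightarrow> w' \<in> carrier (W n) \<Longrightarrow> i n w = i n w' \<longleftrightarrow> w = w'"
  using qi by metis

lemma i_eq_zero: "w \<in> carrier (W n) \<Longrightarrow> i n w = \<zero>\<^bsub>Z n\<^esub> \<longleftrightarrow> w = \<zero>\<^bsub>W n\<^esub>"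
  using i_cancel[of w n "\<zero>\<^bsub>W n\<^esub>"] by (simp add: hom_rules)

lemma ker_p: "z \<in> carrier (Z n) \<Longrightarrow> p n z = \<zero>\<^bsub>X n\<^esub> \<Longrightarrow> i n (q n z) = z"
  using split[of z n] by (simp add: hom_rules)

text \<open>The connecting map of the snake lemma. The splitting makes it a formula on all cochains,
  with \<open>j\<close> choosing the preimage and \<open>q\<close> undoing \<open>i\<close>, rather
  than a choice made for each cocycle.\<close>

definition delta where "delta n = (\<lambda>x\<in>carrier (X n). q (Suc n) (dZ n (j n x)))"

lemma delta_hom: "delta n \<in> mod_hom A (X n) (W (Suc n))"
proof -
  have "(\<lambda>x\<in>carrier (X n). dZ n (j n x)) \<in> mod_hom A (X n) (Z (Suc n))"
    by (rule mod_hom_comp[OF X.module_axioms j is_complexD(2)[OF Z]])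
  from mod_hom_comp[OF X.module_axioms this q] show ?thesis
    by (simp add: delta_def cong: restrict_cong)
qed

text \<open>\<open>dZ n (j n x)\<close> lies in the kernel of \<open>p\<close> because
  \<open>p\<close> is a chain map and \<open>x\<close> a cocycle, and on that kernel
  \<open>i\<close> after \<open>q\<close> is the identity.\<close>

lemma i_delta:
  assumes "x \<in> cocyc X dX n"
  shows "i (Suc n) (delta n x) = dZ n (j n x)"
proof -
  have "p (Suc n) (dZ n (j n x)) = dX n (p n (j n x))"
    using assms by (simp add: p_chain hom_rules cocyc_iff)
  then show ?thesis
    using assms by (simp add: delta_def ker_p hom_rules pj cocyc_iff)
qed

lemma delta_cocyc:
  assumes "x \<in> cocyc X dX n"
  shows "delta n x \<in> cocyc W dW (Suc n)"
proof -
  have x: "x \<in> carrier (X n)" using assms by (simp add: cocyc_iff)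
  have "i (Suc (Suc n)) (dW (Suc n) (delta n x)) = \<zero>\<^bsub>Z (Suc (Suc n))\<^esub>"
    using i_delta[OF assms] x
    by (simp add: i_chain[symmetric] mod_hom_closed[OF delta_hom] dd_rules hom_rules)
  then show ?thesis
    using x by (simp add: i_eq_zero hom_rules mod_hom_closed[OF delta_hom] cocyc_iff)
qed

lemma delta_cobound:
  assumes "x \<in> cobound X dX n"
  shows "delta n x \<in> cobound W dW (Suc n)"
proof (cases n)
  case 0
  then show ?thesis
    using assms mod_hom_zero[OF X.module_axioms W.module_axioms delta_hom, of 0]
      submoduleD(2)[OF W.module_axioms cobound_submodule[OF W], of "Suc 0"] by simp
next
  case (Suc m)
  then obtain x' where x': "x' \<in> carrier (X m)" "x = dX m x'"
    using assms by auto
  have xZ: "x \<in> cocyc X dX n" using x' Suc by (simp add: cocyc_iff dd_rules hom_rules)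
  \<comment> \<open>\<open>z\<close> is a cocycle over \<open>x\<close>, and \<open>j n x\<close> is
    another element over \<open>x\<close>. They differ by \<open>i n (q n z)\<close>, so
    \<open>delta n x\<close> is, up to sign, the coboundary of \<open>q n z\<close>.\<close>
  define z where "z = dZ m (j m x')"
  have z: "z \<in> carrier (Z n)" "p n z = x" "dZ n z = \<zero>\<^bsub>Z (Suc n)\<^esub>"
    using x' Suc by (simp_all add: z_def hom_rules p_chain[symmetric] pj dd_rules)
  have x: "x \<in> carrier (X n)" using xZ by (simp add: cocyc_iff)
  have "j n x = z \<ominus>\<^bsub>Z n\<^esub> i n (q n z)"
    using split[OF z(1)] z x by (metis Z.minus_cancel(4) hom_rules(1,3,4))
  then have "dZ n (j n x) = \<ominus>\<^bsub>Z (Suc n)\<^esub> i (Suc n) (dW n (q n z))"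
    using z by (simp add: hom_add_rules hom_rules i_chain Z.minus_eq)
  then have "delta n x = \<ominus>\<^bsub>W (Suc n)\<^esub> dW n (q n z)"
    using x z by (simp add: delta_def mod_hom_uminus[OF Z.module_axioms W.module_axioms q] hom_rules qi)
  also have "\<dots> = dW n (\<ominus>\<^bsub>W n\<^esub> q n z)"
    using z by (simp add: mod_hom_uminus[OF W.module_axioms W.module_axioms is_complexD(2)[OF W]] hom_rules)
  finally show ?thesis
    using z by (auto simp: hom_rules)
qed

theorem long_exact_sequence:
  assumes HW: "\<And>n. coh_rep A W dW n (HW n) (\<pi>W n)"
    and HZ: "\<And>n. coh_rep A Z dZ n (HZ n) (\<pi>Z n)"
    and HX: "\<And>n. coh_rep A X dX n (HX n) (\<pi>X n)"
  obtains f g h where "\<And>n. f n \<in> mod_hom A (HW n) (HZ n)" "\<And>n. g n \<in> mod_hom A (HZ n) (HX n)"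
    "\<And>n. h n \<in> mod_hom A (HX n) (HW (Suc n))"
    "\<And>n. f n ` carrier (HW n) = a_kernel (HZ n) (HX n) (g n)"
    "\<And>n. g n ` carrier (HZ n) = a_kernel (HX n) (HW (Suc n)) (h n)"
    "\<And>n. h n ` carrier (HX n) = a_kernel (HW (Suc n)) (HZ (Suc n)) (f (Suc n))"
    "a_kernel (HW 0) (HZ 0) (f 0) = {\<zero>\<^bsub>HW 0\<^esub>}"
proof -
  note HW' = coh_repD[OF HW] and HZ' = coh_repD[OF HZ] and HX' = coh_repD[OF HX]
  interpret HW: module A "HW n" for n by (rule HW')
  interpret HZ: module A "HZ n" for n by (rule HZ')
  interpret HX: module A "HX n" for n by (rule HX')
  have iZ: "i n w \<in> cocyc Z dZ n" if "w \<in> cocyc W dW n" for n w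
    using that by (simp add: cocyc_iff hom_rules i_chain)
  have iB: "i n w \<in> cobound Z dZ n" if "w \<in> cobound W dW n" for n w
    using that by (cases n) (auto simp: hom_rules i_chain[symmetric])
  have pZ: "p n w \<in> cocyc X dX n" if "w \<in> cocyc Z dZ n" for n w
    using that by (simp add: cocyc_iff hom_rules p_chain)
  have pB: "p n w \<in> cobound X dX n" if "w \<in> cobound Z dZ n" for n w
    using that by (cases n) (auto simp: hom_rules p_chain[symmetric])
  have "\<forall>n. \<exists>h. h \<in> mod_hom A (HW n) (HZ n) \<and> (\<forall>z\<in>cocyc W dW n. h (\<pi>W n z) = \<pi>Z n (i n z))"
    using coh_rep_map[OF W Z HW HZ i iZ iB] by blast
  then obtain f where f: "\<And>n. f n \<in> mod_hom A (HW n) (HZ n)"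
      "\<And>n z. z \<in> cocyc W dW n \<Longrightarrow> f n (\<pi>W n z) = \<pi>Z n (i n z)" by metis
  have "\<forall>n. \<exists>h. h \<in> mod_hom A (HZ n) (HX n) \<and> (\<forall>z\<in>cocyc Z dZ n. h (\<pi>Z n z) = \<pi>X n (p n z))"
    using coh_rep_map[OF Z X HZ HX p pZ pB] by blast
  then obtain g where g: "\<And>n. g n \<in> mod_hom A (HZ n) (HX n)"
      "\<And>n z. z \<in> cocyc Z dZ n \<Longrightarrow> g n (\<pi>Z n z) = \<pi>X n (p n z)" by metis
  have "\<forall>n. \<exists>h. h \<in> mod_hom A (HX n) (HW (Suc n)) \<and> (\<forall>z\<in>cocyc X dX n. h (\<pi>X n z) = \<pi>W (Suc n) (delta n z))"
    using coh_rep_map[OF X W HX HW delta_hom delta_cocyc delta_cobound] by blast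
  then obtain h where h: "\<And>n. h n \<in> mod_hom A (HX n) (HW (Suc n))"
      "\<And>n z. z \<in> cocyc X dX n \<Longrightarrow> h n (\<pi>X n z) = \<pi>W (Suc n) (delta n z)" by metis
  have \<pi>W_eqI: "\<pi>W n w = \<pi>W n w'" if "w \<in> cocyc W dW n" "w' \<in> cocyc W dW n" "w \<ominus>\<^bsub>W n\<^esub> w' \<in> cobound W dW n" for n w w'
  proof -
    interpret ZW: module A "cocyc_module W dW n" by (rule cocyc_module[OF W])
    have *: "w \<ominus>\<^bsub>W n\<^esub> w' = w \<ominus>\<^bsub>cocyc_module W dW n\<^esub> w'"
      using that by (simp add: a_minus_def a_inv_carrier_update[OF W.module_axioms cocyc_submodule[OF W]])
    have "\<pi>W n (w \<ominus>\<^bsub>cocyc_module W dW n\<^esub> w') = \<zero>\<^bsub>HW n\<^esub>"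
      using that HW'(4) cobound_le_cocyc[OF W, of n] unfolding * by blast
    then show ?thesis
      using that by (simp add: mod_hom_minus[OF ZW.module_axioms HW'(1) HW'(2)] HW.minus_eq_zero_iff HW'(5))
  qed
  have \<pi>Z_eqI: "\<pi>Z n w = \<pi>Z n w'" if "w \<in> cocyc Z dZ n" "w' \<in> cocyc Z dZ n" "w \<ominus>\<^bsub>Z n\<^esub> w' \<in> cobound Z dZ n" for n w w'
  proof -
    interpret ZZ: module A "cocyc_module Z dZ n" by (rule cocyc_module[OF Z])
    have *: "w \<ominus>\<^bsub>Z n\<^esub> w' = w \<ominus>\<^bsub>cocyc_module Z dZ n\<^esub> w'"
      using that by (simp add: a_minus_def a_inv_carrier_update[OF Z.module_axioms cocyc_submodule[OF Z]])
    have "\<pi>Z n (w \<ominus>\<^bsub>cocyc_module Z dZ n\<^esub> w') = \<zero>\<^bsub>HZ n\<^esub>"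
      using that HZ'(4) cobound_le_cocyc[OF Z, of n] unfolding * by blast
    then show ?thesis
      using that by (simp add: mod_hom_minus[OF ZZ.module_axioms HZ'(1) HZ'(2)] HZ.minus_eq_zero_iff HZ'(5))
  qed
  have exZ: "f n ` carrier (HW n) = a_kernel (HZ n) (HX n) (g n)" for n
  proof (intro equalityI subsetI)
    fix y assume "y \<in> f n ` carrier (HW n)"
    then obtain w where w: "w \<in> cocyc W dW n" "y = f n (\<pi>W n w)"
      unfolding HW'(3)[symmetric] by blast
    have "g n y = \<pi>X n \<zero>\<^bsub>X n\<^esub>" using w iZ by (simp add: f g pi cocyc_iff)
    also have "\<dots> = \<zero>\<^bsub>HX n\<^esub>"
      using submoduleD(2)[OF X.module_axioms cobound_submodule[OF X]]
        submoduleD(2)[OF X.module_axioms cocyc_submodule[OF X]] by (simp add: HX'(4))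
    finally show "y \<in> a_kernel (HZ n) (HX n) (g n)"
      using w HW'(5) mod_hom_closed[OF f(1)] by (simp add: a_kernel_def')
  next
    fix y assume "y \<in> a_kernel (HZ n) (HX n) (g n)"
    then obtain z where z: "z \<in> cocyc Z dZ n" "y = \<pi>Z n z" "g n y = \<zero>\<^bsub>HX n\<^esub>"
      using HZ'(6) by (auto simp: a_kernel_def')
    have zc: "z \<in> carrier (Z n)" using z by (simp add: cocyc_iff)
    have "p n z \<in> cobound X dX n" using z pZ by (simp add: g HX'(4))
    \<comment> \<open>The class of \<open>z\<close> maps to zero, so \<open>p n z\<close> is a
      coboundary. Lifting through \<open>j\<close> one degree lower gives a coboundary of
      \<open>Z\<close> over it, and subtracting that moves \<open>z\<close> into the kernel of
      \<open>p\<close> without changing its class.\<close>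
    then have "\<exists>b\<in>cobound Z dZ n. p n b = p n z"
    proof (cases n)
      case 0
      with \<open>p n z \<in> cobound X dX n\<close> show ?thesis by (simp add: hom_rules)
    next
      case (Suc m)
      with \<open>p n z \<in> cobound X dX n\<close> obtain x where "x \<in> carrier (X m)" "p n z = dX m x" by auto
      with Suc show ?thesis
        by (intro bexI[of _ "dZ m (j m x)"]) (auto simp: hom_rules p_chain[symmetric] pj)
    qed
    then obtain b where b: "b \<in> cobound Z dZ n" "p n b = p n z" by blast
    have bc: "b \<in> cocyc Z dZ n" "b \<in> carrier (Z n)"
      using b cobound_le_cocyc[OF Z, of n] by (auto simp: cocyc_iff subset_iff)
    define u where "u = z \<ominus>\<^bsub>Z n\<^esub> b"
    have u: "u \<in> cocyc Z dZ n"
      using submoduleD(6)[OF Z.module_axioms cocyc_submodule[OF Z]] z bc by (simp add: u_def)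
    then have uc: "u \<in> carrier (Z n)" by (simp add: cocyc_iff)
    have "p n u = \<zero>\<^bsub>X n\<^esub>"
      using zc bc b by (simp add: u_def hom_add_rules hom_rules X.minus_eq_zero_iff)
    then have iu: "i n (q n u) = u" by (simp add: uc ker_p)
    have "i (Suc n) (dW n (q n u)) = \<zero>\<^bsub>Z (Suc n)\<^esub>"
      using u uc iu by (simp add: i_chain[symmetric] hom_rules cocyc_iff)
    then have qu: "q n u \<in> cocyc W dW n" using uc by (simp add: i_eq_zero hom_rules cocyc_iff)
    have "y = f n (\<pi>W n (q n u))"
      unfolding f(2)[OF qu] iu z(2)
      by (rule \<pi>Z_eqI) (use z u b zc bc in \<open>simp_all add: u_def Z.minus_cancel\<close>)
    then show "y \<in> f n ` carrier (HW n)" using qu HW'(5) by blast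
  qed
  have exX: "g n ` carrier (HZ n) = a_kernel (HX n) (HW (Suc n)) (h n)" for n
  proof (intro equalityI subsetI)
    fix y assume "y \<in> g n ` carrier (HZ n)"
    then obtain z where z: "z \<in> cocyc Z dZ n" "y = g n (\<pi>Z n z)"
      unfolding HZ'(3)[symmetric] by blast
    have zc: "z \<in> carrier (Z n)" using z by (simp add: cocyc_iff)
    have "j n (p n z) = z \<ominus>\<^bsub>Z n\<^esub> i n (q n z)"
      using split[OF zc] zc by (metis Z.minus_cancel(4) hom_rules(1,2,3,4))
    then have "dZ n (j n (p n z)) = \<ominus>\<^bsub>Z (Suc n)\<^esub> i (Suc n) (dW n (q n z))"
      using z zc by (simp add: hom_add_rules hom_rules i_chain Z.minus_eq cocyc_iff)
    then have "delta n (p n z) = \<ominus>\<^bsub>W (Suc n)\<^esub> dW n (q n z)"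
      using zc by (simp add: delta_def mod_hom_uminus[OF Z.module_axioms W.module_axioms q] hom_rules qi)
    also have "\<dots> = dW n (\<ominus>\<^bsub>W n\<^esub> q n z)"
      using zc by (simp add: mod_hom_uminus[OF W.module_axioms W.module_axioms is_complexD(2)[OF W]] hom_rules)
    finally have "delta n (p n z) \<in> cobound W dW (Suc n)"
      using zc by (auto simp: hom_rules)
    then have "h n y = \<zero>\<^bsub>HW (Suc n)\<^esub>"
      using z pZ delta_cocyc by (simp add: g h HW'(4))
    then show "y \<in> a_kernel (HX n) (HW (Suc n)) (h n)"
      using z HZ'(5) mod_hom_closed[OF g(1)] by (simp add: a_kernel_def')
  next
    fix y assume "y \<in> a_kernel (HX n) (HW (Suc n)) (h n)"
    then obtain x where x: "x \<in> cocyc X dX n" "y = \<pi>X n x" "h n y = \<zero>\<^bsub>HW (Suc n)\<^esub>"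
      using HX'(6) by (auto simp: a_kernel_def')
    have xc: "x \<in> carrier (X n)" using x by (simp add: cocyc_iff)
    have "delta n x \<in> cobound W dW (Suc n)"
      using x delta_cocyc by (simp add: h HW'(4))
    then obtain w where w: "w \<in> carrier (W n)" "delta n x = dW n w" by auto
    \<comment> \<open>\<open>j n x\<close> need not be a cocycle, but its differential is
      \<open>i\<close> applied to \<open>delta n x = dW n w\<close>; subtracting
      \<open>i n w\<close> corrects this without changing the image under \<open>p\<close>.\<close>
    define z where "z = j n x \<ominus>\<^bsub>Z n\<^esub> i n w"
    have "dZ n z = \<zero>\<^bsub>Z (Suc n)\<^esub>"
      using w xc i_delta[OF x(1)] by (simp add: z_def hom_add_rules hom_rules i_chain Z.minus_eq_zero_iff)
    then have z: "z \<in> cocyc Z dZ n" using w xc by (simp add: z_def cocyc_iff hom_rules)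
    have "p n z = x" using w xc by (simp add: z_def hom_add_rules hom_rules pi pj X.minus_eq)
    then show "y \<in> g n ` carrier (HZ n)"
      using x z HZ'(5) g(2) by (metis imageI)
  qed
  have exW: "h n ` carrier (HX n) = a_kernel (HW (Suc n)) (HZ (Suc n)) (f (Suc n))" for n
  proof (intro equalityI subsetI)
    fix y assume "y \<in> h n ` carrier (HX n)"
    then obtain x where x: "x \<in> cocyc X dX n" "y = h n (\<pi>X n x)"
      unfolding HX'(3)[symmetric] by blast
    have xc: "x \<in> carrier (X n)" using x by (simp add: cocyc_iff)
    have "i (Suc n) (delta n x) \<in> cobound Z dZ (Suc n)"
      using xc i_delta[OF x(1)] by (auto simp: hom_rules)
    then have "f (Suc n) y = \<zero>\<^bsub>HZ (Suc n)\<^esub>"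
      using x delta_cocyc iZ by (simp add: h f HZ'(4))
    then show "y \<in> a_kernel (HW (Suc n)) (HZ (Suc n)) (f (Suc n))"
      using x HX'(5) mod_hom_closed[OF h(1)] by (simp add: a_kernel_def')
  next
    fix y assume "y \<in> a_kernel (HW (Suc n)) (HZ (Suc n)) (f (Suc n))"
    then obtain w where w: "w \<in> cocyc W dW (Suc n)" "y = \<pi>W (Suc n) w" "f (Suc n) y = \<zero>\<^bsub>HZ (Suc n)\<^esub>"
      using HW'(6) by (auto simp: a_kernel_def')
    have wc: "w \<in> carrier (W (Suc n))" using w by (simp add: cocyc_iff)
    have "i (Suc n) w \<in> cobound Z dZ (Suc n)"
      using w iZ by (simp add: f HZ'(4))
    then obtain z where z: "z \<in> carrier (Z n)" "dZ n z = i (Suc n) w" by auto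
    \<comment> \<open>A class killed by \<open>f\<close> is represented by some \<open>w\<close>
      with \<open>i w = dZ z\<close>. Then \<open>p n z\<close> is a cocycle that
      \<open>delta\<close> sends to \<open>w\<close> minus a coboundary, so it represents a preimage
      of the class of \<open>w\<close>.\<close>
    have x: "p n z \<in> cocyc X dX n"
      using z wc by (simp add: cocyc_iff hom_rules p_chain pi)
    have "j n (p n z) = z \<ominus>\<^bsub>Z n\<^esub> i n (q n z)"
      using split[OF z(1)] z by (metis Z.minus_cancel(4) hom_rules(1,2,3,4))
    then have "delta n (p n z) = w \<ominus>\<^bsub>W (Suc n)\<^esub> dW n (q n z)"
      using z wc by (simp add: delta_def hom_rules hom_add_rules i_chain qi)
    then have "w \<ominus>\<^bsub>W (Suc n)\<^esub> delta n (p n z) = dW n (q n z)"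
      using z wc by (simp add: hom_rules W.minus_cancel)
    then have "\<pi>W (Suc n) w = \<pi>W (Suc n) (delta n (p n z))"
      using w x z delta_cocyc by (intro \<pi>W_eqI) (auto simp: hom_rules)
    then show "y \<in> h n ` carrier (HX n)"
      using w x HX'(5) h(2) by (metis imageI)
  qed
  \<comment> \<open>The only coboundary of \<open>Z\<close> in degree \<open>0\<close> is zero, so a
    class killed by \<open>f 0\<close> has a representative \<open>w\<close> with
    \<open>i 0 w\<close> equal to zero.\<close>
  have "a_kernel (HW 0) (HZ 0) (f 0) = {\<zero>\<^bsub>HW 0\<^esub>}"
  proof (intro equalityI subsetI)
    fix y assume "y \<in> a_kernel (HW 0) (HZ 0) (f 0)"
    then obtain w where w: "w \<in> cocyc W dW 0" "y = \<pi>W 0 w" "f 0 y = \<zero>\<^bsub>HZ 0\<^esub>"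
      using HW'(6) by (auto simp: a_kernel_def')
    then have "i 0 w = \<zero>\<^bsub>Z 0\<^esub>"
      using iZ HZ'(4)[of "i 0 w" 0] by (simp add: f hom_rules)
    then have "w = \<zero>\<^bsub>W 0\<^esub>" using w by (simp add: i_eq_zero cocyc_iff)
    then show "y \<in> {\<zero>\<^bsub>HW 0\<^esub>}" using w HW'(4)[OF w(1)] by simp
  next
    fix y assume "y \<in> {\<zero>\<^bsub>HW 0\<^esub>}"
    then show "y \<in> a_kernel (HW 0) (HZ 0) (f 0)"
      using mod_hom_zero[OF HW.module_axioms HZ.module_axioms f(1), of 0] by (simp add: a_kernel_def')
  qed
  with that f(1) g(1) h(1) exZ exX exW show ?thesis by blast
qed

end

section \<open>Injective resolutions and derived functors\<close>

lemma injective_moduleD: "injective_module A E \<Longrightarrow> module A E"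
  by (simp add: injective_module_def)

text \<open>\<open>injective_module\<close> speaks of extension along injections. Factoring
  \<open>f\<close> through the image of \<open>j\<close> gives extension along any \<open>j\<close>
  whose kernel is killed by \<open>f\<close>, which is the form that the differentials of a
  resolution call for.\<close>

lemma injective_extend:
  fixes E X Y :: "('a, 'u) module"
  assumes E: "injective_module A E" and X: "module A X" and Y: "module A Y"
    and j: "j \<in> mod_hom A X Y" and f: "f \<in> mod_hom A X E"
    and le: "\<And>x. x \<in> carrier X \<Longrightarrow> j x = \<zero>\<^bsub>Y\<^esub> \<Longrightarrow> f x = \<zero>\<^bsub>E\<^esub>"
  shows "\<exists>g\<in>mod_hom A Y E. \<forall>x\<in>carrier X. g (j x) = f x"
proof -
  note E' = injective_moduleD[OF E]
  define J where "J = Y\<lparr>carrier := j ` carrier X\<rparr>"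
  have sub: "submodule (j ` carrier X) A Y" by (rule submodule_image[OF X Y j])
  have J: "module A J"
    unfolding J_def by (rule submodule.submodule_is_module[OF sub Y])
  have j': "j \<in> mod_hom A X J" and surj: "j ` carrier X = carrier J"
    using j by (auto simp: mod_hom_def J_def)
  have "\<exists>h\<in>mod_hom A J E. \<forall>z\<in>carrier X. h (j z) = f z"
    by (rule mod_hom_factor[OF X J E' j' surj f]) (use le in \<open>simp add: J_def\<close>)
  then obtain h where h: "h \<in> mod_hom A J E" "\<And>x. x \<in> carrier X \<Longrightarrow> h (j x) = f x" by blast
  have le': "j ` carrier X \<subseteq> carrier Y" using submoduleD(1)[OF Y sub] .
  have inc: "(\<lambda>x\<in>carrier J. x) \<in> mod_hom A J Y"
    by (rule restrict_mod_homI[OF J]) (use le' in \<open>auto simp: J_def\<close>)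
  have "\<exists>g\<in>mod_hom A Y E. \<forall>x\<in>carrier J. g ((\<lambda>x\<in>carrier J. x) x) = h x"
    by (rule E[unfolded injective_module_def, THEN conjunct2, rule_format])
      (intro conjI J Y inc h(1), simp add: inj_on_def)
  then obtain g where g: "g \<in> mod_hom A Y E" "\<And>x. x \<in> carrier J \<Longrightarrow> g x = h x" by auto
  have "g (j x) = f x" if "x \<in> carrier X" for x
    using g(2)[of "j x"] h(2)[OF that] that by (simp add: J_def)
  with g(1) show ?thesis by blast
qed

lemma injective_resolutionD:
  assumes "injective_resolution A M I d \<epsilon>"
  shows "injective_module A (I n)" "module A (I n)" "\<epsilon> \<in> mod_hom A M (I 0)"
    "d n \<in> mod_hom A (I n) (I (Suc n))" "inj_on \<epsilon> (carrier M)"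
    "x \<in> carrier (I 0) \<Longrightarrow> d 0 x = \<zero>\<^bsub>I 1\<^esub> \<longleftrightarrow> x \<in> \<epsilon> ` carrier M"
    "y \<in> carrier (I (Suc n)) \<Longrightarrow> d (Suc n) y = \<zero>\<^bsub>I (Suc (Suc n))\<^esub> \<longleftrightarrow> y \<in> d n ` carrier (I n)"
    "is_complex A I d"
proof -
  show inj: "injective_module A (I n)" for n
    using assms by (simp add: injective_resolution_def)
  show mods: "module A (I n)" for n
    by (rule injective_moduleD[OF inj])
  have e: "\<epsilon> ` carrier M = a_kernel (I 0) (I 1) (d 0)"
    and ex: "\<And>n. d n ` carrier (I n) = a_kernel (I (Suc n)) (I (Suc (Suc n))) (d (Suc n))"
    and d: "\<And>n. d n \<in> mod_hom A (I n) (I (Suc n))"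
    using assms by (simp_all add: injective_resolution_def)
  show "\<epsilon> \<in> mod_hom A M (I 0)" "inj_on \<epsilon> (carrier M)" "d n \<in> mod_hom A (I n) (I (Suc n))"
    using assms by (simp_all add: injective_resolution_def)
  show "x \<in> carrier (I 0) \<Longrightarrow> d 0 x = \<zero>\<^bsub>I 1\<^esub> \<longleftrightarrow> x \<in> \<epsilon> ` carrier M"
    unfolding e by (simp add: a_kernel_def')
  show "y \<in> carrier (I (Suc n)) \<Longrightarrow> d (Suc n) y = \<zero>\<^bsub>I (Suc (Suc n))\<^esub> \<longleftrightarrow> y \<in> d n ` carrier (I n)"
    unfolding ex by (simp add: a_kernel_def')
  have "d (Suc n) (d n x) = \<zero>\<^bsub>I (Suc (Suc n))\<^esub>" if "x \<in> carrier (I n)" for n x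
  proof -
    have "d n x \<in> a_kernel (I (Suc n)) (I (Suc (Suc n))) (d (Suc n))"
      unfolding ex[symmetric] using that by blast
    then show ?thesis by (simp add: a_kernel_def')
  qed
  then show "is_complex A I d"
    using d mods by (simp add: is_complex_def)
qed

section \<open>Comparison of injective resolutions: lifts and homotopies\<close>

definition chain_map where
  "chain_map A I d J d' \<phi> \<longleftrightarrow> (\<forall>n. \<phi> n \<in> mod_hom A (I n) (J n)) \<and>
     (\<forall>n. \<forall>x\<in>carrier (I n). \<phi> (Suc n) (d n x) = d' n (\<phi> n x))"

lemma chain_mapD:
  assumes "chain_map A I d J d' \<phi>"
  shows "\<phi> n \<in> mod_hom A (I n) (J n)" "x \<in> carrier (I n) \<Longrightarrow> \<phi> (Suc n) (d n x) = d' n (\<phi> n x)"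
  using assms by (auto simp: chain_map_def)

lemma lift_exists:
  fixes M N :: "('a, 'u) module"
  assumes I: "injective_resolution A M I d \<epsilon>" and J: "injective_resolution A N J d' \<eta>"
    and M: "module A M" and N: "module A N" and f: "f \<in> mod_hom A M N"
  obtains \<phi> where "chain_map A I d J d' \<phi>" "\<And>x. x \<in> carrier M \<Longrightarrow> \<phi> 0 (\<epsilon> x) = \<eta> (f x)"
proof -
  note I = injective_resolutionD[OF I] and J = injective_resolutionD[OF J]
  interpret M: module A M by fact
  interpret J: module A "J n" for n by (rule J)
  \<comment> \<open>The invariant carried along is that \<open>d' n\<close> after
    \<open>\<phi>\<close> vanishes on the kernel of \<open>d n\<close>: exactly what is needed to
    extend this composite along \<open>d n\<close> to the next degree.\<close>
  define P where "P n \<phi> \<longleftrightarrow> \<phi> \<in> mod_hom A (I n) (J n) \<and>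
    (\<forall>z\<in>carrier (I n). d n z = \<zero>\<^bsub>I (Suc n)\<^esub> \<longrightarrow> d' n (\<phi> z) = \<zero>\<^bsub>J (Suc n)\<^esub>) \<and>
    (n = 0 \<longrightarrow> (\<forall>x\<in>carrier M. \<phi> (\<epsilon> x) = \<eta> (f x)))" for n \<phi>
  have "\<exists>\<phi>. \<forall>n. P n (\<phi> n) \<and> (\<forall>x\<in>carrier (I n). \<phi> (Suc n) (d n x) = d' n (\<phi> n x))"
  proof (rule dependent_nat_choice)
    have "\<exists>\<phi>\<in>mod_hom A (I 0) (J 0). \<forall>x\<in>carrier M. \<phi> (\<epsilon> x) = (\<lambda>x\<in>carrier M. \<eta> (f x)) x"
    proof (rule injective_extend[OF J(1) M I(2) I(3) mod_hom_comp[OF M f J(3)] ])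
      fix x assume x: "x \<in> carrier M" "\<epsilon> x = \<zero>\<^bsub>I 0\<^esub>"
      then have "x = \<zero>\<^bsub>M\<^esub>"
        using inj_onD[OF I(5), of x "\<zero>\<^bsub>M\<^esub>"] mod_hom_zero[OF M I(2) I(3)] by simp
      then show "(\<lambda>x\<in>carrier M. \<eta> (f x)) x = \<zero>\<^bsub>J 0\<^esub>"
        by (simp add: mod_hom_zero[OF M N f] mod_hom_zero[OF N J(2) J(3)])
    qed
    then obtain \<phi> where \<phi>: "\<phi> \<in> mod_hom A (I 0) (J 0)" "\<And>x. x \<in> carrier M \<Longrightarrow> \<phi> (\<epsilon> x) = \<eta> (f x)" by auto
    have "d' 0 (\<phi> z) = \<zero>\<^bsub>J (Suc 0)\<^esub>" if z: "z \<in> carrier (I 0)" "d 0 z = \<zero>\<^bsub>I (Suc 0)\<^esub>" for z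
    proof -
      obtain x where x: "x \<in> carrier M" "z = \<epsilon> x" using I(6) z by auto
      show ?thesis
        using J(6)[of "\<eta> (f x)"] mod_hom_closed[OF J(3)] mod_hom_closed[OF f] x \<phi>(2) by simp
    qed
    then show "\<exists>\<phi>. P 0 \<phi>" using \<phi> by (auto simp: P_def)
  next
    fix \<phi> n assume "P n \<phi>"
    then have \<phi>: "\<phi> \<in> mod_hom A (I n) (J n)"
      and 0: "\<And>z. z \<in> carrier (I n) \<Longrightarrow> d n z = \<zero>\<^bsub>I (Suc n)\<^esub> \<Longrightarrow> d' n (\<phi> z) = \<zero>\<^bsub>J (Suc n)\<^esub>"
      by (auto simp: P_def)
    have "\<exists>\<phi>'\<in>mod_hom A (I (Suc n)) (J (Suc n)). \<forall>x\<in>carrier (I n). \<phi>' (d n x) = (\<lambda>x\<in>carrier (I n). d' n (\<phi> x)) x"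
      by (rule injective_extend[OF J(1) I(2) I(2) I(4) mod_hom_comp[OF I(2) \<phi> J(4)]]) (simp add: 0)
    then obtain \<phi>' where \<phi>': "\<phi>' \<in> mod_hom A (I (Suc n)) (J (Suc n))"
      "\<And>x. x \<in> carrier (I n) \<Longrightarrow> \<phi>' (d n x) = d' n (\<phi> x)" by auto
    have "d' (Suc n) (\<phi>' z) = \<zero>\<^bsub>J (Suc (Suc n))\<^esub>"
      if z: "z \<in> carrier (I (Suc n))" "d (Suc n) z = \<zero>\<^bsub>I (Suc (Suc n))\<^esub>" for z
    proof -
      obtain x where x: "x \<in> carrier (I n)" "z = d n x" using I(7) z by auto
      then show ?thesis
        using is_complexD(3)[OF J(8)] mod_hom_closed[OF \<phi>] by (simp add: \<phi>')
    qed
    then show "\<exists>\<phi>'. P (Suc n) \<phi>' \<and> (\<forall>x\<in>carrier (I n). \<phi>' (d n x) = d' n (\<phi> x))"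
      using \<phi>' by (auto simp: P_def)
  qed
  then obtain \<phi> where "\<And>n. P n (\<phi> n)" "\<And>n x. x \<in> carrier (I n) \<Longrightarrow> \<phi> (Suc n) (d n x) = d' n (\<phi> n x)"
    by blast
  then show ?thesis by (intro that[of \<phi>]) (auto simp: P_def chain_map_def)
qed

lemma homotopy_exists:
  fixes M N :: "('a, 'u) module"
  assumes I: "injective_resolution A M I d \<epsilon>" and J: "injective_resolution A N J d' \<eta>"
    and \<theta>: "chain_map A I d J d' \<theta>" and \<theta>0: "\<And>x. x \<in> carrier M \<Longrightarrow> \<theta> 0 (\<epsilon> x) = \<zero>\<^bsub>J 0\<^esub>"
  obtains s where "\<And>n. s n \<in> mod_hom A (I (Suc n)) (J n)"
    "\<And>x. x \<in> carrier (I 0) \<Longrightarrow> \<theta> 0 x = s 0 (d 0 x)"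
    "\<And>n x. x \<in> carrier (I (Suc n)) \<Longrightarrow> \<theta> (Suc n) x = d' n (s n x) \<oplus>\<^bsub>J (Suc n)\<^esub> s (Suc n) (d (Suc n) x)"
proof -
  note I = injective_resolutionD[OF I] and J = injective_resolutionD[OF J]
    and \<theta> = chain_mapD[OF \<theta>]
  interpret I: module A "I n" for n by (rule I)
  interpret J: module A "J n" for n by (rule J)
  \<comment> \<open>The invariant makes \<open>\<theta> (Suc n)\<close> minus \<open>d' n\<close>
    after \<open>s\<close> vanish on the image of \<open>d n\<close>, which is the kernel of
    \<open>d (Suc n)\<close>; the difference then extends along \<open>d (Suc n)\<close> to the next
    \<open>s\<close>. Note the index: \<open>s n\<close> starts at \<open>I (Suc n)\<close>.\<close>
  define P where "P n s \<longleftrightarrow> s \<in> mod_hom A (I (Suc n)) (J n) \<and>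
    (\<forall>x\<in>carrier (I n). d' n (s (d n x)) = d' n (\<theta> n x)) \<and>
    (n = 0 \<longrightarrow> (\<forall>x\<in>carrier (I 0). \<theta> 0 x = s (d 0 x)))" for n s
  have "\<exists>s. \<forall>n. P n (s n) \<and> (\<forall>x\<in>carrier (I (Suc n)).
      \<theta> (Suc n) x = d' n (s n x) \<oplus>\<^bsub>J (Suc n)\<^esub> s (Suc n) (d (Suc n) x))"
  proof (rule dependent_nat_choice)
    have "\<exists>s\<in>mod_hom A (I (Suc 0)) (J 0). \<forall>x\<in>carrier (I 0). s (d 0 x) = \<theta> 0 x"
      by (rule injective_extend[OF J(1) I(2) I(2) I(4) \<theta>(1)]) (use I(6) \<theta>0 in auto)
    then show "\<exists>s. P 0 s" by (auto simp: P_def)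
  next
    fix s n assume "P n s"
    then have s: "s \<in> mod_hom A (I (Suc n)) (J n)"
      and ds: "\<And>x. x \<in> carrier (I n) \<Longrightarrow> d' n (s (d n x)) = d' n (\<theta> n x)"
      by (auto simp: P_def)
    define t where "t = (\<lambda>x\<in>carrier (I (Suc n)). \<theta> (Suc n) x \<ominus>\<^bsub>J (Suc n)\<^esub> (\<lambda>x\<in>carrier (I (Suc n)). d' n (s x)) x)"
    have t: "t \<in> mod_hom A (I (Suc n)) (J (Suc n))"
      unfolding t_def by (intro mod_hom_diff mod_hom_comp[OF I(2) s J(4)] I(2) J(2) \<theta>(1))
    note cl = mod_hom_closed[OF \<theta>(1)] mod_hom_closed[OF s] mod_hom_closed[OF J(4)] mod_hom_closed[OF I(4)]
    have "\<exists>s'\<in>mod_hom A (I (Suc (Suc n))) (J (Suc n)). \<forall>x\<in>carrier (I (Suc n)). s' (d (Suc n) x) = t x"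
    proof (rule injective_extend[OF J(1) I(2) I(2) I(4) t])
      fix x assume x: "x \<in> carrier (I (Suc n))" "d (Suc n) x = \<zero>\<^bsub>I (Suc (Suc n))\<^esub>"
      then obtain y where "y \<in> carrier (I n)" "x = d n y" using I(7) by auto
      with x show "t x = \<zero>\<^bsub>J (Suc n)\<^esub>"
        by (simp add: t_def \<theta>(2) ds cl J.minus_eq_zero_iff)
    qed
    then obtain s' where s': "s' \<in> mod_hom A (I (Suc (Suc n))) (J (Suc n))"
      "\<And>x. x \<in> carrier (I (Suc n)) \<Longrightarrow> s' (d (Suc n) x) = t x" by blast
    have eq: "\<theta> (Suc n) x = d' n (s x) \<oplus>\<^bsub>J (Suc n)\<^esub> s' (d (Suc n) x)" if "x \<in> carrier (I (Suc n))" for x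
      using that by (simp add: s' t_def J.minus_cancel cl)
    have "d' (Suc n) (s' (d (Suc n) x)) = d' (Suc n) (\<theta> (Suc n) x)" if "x \<in> carrier (I (Suc n))" for x
      using that by (simp add: eq mod_hom_add[OF J(4)] cl mod_hom_closed[OF s'(1)] is_complexD(3)[OF J(8)])
    then show "\<exists>s'. P (Suc n) s' \<and> (\<forall>x\<in>carrier (I (Suc n)). \<theta> (Suc n) x = d' n (s x) \<oplus>\<^bsub>J (Suc n)\<^esub> s' (d (Suc n) x))"
      using s' eq by (auto simp: P_def)
  qed
  then obtain s where "\<And>n. P n (s n)" "\<And>n x. x \<in> carrier (I (Suc n)) \<Longrightarrow>
      \<theta> (Suc n) x = d' n (s n x) \<oplus>\<^bsub>J (Suc n)\<^esub> s (Suc n) (d (Suc n) x)"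
    by blast
  then show ?thesis by (intro that[of s]) (auto simp: P_def)
qed

text \<open>Composites, sums and the identity appear restricted to the carrier because elements of
  \<open>mod_hom\<close> are extensional functions. Additivity on parallel maps is what carries over
  zero maps, homotopies and split sequences.\<close>

locale additive_functor =
  fixes A :: "'a ring" and F :: "('a, 'u) module \<Rightarrow> ('a, 'v) module"
    and \<Phi> :: "('a, 'u) module \<Rightarrow> ('a, 'u) module \<Rightarrow> ('u \<Rightarrow> 'u) \<Rightarrow> 'v \<Rightarrow> 'v"
  assumes F_module: "module A M \<Longrightarrow> module A (F M)"
    and F_hom: "module A M \<Longrightarrow> module A N \<Longrightarrow> f \<in> mod_hom A M N \<Longrightarrow> \<Phi> M N f \<in> mod_hom A (F M) (F N)"
    and F_id': "module A M \<Longrightarrow> z \<in> carrier (F M) \<Longrightarrow> \<Phi> M M (\<lambda>x\<in>carrier M. x) z = z"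
    and F_comp': "module A M \<Longrightarrow> module A N \<Longrightarrow> module A K \<Longrightarrow> f \<in> mod_hom A M N \<Longrightarrow> g \<in> mod_hom A N K \<Longrightarrow>
      z \<in> carrier (F M) \<Longrightarrow> \<Phi> M K (\<lambda>x\<in>carrier M. g (f x)) z = \<Phi> N K g (\<Phi> M N f z)"
    and F_sum': "module A M \<Longrightarrow> module A N \<Longrightarrow> f \<in> mod_hom A M N \<Longrightarrow> g \<in> mod_hom A M N \<Longrightarrow>
      z \<in> carrier (F M) \<Longrightarrow> \<Phi> M N (\<lambda>x\<in>carrier M. f x \<oplus>\<^bsub>N\<^esub> g x) z = \<Phi> M N f z \<oplus>\<^bsub>F N\<^esub> \<Phi> M N g z"
begin

text \<open>A homomorphism is determined by its values on the carrier, so \<open>h\<close> may be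
  any homomorphism that agrees there with the composite; commutative squares can then be transferred
  directly.\<close>

lemma F_comp:
  assumes "module A M" "module A N" "module A K" "f \<in> mod_hom A M N" "g \<in> mod_hom A N K" "h \<in> mod_hom A M K"
    "\<And>x. x \<in> carrier M \<Longrightarrow> h x = g (f x)" "z \<in> carrier (F M)"
  shows "\<Phi> N K g (\<Phi> M N f z) = \<Phi> M K h z"
proof -
  have "h = (\<lambda>x\<in>carrier M. g (f x))"
    by (rule mod_hom_ext[OF assms(6) mod_hom_comp[OF assms(1,4,5)]]) (simp add: assms)
  then show ?thesis using F_comp' assms by simp
qed

lemma F_sum:
  assumes "module A M" "module A N" "f \<in> mod_hom A M N" "g \<in> mod_hom A M N" "h \<in> mod_hom A M N"
    "\<And>x. x \<in> carrier M \<Longrightarrow> h x = f x \<oplus>\<^bsub>N\<^esub> g x" "z \<in> carrier (F M)"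
  shows "\<Phi> M N h z = \<Phi> M N f z \<oplus>\<^bsub>F N\<^esub> \<Phi> M N g z"
proof -
  have "h = (\<lambda>x\<in>carrier M. f x \<oplus>\<^bsub>N\<^esub> g x)"
    by (rule mod_hom_ext[OF assms(5) mod_hom_sum[OF assms(1-4)]]) (simp add: assms)
  then show ?thesis using F_sum' assms by simp
qed

text \<open>A zero map satisfies \<open>h = h + h\<close>; so does its image under an additive
  functor, which must therefore vanish.\<close>

lemma F_null:
  assumes "module A M" "module A N" "h \<in> mod_hom A M N" "\<And>x. x \<in> carrier M \<Longrightarrow> h x = \<zero>\<^bsub>N\<^esub>" "z \<in> carrier (F M)"
  shows "\<Phi> M N h z = \<zero>\<^bsub>F N\<^esub>"
proof -
  interpret N: module A N by fact
  interpret FN: module A "F N" by (rule F_module) fact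
  have cl: "\<Phi> M N h z \<in> carrier (F N)"
    using mod_hom_closed[OF F_hom[OF assms(1-3)]] assms(5) .
  have "\<Phi> M N h z = \<Phi> M N h z \<oplus>\<^bsub>F N\<^esub> \<Phi> M N h z"
    by (rule F_sum) (use assms in simp_all)
  then show ?thesis using cl by simp
qed

abbreviation FO :: "(nat \<Rightarrow> ('a, 'u) module) \<Rightarrow> nat \<Rightarrow> ('a, 'v) module" where
  "FO C \<equiv> \<lambda>n. F (C n)"

abbreviation FD :: "(nat \<Rightarrow> ('a, 'u) module) \<Rightarrow> (nat \<Rightarrow> 'u \<Rightarrow> 'u) \<Rightarrow> nat \<Rightarrow> 'v \<Rightarrow> 'v" where
  "FD C d \<equiv> \<lambda>n. \<Phi> (C n) (C (Suc n)) (d n)"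

lemma F_complex:
  assumes "is_complex A C d"
  shows "is_complex A (FO C) (FD C d)"
proof -
  note C = is_complexD[OF assms]
  have "FD C d (Suc n) (FD C d n z) = \<zero>\<^bsub>FO C (Suc (Suc n))\<^esub>" if "z \<in> carrier (F (C n))" for n z
  proof -
    have "FD C d (Suc n) (FD C d n z) = \<Phi> (C n) (C (Suc (Suc n))) (\<lambda>x\<in>carrier (C n). \<zero>\<^bsub>C (Suc (Suc n))\<^esub>) z"
      by (rule F_comp) (use C that mod_hom_null[OF C(1) C(1)] in auto)
    also have "\<dots> = \<zero>\<^bsub>FO C (Suc (Suc n))\<^esub>"
      by (rule F_null) (use C that mod_hom_null[OF C(1) C(1)] in auto)
    finally show ?thesis .
  qed
  then show ?thesis
    using C F_module F_hom by (simp add: is_complex_def)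
qed

lemma F_split_ses:
  assumes "split_ses A W dW Z dZ X dX i p q j"
  shows "split_ses A (FO W) (FD W dW) (FO Z) (FD Z dZ) (FO X) (FD X dX)
    (\<lambda>n. \<Phi> (W n) (Z n) (i n)) (\<lambda>n. \<Phi> (Z n) (X n) (p n)) (\<lambda>n. \<Phi> (Z n) (W n) (q n)) (\<lambda>n. \<Phi> (X n) (Z n) (j n))"
proof -
  interpret S: split_ses A W dW Z dZ X dX i p q j by fact
  note mods = S.W.module_axioms S.Z.module_axioms S.X.module_axioms
  note homs = S.i S.p S.q S.j is_complexD(2)[OF S.W] is_complexD(2)[OF S.Z] is_complexD(2)[OF S.X]
  show ?thesis
  proof
    fix n
    show "\<Phi> (W n) (Z n) (i n) \<in> mod_hom A (F (W n)) (F (Z n))" "\<Phi> (Z n) (X n) (p n) \<in> mod_hom A (F (Z n)) (F (X n))"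
      "\<Phi> (Z n) (W n) (q n) \<in> mod_hom A (F (Z n)) (F (W n))" "\<Phi> (X n) (Z n) (j n) \<in> mod_hom A (F (X n)) (F (Z n))"
      by (intro F_hom mods homs)+
  next
    fix n w assume w: "w \<in> carrier (F (W n))"
    note c1 = mod_hom_comp[OF mods(1) S.i is_complexD(2)[OF S.Z], of n]
    have "\<Phi> (Z n) (Z (Suc n)) (dZ n) (\<Phi> (W n) (Z n) (i n) w) = \<Phi> (W n) (Z (Suc n)) (\<lambda>x\<in>carrier (W n). dZ n (i n x)) w"
      by (rule F_comp) (use mods homs w c1 in auto)
    also have "\<dots> = \<Phi> (W (Suc n)) (Z (Suc n)) (i (Suc n)) (\<Phi> (W n) (W (Suc n)) (dW n) w)"
      by (rule F_comp[symmetric]) (use mods homs w c1 S.i_chain in auto)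
    finally show "\<Phi> (Z n) (Z (Suc n)) (dZ n) (\<Phi> (W n) (Z n) (i n) w) = \<Phi> (W (Suc n)) (Z (Suc n)) (i (Suc n)) (\<Phi> (W n) (W (Suc n)) (dW n) w)" .
    have "\<Phi> (Z n) (W n) (q n) (\<Phi> (W n) (Z n) (i n) w) = \<Phi> (W n) (W n) (\<lambda>x\<in>carrier (W n). x) w"
      by (rule F_comp) (use mods homs w mod_hom_id[OF mods(1)] S.qi in auto)
    then show "\<Phi> (Z n) (W n) (q n) (\<Phi> (W n) (Z n) (i n) w) = w"
      using F_id' mods w by simp
    have "\<Phi> (Z n) (X n) (p n) (\<Phi> (W n) (Z n) (i n) w) = \<Phi> (W n) (X n) (\<lambda>x\<in>carrier (W n). \<zero>\<^bsub>X n\<^esub>) w"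
      by (rule F_comp) (use mods homs w mod_hom_null[OF mods(1) mods(3)] S.pi in auto)
    then show "\<Phi> (Z n) (X n) (p n) (\<Phi> (W n) (Z n) (i n) w) = \<zero>\<^bsub>F (X n)\<^esub>"
      using F_null[OF mods(1,3) mod_hom_null[OF mods(1,3)]] w by simp
  next
    fix n z assume z: "z \<in> carrier (F (Z n))"
    note c1 = mod_hom_comp[OF mods(2) S.p is_complexD(2)[OF S.X], of n]
    have "\<Phi> (X n) (X (Suc n)) (dX n) (\<Phi> (Z n) (X n) (p n) z) = \<Phi> (Z n) (X (Suc n)) (\<lambda>x\<in>carrier (Z n). dX n (p n x)) z"
      by (rule F_comp) (use mods homs z c1 in auto)
    also have "\<dots> = \<Phi> (Z (Suc n)) (X (Suc n)) (p (Suc n)) (\<Phi> (Z n) (Z (Suc n)) (dZ n) z)"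
      by (rule F_comp[symmetric]) (use mods homs z c1 S.p_chain in auto)
    finally show "\<Phi> (X n) (X (Suc n)) (dX n) (\<Phi> (Z n) (X n) (p n) z) = \<Phi> (Z (Suc n)) (X (Suc n)) (p (Suc n)) (\<Phi> (Z n) (Z (Suc n)) (dZ n) z)" .
    note iq = mod_hom_comp[OF mods(2) S.q S.i, of n] and jp = mod_hom_comp[OF mods(2) S.p S.j, of n]
    have "\<Phi> (W n) (Z n) (i n) (\<Phi> (Z n) (W n) (q n) z) = \<Phi> (Z n) (Z n) (\<lambda>x\<in>carrier (Z n). i n (q n x)) z"
      by (rule F_comp) (use mods homs z iq in auto)
    moreover have "\<Phi> (X n) (Z n) (j n) (\<Phi> (Z n) (X n) (p n) z) = \<Phi> (Z n) (Z n) (\<lambda>x\<in>carrier (Z n). j n (p n x)) z"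
      by (rule F_comp) (use mods homs z jp in auto)
    moreover have "\<Phi> (Z n) (Z n) (\<lambda>x\<in>carrier (Z n). x) z = \<Phi> (Z n) (Z n) (\<lambda>x\<in>carrier (Z n). i n (q n x)) z \<oplus>\<^bsub>F (Z n)\<^esub>
        \<Phi> (Z n) (Z n) (\<lambda>x\<in>carrier (Z n). j n (p n x)) z"
      by (rule F_sum) (use mods iq jp z mod_hom_id[OF mods(2)] S.split in auto)
    ultimately show "\<Phi> (W n) (Z n) (i n) (\<Phi> (Z n) (W n) (q n) z) \<oplus>\<^bsub>F (Z n)\<^esub> \<Phi> (X n) (Z n) (j n) (\<Phi> (Z n) (X n) (p n) z) = z"
      using F_id' mods z by simp
  next
    fix n x assume x: "x \<in> carrier (F (X n))"
    have "\<Phi> (Z n) (X n) (p n) (\<Phi> (X n) (Z n) (j n) x) = \<Phi> (X n) (X n) (\<lambda>x\<in>carrier (X n). x) x"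
      by (rule F_comp) (use mods homs x mod_hom_id[OF mods(3)] S.pj in auto)
    then show "\<Phi> (Z n) (X n) (p n) (\<Phi> (X n) (Z n) (j n) x) = x"
      using F_id' mods x by simp
  qed (intro F_complex S.W S.Z S.X)+
qed

lemma F_chain_map:
  assumes "is_complex A I d" "is_complex A J d'" "chain_map A I d J d' \<phi>"
  shows "chain_map A (FO I) (FD I d) (FO J) (FD J d') (\<lambda>n. \<Phi> (I n) (J n) (\<phi> n))"
  unfolding chain_map_def
proof (intro conjI allI ballI)
  note I = is_complexD[OF assms(1)] and J = is_complexD[OF assms(2)] and \<phi> = chain_mapD[OF assms(3)]
  fix n
  show "\<Phi> (I n) (J n) (\<phi> n) \<in> mod_hom A (F (I n)) (F (J n))"
    by (intro F_hom I J \<phi>)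
  fix x assume x: "x \<in> carrier (F (I n))"
  note c = mod_hom_comp[OF I(1) I(2) \<phi>(1), of n]
  have "\<Phi> (I (Suc n)) (J (Suc n)) (\<phi> (Suc n)) (\<Phi> (I n) (I (Suc n)) (d n) x) =
      \<Phi> (I n) (J (Suc n)) (\<lambda>x\<in>carrier (I n). \<phi> (Suc n) (d n x)) x"
    by (rule F_comp) (use I J \<phi> x c in auto)
  also have "\<dots> = \<Phi> (J n) (J (Suc n)) (d' n) (\<Phi> (I n) (J n) (\<phi> n) x)"
    by (rule F_comp[symmetric]) (use I J \<phi> x c in auto)
  finally show "\<Phi> (I (Suc n)) (J (Suc n)) (\<phi> (Suc n)) (\<Phi> (I n) (I (Suc n)) (d n) x) =
    \<Phi> (J n) (J (Suc n)) (d' n) (\<Phi> (I n) (J n) (\<phi> n) x)" .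
qed

end

section \<open>Independence of derived functors from the resolution\<close>

lemma chain_map_cocyc:
  assumes "is_complex A I d" "is_complex A J d'" "chain_map A I d J d' \<phi>" "z \<in> cocyc I d n"
  shows "\<phi> n z \<in> cocyc J d' n"
  using assms(4) chain_mapD(2)[OF assms(3), of z n, symmetric] mod_hom_closed[OF chain_mapD(1)[OF assms(3)]]
    mod_hom_zero[OF is_complexD(1)[OF assms(1)] is_complexD(1)[OF assms(2)] chain_mapD(1)[OF assms(3)]]
  by (auto simp: cocyc_iff)

lemma chain_map_cobound:
  assumes "is_complex A I d" "is_complex A J d'" "chain_map A I d J d' \<phi>" "z \<in> cobound I d n"
  shows "\<phi> n z \<in> cobound J d' n"
proof (cases n)
  case 0
  then show ?thesis
    using assms(4) mod_hom_zero[OF is_complexD(1)[OF assms(1)] is_complexD(1)[OF assms(2)] chain_mapD(1)[OF assms(3)]]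
    by simp
next
  case (Suc m)
  then show ?thesis
    using assms(4) chain_mapD(2)[OF assms(3)] mod_hom_closed[OF chain_mapD(1)[OF assms(3)]] by auto
qed

context additive_functor
begin

text \<open>Two lifts compose to a map homotopic to the identity, so on cohomology they compose to the identity.\<close>

lemma lift_retract:
  assumes I: "injective_resolution A M I d \<epsilon>" and J: "injective_resolution A N J d' \<eta>"
    and gf: "\<And>x. x \<in> carrier M \<Longrightarrow> f x \<in> carrier N" "\<And>x. x \<in> carrier M \<Longrightarrow> g (f x) = x"
    and \<phi>: "chain_map A I d J d' \<phi>" "\<And>x. x \<in> carrier M \<Longrightarrow> \<phi> 0 (\<epsilon> x) = \<eta> (f x)"
    and \<psi>: "chain_map A J d' I d \<psi>" "\<And>y. y \<in> carrier N \<Longrightarrow> \<psi> 0 (\<eta> y) = \<epsilon> (g y)"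
    and H: "coh_rep A (FO I) (FD I d) n H \<pi>" and z: "z \<in> cocyc (FO I) (FD I d) n"
  shows "\<pi> (\<Phi> (J n) (I n) (\<psi> n) (\<Phi> (I n) (J n) (\<phi> n) z)) = \<pi> z"
proof -
  note I' = injective_resolutionD[OF I] and J' = injective_resolutionD[OF J]
    and \<phi>' = chain_mapD[OF \<phi>(1)] and \<psi>' = chain_mapD[OF \<psi>(1)]
  interpret I: module A "I k" for k by (rule I')
  interpret J: module A "J k" for k by (rule J')
  note FI = F_complex[OF I'(8)]
  interpret FI: module A "F (I k)" for k by (rule F_module[OF I'(2)])
  interpret ZI: module A "cocyc_module (FO I) (FD I d) n" by (rule cocyc_module[OF FI])
  define \<theta> where "\<theta> k = (\<lambda>x\<in>carrier (I k). (\<lambda>x\<in>carrier (I k). \<psi> k (\<phi> k x)) x \<ominus>\<^bsub>I k\<^esub> (\<lambda>x\<in>carrier (I k). x) x)" for k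
  note comp = mod_hom_comp[OF I'(2) \<phi>'(1) \<psi>'(1)]
  note cl = mod_hom_closed[OF \<phi>'(1)] mod_hom_closed[OF \<psi>'(1)] mod_hom_closed[OF I'(4)] mod_hom_closed[OF I'(3)]
  have \<theta>_hom: "\<theta> k \<in> mod_hom A (I k) (I k)" for k
    unfolding \<theta>_def by (intro mod_hom_diff comp mod_hom_id I'(2))
  have \<theta>_eq: "\<theta> k x = \<psi> k (\<phi> k x) \<ominus>\<^bsub>I k\<^esub> x" if "x \<in> carrier (I k)" for k x
    using that by (simp add: \<theta>_def)
  have "chain_map A I d I d \<theta>"
    using \<theta>_hom by (auto simp: chain_map_def \<theta>_eq cl \<phi>'(2) \<psi>'(2) mod_hom_minus[OF I'(2) I'(2) I'(4)])
  moreover have "\<theta> 0 (\<epsilon> x) = \<zero>\<^bsub>I 0\<^esub>" if "x \<in> carrier M" for x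
    using that gf \<phi>(2) \<psi>(2) by (simp add: \<theta>_eq cl I.minus_eq_zero_iff)
  ultimately obtain s where s: "\<And>k. s k \<in> mod_hom A (I (Suc k)) (I k)"
    "\<And>x. x \<in> carrier (I 0) \<Longrightarrow> \<theta> 0 x = s 0 (d 0 x)"
    "\<And>k x. x \<in> carrier (I (Suc k)) \<Longrightarrow> \<theta> (Suc k) x = d k (s k x) \<oplus>\<^bsub>I (Suc k)\<^esub> s (Suc k) (d (Suc k) x)"
    using homotopy_exists[OF I I] by blast
  have zc: "z \<in> carrier (F (I n))" and dz: "\<Phi> (I n) (I (Suc n)) (d n) z = \<zero>\<^bsub>F (I (Suc n))\<^esub>"
    using z by (simp_all add: cocyc_iff)
  \<comment> \<open>Through the homotopy \<open>\<theta>\<close> becomes \<open>d s + s d\<close>;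
    the second term kills the cocycle \<open>z\<close> and the first yields a coboundary. In degree
    \<open>0\<close> only the second term occurs, and there the only coboundary is zero.\<close>
  have "\<Phi> (I n) (I n) (\<theta> n) z \<in> cobound (FO I) (FD I d) n"
  proof (cases n)
    case 0
    have "\<Phi> (I 0) (I 0) (\<theta> 0) z = \<Phi> (I (Suc 0)) (I 0) (s 0) (\<Phi> (I 0) (I (Suc 0)) (d 0) z)"
      by (rule F_comp[symmetric]) (use I' \<theta>_hom s zc 0 in auto)
    then show ?thesis
      using dz 0 mod_hom_zero[OF F_module[OF I'(2)] F_module[OF I'(2)] F_hom[OF I'(2) I'(2) s(1)], of 0] by simp
  next
    case (Suc k)
    note c1 = mod_hom_comp[OF I'(2) s(1) I'(4), of k] and c2 = mod_hom_comp[OF I'(2) I'(4) s(1), of "Suc k"]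
    have sz: "\<Phi> (I (Suc k)) (I k) (s k) z \<in> carrier (F (I k))"
      using mod_hom_closed[OF F_hom[OF I'(2) I'(2) s(1)]] zc Suc by auto
    have "\<Phi> (I n) (I n) (\<theta> n) z = \<Phi> (I n) (I n) (\<lambda>x\<in>carrier (I (Suc k)). d k (s k x)) z \<oplus>\<^bsub>F (I n)\<^esub>
        \<Phi> (I n) (I n) (\<lambda>x\<in>carrier (I (Suc k)). s (Suc k) (d (Suc k) x)) z"
      by (rule F_sum) (use I' \<theta>_hom s c1 c2 zc Suc in auto)
    also have "\<Phi> (I n) (I n) (\<lambda>x\<in>carrier (I (Suc k)). d k (s k x)) z = \<Phi> (I k) (I n) (d k) (\<Phi> (I n) (I k) (s k) z)"
      unfolding Suc by (rule F_comp[symmetric]) (use I' s c1 zc Suc in auto)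
    also have "\<Phi> (I n) (I n) (\<lambda>x\<in>carrier (I (Suc k)). s (Suc k) (d (Suc k) x)) z =
        \<Phi> (I (Suc n)) (I n) (s n) (\<Phi> (I n) (I (Suc n)) (d n) z)"
      unfolding Suc by (rule F_comp[symmetric]) (use I' s c2 zc Suc in auto)
    also have "\<dots> = \<zero>\<^bsub>F (I n)\<^esub>"
      using dz mod_hom_zero[OF F_module[OF I'(2)] F_module[OF I'(2)] F_hom[OF I'(2) I'(2) s(1)], of n] by simp
    finally show ?thesis
      using sz mod_hom_closed[OF F_hom[OF I'(2) I'(2) I'(4)], of _ k] Suc by simp
  qed
  moreover have "\<Phi> (J n) (I n) (\<psi> n) (\<Phi> (I n) (J n) (\<phi> n) z) = z \<oplus>\<^bsub>F (I n)\<^esub> \<Phi> (I n) (I n) (\<theta> n) z"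
  proof -
    have "\<Phi> (J n) (I n) (\<psi> n) (\<Phi> (I n) (J n) (\<phi> n) z) = \<Phi> (I n) (I n) (\<lambda>x\<in>carrier (I n). \<psi> n (\<phi> n x)) z"
      by (rule F_comp) (use I' J' \<phi>' \<psi>' comp zc in auto)
    also have "\<dots> = \<Phi> (I n) (I n) (\<lambda>x\<in>carrier (I n). x) z \<oplus>\<^bsub>F (I n)\<^esub> \<Phi> (I n) (I n) (\<theta> n) z"
      by (rule F_sum) (use I' \<theta>_hom comp mod_hom_id[OF I'(2)] zc in \<open>auto simp: \<theta>_eq cl I.minus_cancel\<close>)
    finally show ?thesis using F_id' I' zc by simp
  qed
  ultimately obtain b where b: "b \<in> cobound (FO I) (FD I d) n"
    "\<Phi> (J n) (I n) (\<psi> n) (\<Phi> (I n) (J n) (\<phi> n) z) = z \<oplus>\<^bsub>F (I n)\<^esub> b" by blast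
  note H' = coh_repD[OF H]
  interpret H: module A H by (rule H')
  have bZ: "b \<in> cocyc (FO I) (FD I d) n" using b cobound_le_cocyc[OF FI] by blast
  then show ?thesis
    using mod_hom_add[OF H'(2), of z b] z H'(4)[of b] H'(5) b by simp
qed

lemma coh_rep_chain_map:
  assumes I: "is_complex A I d" and J: "is_complex A J d'" and \<phi>: "chain_map A I d J d' \<phi>"
    and H: "coh_rep A (FO I) (FD I d) n H \<pi>" and H': "coh_rep A (FO J) (FD J d') n H' \<pi>'"
  shows "\<exists>a\<in>mod_hom A H H'. \<forall>z\<in>cocyc (FO I) (FD I d) n. a (\<pi> z) = \<pi>' (\<Phi> (I n) (J n) (\<phi> n) z)"
proof -
  note F\<phi> = F_chain_map[OF I J \<phi>] and FI = F_complex[OF I] and FJ = F_complex[OF J]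
  show ?thesis
    by (rule coh_rep_map[OF FI FJ H H'])
      (use chain_mapD(1)[OF F\<phi>] chain_map_cocyc[OF FI FJ F\<phi>] chain_map_cobound[OF FI FJ F\<phi>] in auto)
qed

text \<open>The last clause upgrades the retraction to an isomorphism when \<open>f\<close> and
  \<open>g\<close> are mutually inverse. With both equal to the identity this compares two
  resolutions of one module; the one-sided form serves direct summands.\<close>

theorem retract_cohomology:
  assumes M: "module A M" and N: "module A N"
    and I: "injective_resolution A M I d \<epsilon>" and J: "injective_resolution A N J d' \<eta>"
    and f: "f \<in> mod_hom A M N" and g: "g \<in> mod_hom A N M" and gf: "\<And>x. x \<in> carrier M \<Longrightarrow> g (f x) = x"
    and H: "coh_rep A (FO I) (FD I d) n H \<pi>" and H': "coh_rep A (FO J) (FD J d') n H' \<pi>'"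
  obtains a b where "a \<in> mod_hom A H H'" "b \<in> mod_hom A H' H" "\<And>y. y \<in> carrier H \<Longrightarrow> b (a y) = y"
    "(\<And>x. x \<in> carrier N \<Longrightarrow> f (g x) = x) \<Longrightarrow> (\<And>y. y \<in> carrier H' \<Longrightarrow> a (b y) = y)"
proof -
  note I' = injective_resolutionD(8)[OF I] and J' = injective_resolutionD(8)[OF J]
  obtain \<phi> where \<phi>: "chain_map A I d J d' \<phi>" "\<And>x. x \<in> carrier M \<Longrightarrow> \<phi> 0 (\<epsilon> x) = \<eta> (f x)"
    using lift_exists[OF I J M N f] by blast
  obtain \<psi> where \<psi>: "chain_map A J d' I d \<psi>" "\<And>x. x \<in> carrier N \<Longrightarrow> \<psi> 0 (\<eta> x) = \<epsilon> (g x)"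
    using lift_exists[OF J I N M g] by blast
  obtain a where a: "a \<in> mod_hom A H H'"
    "\<And>z. z \<in> cocyc (FO I) (FD I d) n \<Longrightarrow> a (\<pi> z) = \<pi>' (\<Phi> (I n) (J n) (\<phi> n) z)"
    using coh_rep_chain_map[OF I' J' \<phi>(1) H H'] by blast
  obtain b where b: "b \<in> mod_hom A H' H"
    "\<And>z. z \<in> cocyc (FO J) (FD J d') n \<Longrightarrow> b (\<pi>' z) = \<pi> (\<Phi> (J n) (I n) (\<psi> n) z)"
    using coh_rep_chain_map[OF J' I' \<psi>(1) H' H] by blast
  note Z1 = chain_map_cocyc[OF F_complex[OF I'] F_complex[OF J'] F_chain_map[OF I' J' \<phi>(1)]]
  note Z2 = chain_map_cocyc[OF F_complex[OF J'] F_complex[OF I'] F_chain_map[OF J' I' \<psi>(1)]]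
  have "b (a y) = y" if y: "y \<in> carrier H" for y
  proof -
    obtain z where z: "z \<in> cocyc (FO I) (FD I d) n" "y = \<pi> z" using coh_repD(6)[OF H y] by blast
    show ?thesis
      unfolding z(2) a(2)[OF z(1)] b(2)[OF Z1[OF z(1)]]
      by (rule lift_retract[OF I J mod_hom_closed[OF f] gf \<phi> \<psi> H z(1)])
  qed
  moreover have "a (b y) = y" if fg: "\<And>x. x \<in> carrier N \<Longrightarrow> f (g x) = x" and y: "y \<in> carrier H'" for y
  proof -
    obtain z where z: "z \<in> cocyc (FO J) (FD J d') n" "y = \<pi>' z" using coh_repD(6)[OF H' y] by blast
    show ?thesis
      unfolding z(2) b(2)[OF z(1)] a(2)[OF Z2[OF z(1)]]
      by (rule lift_retract[OF J I mod_hom_closed[OF g] fg \<psi> \<phi> H' z(1)])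
  qed
  ultimately show ?thesis using that a(1) b(1) by blast
qed

text \<open>The resolution inside \<open>right_derived\<close> comes from \<open>SOME\<close> and is
  otherwise unknown; lifting the identity of \<open>M\<close> between it and \<open>J\<close> lets
  any convenient resolution compute the derived functor.\<close>

theorem right_derived_coh_rep:
  assumes M: "module A M" and J: "injective_resolution A M J d' \<eta>"
  shows "\<exists>\<pi>. coh_rep A (FO J) (FD J d') n (right_derived A F \<Phi> n M) \<pi>"
proof -
  define r where "r = (SOME (I, d). \<exists>\<epsilon>. injective_resolution A M I d \<epsilon>)"
  have "case r of (I, d) \<Rightarrow> \<exists>\<epsilon>. injective_resolution A M I d \<epsilon>"
    unfolding r_def by (rule someI_ex) (use J in auto)
  then obtain I d \<epsilon> where r: "r = (I, d)" and I: "injective_resolution A M I d \<epsilon>" by auto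
  have eq: "right_derived A F \<Phi> n M = cohomology (FO I) (FD I d) n"
    using r by (simp add: right_derived_def r_def[symmetric])
  note FI = F_complex[OF injective_resolutionD(8)[OF I]] and FJ = F_complex[OF injective_resolutionD(8)[OF J]]
  obtain \<pi> where \<pi>: "coh_rep A (FO I) (FD I d) n (right_derived A F \<Phi> n M) \<pi>"
    unfolding eq using cohomology_coh_rep[OF FI] by blast
  obtain \<pi>' where \<pi>': "coh_rep A (FO J) (FD J d') n (cohomology (FO J) (FD J d') n) \<pi>'"
    using cohomology_coh_rep[OF FJ] by blast
  obtain a b where "a \<in> mod_hom A (cohomology (FO J) (FD J d') n) (right_derived A F \<Phi> n M)"
    and b: "b \<in> mod_hom A (right_derived A F \<Phi> n M) (cohomology (FO J) (FD J d') n)"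
    and ab: "\<And>y. y \<in> carrier (cohomology (FO J) (FD J d') n) \<Longrightarrow> b (a y) = y"
       "\<And>y. y \<in> carrier (right_derived A F \<Phi> n M) \<Longrightarrow> a (b y) = y"
    by (rule retract_cohomology[OF M M J I mod_hom_id[OF M] mod_hom_id[OF M] _ \<pi>' \<pi>]) auto
  moreover from this have "bij_betw a (carrier (cohomology (FO J) (FD J d') n)) (carrier (right_derived A F \<Phi> n M))"
    by (intro bij_betw_byWitness[where f' = b]) (auto intro: mod_hom_closed)
  ultimately have "mod_iso A (cohomology (FO J) (FD J d') n) (right_derived A F \<Phi> n M)"
    unfolding mod_iso_def by blast
  then show ?thesis
    using coh_rep_iso[OF \<pi>' FJ coh_repD(1)[OF \<pi>]] by blast
qed

end

section \<open>The cone resolution\<close>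

text \<open>The quotient module consists of cosets; a copy in the original element type keeps the
  iterated cokernels of a resolution inside one universe.\<close>

lemma cokernel_exists:
  fixes M :: "('a, 'u) module"
  assumes M: "module A M" and N: "submodule N A M"
  obtains C :: "('a, 'u) module" and q where "module A C" "q \<in> mod_hom A M C" "q ` carrier M = carrier C"
    "\<And>x. x \<in> carrier M \<Longrightarrow> q x = \<zero>\<^bsub>C\<^esub> \<longleftrightarrow> x \<in> N"
proof -
  note Q = quotient_module[OF M N]
  obtain C :: "('a, 'u) module" where C: "module A C" and "mod_iso A (quotient_module M N) C"
    using module_copy[OF M Q(1,3)] by blast
  then obtain e where e: "e \<in> mod_hom A (quotient_module M N) C"
      "bij_betw e (carrier (quotient_module M N)) (carrier C)"
    by (auto simp: mod_iso_def)
  interpret Q: module A "quotient_module M N" by (rule Q)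
  define q where "q = (\<lambda>x\<in>carrier M. e ((\<lambda>x\<in>carrier M. N +>\<^bsub>M\<^esub> x) x))"
  have "q \<in> mod_hom A M C"
    unfolding q_def by (rule mod_hom_comp[OF M Q(2) e(1)])
  moreover have "q ` carrier M = carrier C"
  proof -
    have "q ` carrier M = e ` ((\<lambda>x. N +>\<^bsub>M\<^esub> x) ` carrier M)"
      by (auto simp: q_def image_iff)
    also have "\<dots> = carrier C"
      unfolding Q(3) using e(2) by (simp add: bij_betw_def)
    finally show ?thesis .
  qed
  moreover have "q x = \<zero>\<^bsub>C\<^esub> \<longleftrightarrow> x \<in> N" if "x \<in> carrier M" for x
  proof -
    have "N +>\<^bsub>M\<^esub> x \<in> carrier (quotient_module M N)"
      using that unfolding Q(3)[symmetric] by blast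
    then show ?thesis
      using inj_onD[OF bij_betw_imp_inj_on[OF e(2)], of "N +>\<^bsub>M\<^esub> x" "\<zero>\<^bsub>quotient_module M N\<^esub>"]
        Q(4)[OF that] mod_hom_zero[OF Q(1) C e(1)] that by (auto simp: q_def)
  qed
  ultimately show ?thesis using that C by blast
qed

text \<open>The universe \<open>'u\<close> occurs only in the types of bound variables, so it is
  passed through an \<open>itself\<close> argument.\<close>

definition enough_injectives :: "'a ring \<Rightarrow> 'u itself \<Rightarrow> bool" where
  "enough_injectives A _ \<longleftrightarrow> (\<forall>M :: ('a, 'u) module. module A M \<longrightarrow>
     (\<exists>(E :: ('a, 'u) module) \<epsilon>. injective_module A E \<and> \<epsilon> \<in> mod_hom A M E \<and> inj_on \<epsilon> (carrier M)))"

lemma injective_resolution_exists: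
  fixes M :: "('a, 'u) module"
  assumes enough: "enough_injectives A TYPE('u)" and M: "module A M"
  obtains I d \<epsilon> where "injective_resolution A M I d \<epsilon>"
proof -
  \<comment> \<open>A state of the recursion is a module \<open>N\<close>, an injective module
    \<open>E\<close> and an embedding \<open>e\<close> of \<open>N\<close> into \<open>E\<close>;
    the next \<open>N\<close> is the cokernel of \<open>e\<close>. The differential is the
    projection onto that cokernel followed by its embedding.\<close>
  define P where "P n x \<longleftrightarrow> (case x of (N :: ('a, 'u) module, E :: ('a, 'u) module, e) \<Rightarrow> module A N \<and> injective_module A E \<and>
    e \<in> mod_hom A N E \<and> inj_on e (carrier N) \<and> (n = 0 \<longrightarrow> N = M))" for n :: nat and x
  define R where "R n x y \<longleftrightarrow> (case x of (N :: ('a, 'u) module, E :: ('a, 'u) module, e) \<Rightarrow>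
    case y of (N' :: ('a, 'u) module, E' :: ('a, 'u) module, e' :: 'u \<Rightarrow> 'u) \<Rightarrow>
    \<exists>q\<in>mod_hom A E N'. q ` carrier E = carrier N' \<and> (\<forall>x\<in>carrier E. q x = \<zero>\<^bsub>N'\<^esub> \<longleftrightarrow> x \<in> e ` carrier N))" for n :: nat and x y
  have "\<exists>x. \<forall>n. P n (x n) \<and> R n (x n) (x (Suc n))"
  proof (rule dependent_nat_choice)
    show "\<exists>x. P 0 x"
      using enough M by (auto simp: P_def enough_injectives_def)
  next
    fix x n assume "P n x"
    then obtain N E e where x: "x = (N, E, e)" and N: "module A N" and E: "injective_module A E"
      and e: "e \<in> mod_hom A N E" by (cases x) (auto simp: P_def)
    note E' = injective_moduleD[OF E]
    obtain C :: "('a, 'u) module" and q where C: "module A C" "q \<in> mod_hom A E C" "q ` carrier E = carrier C"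
      "\<And>x. x \<in> carrier E \<Longrightarrow> q x = \<zero>\<^bsub>C\<^esub> \<longleftrightarrow> x \<in> e ` carrier N"
      by (rule cokernel_exists[OF E' submodule_image[OF N E' e]]) blast
    obtain E2 :: "('a, 'u) module" and e2 where E2: "injective_module A E2" "e2 \<in> mod_hom A C E2" "inj_on e2 (carrier C)"
      using enough C(1) unfolding enough_injectives_def by blast
    have "P (Suc n) (C, E2, e2)" using C E2 by (simp add: P_def)
    moreover have "R n x (C, E2, e2)" unfolding R_def x using C by auto
    ultimately show "\<exists>y. P (Suc n) y \<and> R n x y" by blast
  qed
  then obtain x where x: "\<And>n. P n (x n)" "\<And>n. R n (x n) (x (Suc n))" by blast
  define N E e where "N n = fst (x n)" and "E n = fst (snd (x n))" and "e n = snd (snd (x n))" for n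
  have xn: "x n = (N n, E n, e n)" for n by (simp add: N_def E_def e_def)
  have N: "module A (N n)" "N 0 = M" and E: "injective_module A (E n)"
    and e: "e n \<in> mod_hom A (N n) (E n)" "inj_on (e n) (carrier (N n))" for n
    using x(1)[of n] x(1)[of 0] by (simp_all add: P_def xn)
  note E' = injective_moduleD[OF E]
  interpret N: module A "N n" for n by (rule N)
  have "\<exists>q. q \<in> mod_hom A (E n) (N (Suc n)) \<and> q ` carrier (E n) = carrier (N (Suc n)) \<and>
     (\<forall>x\<in>carrier (E n). q x = \<zero>\<^bsub>N (Suc n)\<^esub> \<longleftrightarrow> x \<in> e n ` carrier (N n))" for n
    using x(2)[of n] by (auto simp: R_def xn)
  then obtain q where q: "\<And>n. q n \<in> mod_hom A (E n) (N (Suc n))" "\<And>n. q n ` carrier (E n) = carrier (N (Suc n))"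
    "\<And>n x. x \<in> carrier (E n) \<Longrightarrow> q n x = \<zero>\<^bsub>N (Suc n)\<^esub> \<longleftrightarrow> x \<in> e n ` carrier (N n)" by metis
  define d where "d n = (\<lambda>x\<in>carrier (E n). e (Suc n) (q n x))" for n
  have d: "d n \<in> mod_hom A (E n) (E (Suc n))" for n
    unfolding d_def by (rule mod_hom_comp[OF E' q(1) e(1)])
  have ker: "a_kernel (E n) (E (Suc n)) (d n) = e n ` carrier (N n)" for n
  proof -
    have "d n x = \<zero>\<^bsub>E (Suc n)\<^esub> \<longleftrightarrow> q n x = \<zero>\<^bsub>N (Suc n)\<^esub>" if "x \<in> carrier (E n)" for x
      using inj_onD[OF e(2), of "Suc n" "q n x" "\<zero>\<^bsub>N (Suc n)\<^esub>"] mod_hom_zero[OF N(1) E' e(1), of "Suc n"]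
        mod_hom_closed[OF q(1) that] that by (auto simp: d_def)
    then show ?thesis
      using q(3) mod_hom_closed[OF e(1)] by (auto simp: a_kernel_def')
  qed
  have "d n ` carrier (E n) = e (Suc n) ` carrier (N (Suc n))" for n
    unfolding q(2)[symmetric] by (auto simp: d_def image_iff)
  then have "injective_resolution A M E d (e 0)"
    unfolding injective_resolution_def using E d e[of 0] N(2) ker[of 0] ker by simp
  then show ?thesis using that by blast
qed

text \<open>This builds the sign of the mapping cone into the target resolution: a chain map into
  the negated resolution anticommutes with the original differentials.\<close>

lemma injective_resolution_neg:
  assumes R: "injective_resolution A M I d \<epsilon>"
  shows "injective_resolution A M I (\<lambda>n. \<lambda>x\<in>carrier (I n). \<ominus>\<^bsub>I (Suc n)\<^esub> d n x) \<epsilon>"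
proof -
  note R' = injective_resolutionD[OF R]
  interpret I: module A "I n" for n by (rule R')
  let ?d = "\<lambda>n. \<lambda>x\<in>carrier (I n). \<ominus>\<^bsub>I (Suc n)\<^esub> d n x"
  have hom: "?d n \<in> mod_hom A (I n) (I (Suc n))" for n
    by (rule restrict_mod_homI[OF R'(2)])
      (simp_all add: mod_hom_closed[OF R'(4)] mod_hom_add[OF R'(4)] mod_hom_smult[OF R'(4)] I.minus_add I.smult_r_minus)
  have neg_iff: "\<ominus>\<^bsub>I n\<^esub> x = \<zero>\<^bsub>I n\<^esub> \<longleftrightarrow> x = \<zero>\<^bsub>I n\<^esub>" if "x \<in> carrier (I n)" for n x
    using that I.minus_minus[of x n] by force
  have ker: "a_kernel (I n) (I (Suc n)) (?d n) = a_kernel (I n) (I (Suc n)) (d n)" for n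
    by (auto simp: a_kernel_def' neg_iff mod_hom_closed[OF R'(4)])
  have im: "?d n ` carrier (I n) = d n ` carrier (I n)" for n
  proof (intro equalityI subsetI)
    fix y assume "y \<in> ?d n ` carrier (I n)"
    then show "y \<in> d n ` carrier (I n)"
      using submoduleD(5)[OF R'(2) submodule_image[OF R'(2) R'(2) R'(4)]] by auto
  next
    fix y assume "y \<in> d n ` carrier (I n)"
    then obtain x where "x \<in> carrier (I n)" "y = d n x" by blast
    then have "y = ?d n (\<ominus>\<^bsub>I n\<^esub> x)"
      using mod_hom_closed[OF R'(4)] by (simp add: mod_hom_uminus[OF R'(2) R'(2) R'(4)])
    then show "y \<in> ?d n ` carrier (I n)" using \<open>x \<in> carrier (I n)\<close> by blast
  qed
  show ?thesis
    using R hom ker im unfolding injective_resolution_def by (simp del: restrict_apply)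
qed

section \<open>Biproducts inside the universe and their injectivity\<close>

definition is_biproduct where
  "is_biproduct A W X Z i p q j \<longleftrightarrow> module A W \<and> module A X \<and> module A Z \<and>
     i \<in> mod_hom A W Z \<and> p \<in> mod_hom A Z X \<and> q \<in> mod_hom A Z W \<and> j \<in> mod_hom A X Z \<and>
     (\<forall>w\<in>carrier W. q (i w) = w \<and> p (i w) = \<zero>\<^bsub>X\<^esub>) \<and>
     (\<forall>x\<in>carrier X. p (j x) = x \<and> q (j x) = \<zero>\<^bsub>W\<^esub>) \<and>
     (\<forall>z\<in>carrier Z. i (q z) \<oplus>\<^bsub>Z\<^esub> j (p z) = z)"

lemma is_biproductD:
  assumes "is_biproduct A W X Z i p q j"
  shows "module A W" "module A X" "module A Z"
    "i \<in> mod_hom A W Z" "p \<in> mod_hom A Z X" "q \<in> mod_hom A Z W" "j \<in> mod_hom A X Z"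
    "w \<in> carrier W \<Longrightarrow> q (i w) = w" "w \<in> carrier W \<Longrightarrow> p (i w) = \<zero>\<^bsub>X\<^esub>"
    "x \<in> carrier X \<Longrightarrow> p (j x) = x" "x \<in> carrier X \<Longrightarrow> q (j x) = \<zero>\<^bsub>W\<^esub>"
    "z \<in> carrier Z \<Longrightarrow> i (q z) \<oplus>\<^bsub>Z\<^esub> j (p z) = z"
  using assms by (auto simp: is_biproduct_def)

lemma infinite_prod_inj:
  assumes "infinite (UNIV :: 'u set)"
  obtains e :: "'u \<times> 'u \<Rightarrow> 'u" where "inj e"
  using card_of_Times_same_infinite[OF assms] unfolding card_of_ordIso[symmetric] bij_betw_def by auto

text \<open>The square of an infinite universe injects into it, so the module of pairs has a copy
  inside.\<close>

lemma biproduct_exists: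
  fixes W X :: "('a, 'u) module"
  assumes inf: "infinite (UNIV :: 'u set)" and W: "module A W" and X: "module A X"
  shows "\<exists>(Z :: ('a, 'u) module) i p q j. is_biproduct A W X Z i p q j"
proof -
  interpret W: module A W by fact
  interpret X: module A X by fact
  define S :: "('a, 'u \<times> 'u) module" where
    "S = \<lparr>carrier = carrier W \<times> carrier X, monoid.mult = undefined, one = undefined, ring.zero = (\<zero>\<^bsub>W\<^esub>, \<zero>\<^bsub>X\<^esub>),
      add = (\<lambda>s t. (fst s \<oplus>\<^bsub>W\<^esub> fst t, snd s \<oplus>\<^bsub>X\<^esub> snd t)), smult = (\<lambda>r s. (r \<odot>\<^bsub>W\<^esub> fst s, r \<odot>\<^bsub>X\<^esub> snd s))\<rparr>"
  have S: "module A S"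
  proof (rule moduleI)
    show "cring A" by (rule W.R.is_cring)
    show "abelian_group S"
    proof (rule abelian_groupI)
      fix s assume "s \<in> carrier S"
      then show "\<exists>t\<in>carrier S. t \<oplus>\<^bsub>S\<^esub> s = \<zero>\<^bsub>S\<^esub>"
        by (intro bexI[of _ "(\<ominus>\<^bsub>W\<^esub> fst s, \<ominus>\<^bsub>X\<^esub> snd s)"]) (auto simp: S_def W.l_neg X.l_neg)
    qed (auto simp: S_def W.add.m_ac X.add.m_ac)
  qed (auto simp: S_def W.smult_l_distr W.smult_r_distr W.smult_assoc1 X.smult_l_distr X.smult_r_distr X.smult_assoc1)
  obtain c :: "'u \<times> 'u \<Rightarrow> 'u" where c: "inj c" using infinite_prod_inj[OF inf] .
  obtain Z :: "('a, 'u) module" where Z: "module A Z" and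
    e: "restrict c (carrier S) \<in> mod_hom A S Z" "bij_betw (restrict c (carrier S)) (carrier S) (carrier Z)"
    using module_transport[OF S inj_on_subset[OF c]] by blast
  define e' where "e' = restrict c (carrier S)"
  obtain g where g: "g \<in> mod_hom A Z S" "\<And>s. s \<in> carrier S \<Longrightarrow> g (e' s) = s" "\<And>z. z \<in> carrier Z \<Longrightarrow> e' (g z) = z"
    using mod_iso_inverse[OF S Z e] unfolding e'_def by metis
  have i0: "(\<lambda>w\<in>carrier W. (w, \<zero>\<^bsub>X\<^esub>)) \<in> mod_hom A W S"
    by (rule restrict_mod_homI[OF W]) (auto simp: S_def)
  have j0: "(\<lambda>x\<in>carrier X. (\<zero>\<^bsub>W\<^esub>, x)) \<in> mod_hom A X S"
    by (rule restrict_mod_homI[OF X]) (auto simp: S_def)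
  have p0: "(\<lambda>s\<in>carrier S. snd s) \<in> mod_hom A S X"
    by (rule restrict_mod_homI[OF S]) (auto simp: S_def)
  have q0: "(\<lambda>s\<in>carrier S. fst s) \<in> mod_hom A S W"
    by (rule restrict_mod_homI[OF S]) (auto simp: S_def)
  note e'_hom = e(1)[folded e'_def]
  have S_mem: "(w, x) \<in> carrier S \<longleftrightarrow> w \<in> carrier W \<and> x \<in> carrier X" for w x
    by (simp add: S_def)
  have gz: "fst (g z) \<in> carrier W" "snd (g z) \<in> carrier X" if "z \<in> carrier Z" for z
    using mod_hom_closed[OF g(1) that] by (auto simp: S_def)
  have "is_biproduct A W X Z (\<lambda>w\<in>carrier W. e' ((\<lambda>w\<in>carrier W. (w, \<zero>\<^bsub>X\<^esub>)) w)) (\<lambda>z\<in>carrier Z. (\<lambda>s\<in>carrier S. snd s) (g z))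
    (\<lambda>z\<in>carrier Z. (\<lambda>s\<in>carrier S. fst s) (g z)) (\<lambda>x\<in>carrier X. e' ((\<lambda>x\<in>carrier X. (\<zero>\<^bsub>W\<^esub>, x)) x))"
    unfolding is_biproduct_def
  proof (intro conjI W X Z mod_hom_comp[OF W i0 e'_hom] mod_hom_comp[OF X j0 e'_hom] mod_hom_comp[OF Z g(1) p0] mod_hom_comp[OF Z g(1) q0] ballI)
    fix z assume z: "z \<in> carrier Z"
    have "e' (fst (g z), \<zero>\<^bsub>X\<^esub>) \<oplus>\<^bsub>Z\<^esub> e' (\<zero>\<^bsub>W\<^esub>, snd (g z)) = e' ((fst (g z), \<zero>\<^bsub>X\<^esub>) \<oplus>\<^bsub>S\<^esub> (\<zero>\<^bsub>W\<^esub>, snd (g z)))"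
      by (rule mod_hom_add[OF e'_hom, symmetric]) (use gz[OF z] in \<open>auto simp: S_mem\<close>)
    also have "(fst (g z), \<zero>\<^bsub>X\<^esub>) \<oplus>\<^bsub>S\<^esub> (\<zero>\<^bsub>W\<^esub>, snd (g z)) = g z"
      using gz[OF z] by (simp add: S_def)
    finally show "(\<lambda>w\<in>carrier W. e' ((\<lambda>w\<in>carrier W. (w, \<zero>\<^bsub>X\<^esub>)) w)) ((\<lambda>z\<in>carrier Z. (\<lambda>s\<in>carrier S. fst s) (g z)) z) \<oplus>\<^bsub>Z\<^esub>
       (\<lambda>x\<in>carrier X. e' ((\<lambda>x\<in>carrier X. (\<zero>\<^bsub>W\<^esub>, x)) x)) ((\<lambda>z\<in>carrier Z. (\<lambda>s\<in>carrier S. snd s) (g z)) z) = z"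
      using z gz[OF z] g(3) mod_hom_closed[OF g(1) z] by simp
  qed (use mod_hom_closed[OF e'_hom] g(2) in \<open>auto simp: S_mem\<close>)
  then show ?thesis by (intro exI)
qed

lemma injective_biproduct:
  fixes W X Z :: "('a, 'u) module"
  assumes B: "is_biproduct A W X Z i p q j" and W: "injective_module A W" and X: "injective_module A X"
  shows "injective_module A Z"
  unfolding injective_module_def
proof (intro conjI allI impI)
  note B = is_biproductD[OF B]
  show "module A Z" by (rule B)
  fix P Q :: "('a, 'u) module" and k f
  assume "module A P \<and> module A Q \<and> k \<in> mod_hom A P Q \<and> inj_on k (carrier P) \<and> f \<in> mod_hom A P Z"
  then have P: "module A P" and Q: "module A Q" and k: "k \<in> mod_hom A P Q" and inj: "inj_on k (carrier P)"
    and f: "f \<in> mod_hom A P Z" by auto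
  interpret P: module A P by fact
  have k0: "x = \<zero>\<^bsub>P\<^esub>" if "x \<in> carrier P" "k x = \<zero>\<^bsub>Q\<^esub>" for x
    using inj_onD[OF inj, of x "\<zero>\<^bsub>P\<^esub>"] mod_hom_zero[OF P Q k] that by simp
  have "\<exists>g\<in>mod_hom A Q W. \<forall>x\<in>carrier P. g (k x) = (\<lambda>x\<in>carrier P. q (f x)) x"
    by (rule injective_extend[OF W P Q k mod_hom_comp[OF P f B(6)]])
      (use k0 mod_hom_zero[OF P B(3) f] mod_hom_zero[OF B(3) B(1) B(6)] in auto)
  then obtain g1 where g1: "g1 \<in> mod_hom A Q W" "\<And>x. x \<in> carrier P \<Longrightarrow> g1 (k x) = q (f x)" by auto
  have "\<exists>g\<in>mod_hom A Q X. \<forall>x\<in>carrier P. g (k x) = (\<lambda>x\<in>carrier P. p (f x)) x"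
    by (rule injective_extend[OF X P Q k mod_hom_comp[OF P f B(5)]])
      (use k0 mod_hom_zero[OF P B(3) f] mod_hom_zero[OF B(3) B(2) B(5)] in auto)
  then obtain g2 where g2: "g2 \<in> mod_hom A Q X" "\<And>x. x \<in> carrier P \<Longrightarrow> g2 (k x) = p (f x)" by auto
  have "(\<lambda>y\<in>carrier Q. (\<lambda>y\<in>carrier Q. i (g1 y)) y \<oplus>\<^bsub>Z\<^esub> (\<lambda>y\<in>carrier Q. j (g2 y)) y) \<in> mod_hom A Q Z"
    by (intro mod_hom_sum Q B(3) mod_hom_comp[OF Q g1(1) B(4)] mod_hom_comp[OF Q g2(1) B(7)])
  then show "\<exists>g\<in>mod_hom A Q Z. \<forall>x\<in>carrier P. g (k x) = f x"
    by (rule bexI[rotated]) (simp add: mod_hom_closed[OF k] g1 g2 B(12) mod_hom_closed[OF f])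
qed

text \<open>This fills degree \<open>0\<close> of the shifted complex in the cone. The zero module
  is cut out of a given module, so that its operations and element type are at hand.\<close>

lemma injective_zero_module:
  fixes E :: "('a, 'u) module"
  assumes E: "module A E"
  shows "injective_module A (E\<lparr>carrier := {\<zero>\<^bsub>E\<^esub>}\<rparr>)"
proof -
  have O: "module A (E\<lparr>carrier := {\<zero>\<^bsub>E\<^esub>}\<rparr>)"
    by (rule submodule.submodule_is_module[OF submodule_zero[OF E] E])
  show ?thesis
    unfolding injective_module_def
  proof (intro conjI allI impI O)
    fix P Q :: "('a, 'u) module" and k f
    assume "module A P \<and> module A Q \<and> k \<in> mod_hom A P Q \<and> inj_on k (carrier P) \<and>
      f \<in> mod_hom A P (E\<lparr>carrier := {\<zero>\<^bsub>E\<^esub>}\<rparr>)"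
    then show "\<exists>g\<in>mod_hom A Q (E\<lparr>carrier := {\<zero>\<^bsub>E\<^esub>}\<rparr>). \<forall>x\<in>carrier P. g (k x) = f x"
      by (intro bexI[OF _ mod_hom_null[OF _ O]]) (auto dest: mod_hom_closed)
  qed
qed

text \<open>The mapping cone of a lift of \<open>g : Q \<rightarrow> T\<close>, shifted so that it starts in degree \<open>0\<close>, resolves the
  kernel of \<open>g\<close>; this replaces the horseshoe lemma.\<close>

theorem cone_resolution:
  fixes P Q T :: "('a, 'u) module"
  assumes inf: "infinite (UNIV :: 'u set)" and ses: "short_exact A P Q T f g"
    and I: "injective_resolution A Q I dI \<epsilon>" and J: "injective_resolution A T J dJ \<eta>"
  defines "W \<equiv> (\<lambda>n. case n of 0 \<Rightarrow> (J 0)\<lparr>carrier := {\<zero>\<^bsub>J 0\<^esub>}\<rparr> | Suc m \<Rightarrow> J m)"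
    and "dW \<equiv> (\<lambda>n. case n of 0 \<Rightarrow> (\<lambda>x\<in>{\<zero>\<^bsub>J 0\<^esub>}. \<zero>\<^bsub>J 0\<^esub>) | Suc m \<Rightarrow> dJ m)"
  obtains Z dZ \<epsilon>' i p q j where "split_ses A W dW Z dZ I dI i p q j" "injective_resolution A P Z dZ \<epsilon>'"
proof -
  note I' = injective_resolutionD[OF I] and J' = injective_resolutionD[OF J]
  have P: "module A P" and Q: "module A Q" and T: "module A T" and f: "f \<in> mod_hom A P Q" and g: "g \<in> mod_hom A Q T"
    and f_inj: "inj_on f (carrier P)" and fg: "f ` carrier P = a_kernel Q T g" and g_surj: "g ` carrier Q = carrier T"
    using ses by (auto simp: short_exact_def)
  interpret T: module A T by fact
  interpret I: module A "I n" for n by (rule I')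
  interpret J: module A "J n" for n by (rule J')
  \<comment> \<open>\<open>W\<close> is \<open>J\<close> moved up by one degree, with a zero module
    in degree \<open>0\<close>; its differentials keep their sign.\<close>
  have W_simps [simp]: "W 0 = (J 0)\<lparr>carrier := {\<zero>\<^bsub>J 0\<^esub>}\<rparr>" "W (Suc m) = J m" for m by (simp_all add: W_def)
  have dW_simps [simp]: "dW 0 = (\<lambda>x\<in>{\<zero>\<^bsub>J 0\<^esub>}. \<zero>\<^bsub>J 0\<^esub>)" "dW (Suc m) = dJ m" for m by (simp_all add: dW_def)
  have W_inj: "injective_module A (W n)" for n
    by (cases n) (use J'(1) injective_zero_module[OF J'(2)] in auto)
  then have W: "module A (W n)" for n by (rule injective_moduleD)
  interpret W: module A "W n" for n by (rule W)
  have "mod_hom A ((J 0)\<lparr>carrier := {\<zero>\<^bsub>J 0\<^esub>}\<rparr>) (J 0) = mod_hom A (W 0) (W (Suc 0))" by simp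
  then have dW: "dW n \<in> mod_hom A (W n) (W (Suc n))" for n
    using mod_hom_null[OF W J'(2), of 0 0] J'(4) by (cases n) auto
  have W_complex: "is_complex A W dW"
    unfolding is_complex_def
  proof (intro conjI allI ballI W dW)
    fix n x assume "x \<in> carrier (W n)"
    then show "dW (Suc n) (dW n x) = \<zero>\<^bsub>W (Suc (Suc n))\<^esub>"
      using mod_hom_zero[OF J'(2) J'(2) J'(4)] is_complexD(3)[OF J'(8)] by (cases n) auto
  qed
  \<comment> \<open>The lift goes into the negated resolution, so \<open>\<gamma>\<close>
    anticommutes with the differentials and the cone differential
    \<open>(w, x) -> (dW w + \<gamma> x, dI x)\<close> squares to zero.\<close>
  obtain \<gamma> where "chain_map A I dI J (\<lambda>n. \<lambda>x\<in>carrier (J n). \<ominus>\<^bsub>J (Suc n)\<^esub> dJ n x) \<gamma>"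
    and \<gamma>0: "\<And>x. x \<in> carrier Q \<Longrightarrow> \<gamma> 0 (\<epsilon> x) = \<eta> (g x)"
    using lift_exists[OF I injective_resolution_neg[OF J] Q T g] by blast
  note \<gamma>_map = chain_mapD[OF this(1)]
  have \<gamma>: "\<gamma> n \<in> mod_hom A (I n) (W (Suc n))" for n using \<gamma>_map(1) by simp
  have \<gamma>_anti: "dW (Suc n) (\<gamma> n x) \<oplus>\<^bsub>W (Suc (Suc n))\<^esub> \<gamma> (Suc n) (dI n x) = \<zero>\<^bsub>W (Suc (Suc n))\<^esub>"
    if "x \<in> carrier (I n)" for n x
  proof -
    have c: "\<gamma> n x \<in> carrier (J n)" by (rule mod_hom_closed[OF \<gamma>_map(1) that])
    have "\<gamma> (Suc n) (dI n x) = \<ominus>\<^bsub>J (Suc n)\<^esub> dJ n (\<gamma> n x)"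
      using \<gamma>_map(2)[OF that] c by simp
    then show ?thesis using J.r_neg[OF mod_hom_closed[OF J'(4) c]] by simp
  qed
  have "\<exists>(Z :: ('a, 'u) module) i p q j. is_biproduct A (W n) (I n) Z i p q j" for n
    by (rule biproduct_exists[OF inf W I'(2)])
  then obtain Z :: "nat \<Rightarrow> ('a, 'u) module" and i p q j where "\<And>n. is_biproduct A (W n) (I n) (Z n) (i n) (p n) (q n) (j n)" by metis
  note B' = this and B = is_biproductD[OF this]
  interpret Z: module A "Z n" for n by (rule B)
  define t where "t n = (\<lambda>z\<in>carrier (Z n). (\<lambda>z\<in>carrier (Z n). dW n (q n z)) z \<oplus>\<^bsub>W (Suc n)\<^esub> (\<lambda>z\<in>carrier (Z n). \<gamma> n (p n z)) z)" for n
  have t: "t n \<in> mod_hom A (Z n) (W (Suc n))" for n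
    unfolding t_def by (intro mod_hom_sum mod_hom_comp[OF B(3) B(6) dW] mod_hom_comp[OF B(3) B(5) \<gamma>] B(3) W)
  define s where "s n = (\<lambda>z\<in>carrier (Z n). dI n (p n z))" for n
  have s: "s n \<in> mod_hom A (Z n) (I (Suc n))" for n
    unfolding s_def by (rule mod_hom_comp[OF B(3) B(5) I'(4)])
  define dZ where "dZ n = (\<lambda>z\<in>carrier (Z n). (\<lambda>z\<in>carrier (Z n). i (Suc n) (t n z)) z \<oplus>\<^bsub>Z (Suc n)\<^esub>
    (\<lambda>z\<in>carrier (Z n). j (Suc n) (s n z)) z)" for n
  have dZ: "dZ n \<in> mod_hom A (Z n) (Z (Suc n))" for n
    unfolding dZ_def by (intro mod_hom_sum mod_hom_comp[OF B(3) t B(4)] mod_hom_comp[OF B(3) s B(7)] B(3))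
  note cl = mod_hom_closed[OF B(4)] mod_hom_closed[OF B(5)] mod_hom_closed[OF B(6)] mod_hom_closed[OF B(7)]
    mod_hom_closed[OF dW] mod_hom_closed[OF \<gamma>] mod_hom_closed[OF I'(4)] mod_hom_closed[OF dZ]
    mod_hom_closed[OF s] mod_hom_closed[OF t]
  have qdZ: "q (Suc n) (dZ n z) = dW n (q n z) \<oplus>\<^bsub>W (Suc n)\<^esub> \<gamma> n (p n z)" if "z \<in> carrier (Z n)" for n z
  proof -
    have "q (Suc n) (dZ n z) = t n z"
      using that by (simp add: dZ_def mod_hom_add[OF B(6)] cl B(8,11) del: W_simps)
    then show ?thesis using that by (simp add: t_def del: W_simps)
  qed
  have pdZ: "p (Suc n) (dZ n z) = dI n (p n z)" if "z \<in> carrier (Z n)" for n z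
  proof -
    have "p (Suc n) (dZ n z) = s n z"
      using that by (simp add: dZ_def mod_hom_add[OF B(5)] cl B(9,10) del: W_simps)
    then show ?thesis using that by (simp add: s_def)
  qed
  have Z_eqI: "z = z'" if "z \<in> carrier (Z n)" "z' \<in> carrier (Z n)" "p n z = p n z'" "q n z = q n z'" for n z z'
    using B(12)[OF that(1)] B(12)[OF that(2)] unfolding that(3,4) by (rule trans[OF sym])
  have zeros: "i n \<zero>\<^bsub>W n\<^esub> = \<zero>\<^bsub>Z n\<^esub>" "j n \<zero>\<^bsub>I n\<^esub> = \<zero>\<^bsub>Z n\<^esub>" "p n \<zero>\<^bsub>Z n\<^esub> = \<zero>\<^bsub>I n\<^esub>" "q n \<zero>\<^bsub>Z n\<^esub> = \<zero>\<^bsub>W n\<^esub>"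
    "dW n \<zero>\<^bsub>W n\<^esub> = \<zero>\<^bsub>W (Suc n)\<^esub>" "dI n \<zero>\<^bsub>I n\<^esub> = \<zero>\<^bsub>I (Suc n)\<^esub>" "\<gamma> n \<zero>\<^bsub>I n\<^esub> = \<zero>\<^bsub>W (Suc n)\<^esub>" for n
    using mod_hom_zero[OF B(1,3,4)] mod_hom_zero[OF B(2,3,7)] mod_hom_zero[OF B(3,2,5)] mod_hom_zero[OF B(3,1,6)]
      mod_hom_zero[OF W W dW] mod_hom_zero[OF I'(2) I'(2) I'(4)] mod_hom_zero[OF I'(2) W \<gamma>] by blast+
  have ddZ: "dZ (Suc n) (dZ n z) = \<zero>\<^bsub>Z (Suc (Suc n))\<^esub>" if z: "z \<in> carrier (Z n)" for n z
  proof (rule Z_eqI)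
    show "p (Suc (Suc n)) (dZ (Suc n) (dZ n z)) = p (Suc (Suc n)) \<zero>\<^bsub>Z (Suc (Suc n))\<^esub>"
      using z by (simp add: pdZ cl zeros is_complexD(3)[OF I'(8)])
    have "q (Suc (Suc n)) (dZ (Suc n) (dZ n z)) = dW (Suc n) (dW n (q n z)) \<oplus>\<^bsub>W (Suc (Suc n))\<^esub>
       (dW (Suc n) (\<gamma> n (p n z)) \<oplus>\<^bsub>W (Suc (Suc n))\<^esub> \<gamma> (Suc n) (dI n (p n z)))"
      using z by (simp add: qdZ pdZ cl mod_hom_add[OF dW] W.a_assoc del: W_simps dW_simps)
    then show "q (Suc (Suc n)) (dZ (Suc n) (dZ n z)) = q (Suc (Suc n)) \<zero>\<^bsub>Z (Suc (Suc n))\<^esub>"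
      using z by (simp add: zeros is_complexD(3)[OF W_complex] \<gamma>_anti cl del: W_simps dW_simps)
  qed (use z in \<open>simp_all add: cl\<close>)
  have Z_complex: "is_complex A Z dZ"
    unfolding is_complex_def using B(3) dZ ddZ by blast
  have "split_ses A W dW Z dZ I dI i p q j"
  proof
    fix n w assume w: "w \<in> carrier (W n)"
    show "dZ n (i n w) = i (Suc n) (dW n w)"
      by (rule Z_eqI[of _ "Suc n"]) (use w in \<open>simp_all add: cl pdZ qdZ B(8,9) zeros del: W_simps dW_simps\<close>)
  qed (use W_complex Z_complex I'(8) B pdZ in auto)
  moreover
  have ker0: "dW 0 y = \<zero>\<^bsub>W (Suc 0)\<^esub>" if "y \<in> carrier (W 0)" for y
    using that by simp
  note \<epsilon>cl = mod_hom_closed[OF I'(3)] and fcl = mod_hom_closed[OF f]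
  \<comment> \<open>In degree \<open>0\<close> the summand \<open>W 0\<close> is zero, so
    \<open>P\<close> embeds through \<open>f\<close> and \<open>\<epsilon>\<close> into the part
    \<open>I 0\<close>. The cone differential kills the image because \<open>\<gamma> 0\<close>
    sends \<open>\<epsilon> (f x)\<close> to \<open>\<eta> (g (f x))\<close>, which is zero.\<close>
  define \<epsilon>' where "\<epsilon>' = (\<lambda>x\<in>carrier P. j 0 ((\<lambda>x\<in>carrier P. \<epsilon> (f x)) x))"
  have e': "\<epsilon>' \<in> mod_hom A P (Z 0)"
    unfolding \<epsilon>'_def by (rule mod_hom_comp[OF P mod_hom_comp[OF P f I'(3)] B(7)])
  have gf: "g (f x) = \<zero>\<^bsub>T\<^esub>" if "x \<in> carrier P" for x
  proof -
    have "f x \<in> a_kernel Q T g" unfolding fg[symmetric] using that by blast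
    then show ?thesis by (simp add: a_kernel_def')
  qed
  have "injective_resolution A P Z dZ \<epsilon>'"
    unfolding injective_resolution_def
  proof (intro conjI allI)
    show "injective_module A (Z n)" for n
      by (rule injective_biproduct[OF B' W_inj I'(1)])
    show "\<epsilon>' \<in> mod_hom A P (Z 0)" "dZ n \<in> mod_hom A (Z n) (Z (Suc n))" for n
      by (fact e' dZ)+
    show "inj_on \<epsilon>' (carrier P)"
    proof (rule inj_onI)
      fix x y assume "x \<in> carrier P" "y \<in> carrier P" "\<epsilon>' x = \<epsilon>' y"
      then have "p 0 (j 0 (\<epsilon> (f x))) = p 0 (j 0 (\<epsilon> (f y)))" by (simp add: \<epsilon>'_def)
      then have "\<epsilon> (f x) = \<epsilon> (f y)"
        using B(10)[OF \<epsilon>cl[OF fcl[OF \<open>x \<in> carrier P\<close>]]] B(10)[OF \<epsilon>cl[OF fcl[OF \<open>y \<in> carrier P\<close>]]] by simp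
      then show "x = y"
        using inj_onD[OF f_inj] inj_onD[OF I'(5)] fcl \<open>x \<in> carrier P\<close> \<open>y \<in> carrier P\<close> by blast
    qed
    show "\<epsilon>' ` carrier P = a_kernel (Z 0) (Z 1) (dZ 0)"
    proof (intro equalityI subsetI)
      fix z assume "z \<in> \<epsilon>' ` carrier P"
      then obtain x where x: "x \<in> carrier P" "z = j 0 (\<epsilon> (f x))" by (auto simp: \<epsilon>'_def)
      have z: "z \<in> carrier (Z 0)" using x by (simp add: cl \<epsilon>cl fcl)
      have "dZ 0 z = \<zero>\<^bsub>Z (Suc 0)\<^esub>"
      proof (rule Z_eqI)
        show "p (Suc 0) (dZ 0 z) = p (Suc 0) \<zero>\<^bsub>Z (Suc 0)\<^esub>"
          using x z I'(6)[of "\<epsilon> (f x)"] by (simp add: pdZ B(10) cl \<epsilon>cl fcl zeros)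
        have "q (Suc 0) (dZ 0 z) = \<gamma> 0 (\<epsilon> (f x))"
          unfolding qdZ[OF z] unfolding x(2) using x(1) by (simp add: B(10,11) cl \<epsilon>cl fcl zeros del: W_simps dW_simps)
        then show "q (Suc 0) (dZ 0 z) = q (Suc 0) \<zero>\<^bsub>Z (Suc 0)\<^esub>"
          using x mod_hom_zero[OF T J'(2,3)] by (simp add: \<gamma>0 fcl gf zeros)
      qed (use z in \<open>simp_all add: cl\<close>)
      then show "z \<in> a_kernel (Z 0) (Z 1) (dZ 0)" using z by (simp add: a_kernel_def')
    next
      fix z assume "z \<in> a_kernel (Z 0) (Z 1) (dZ 0)"
      then have z: "z \<in> carrier (Z 0)" and dz: "dZ 0 z = \<zero>\<^bsub>Z (Suc 0)\<^esub>" by (simp_all add: a_kernel_def')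
      have "dI 0 (p 0 z) = \<zero>\<^bsub>I 1\<^esub>" using pdZ[OF z] dz by (simp add: zeros)
      then obtain y where y: "y \<in> carrier Q" "p 0 z = \<epsilon> y" using I'(6)[of "p 0 z"] z by (auto simp: cl)
      \<comment> \<open>With \<open>p 0 z = \<epsilon> y\<close> this component of the differential
        is \<open>\<eta> (g y)\<close>; its vanishing puts \<open>y\<close> into the kernel of
        \<open>g\<close>, which is the image of \<open>f\<close>.\<close>
      have "\<gamma> 0 (p 0 z) = \<zero>\<^bsub>W (Suc 0)\<^esub>"
        using qdZ[OF z] dz ker0[OF cl(3)[OF z]] z by (simp add: zeros cl del: W_simps dW_simps)
      then have "\<eta> (g y) = \<eta> \<zero>\<^bsub>T\<^esub>"
        using y mod_hom_zero[OF T J'(2,3)] by (simp add: \<gamma>0)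
      then have "g y = \<zero>\<^bsub>T\<^esub>"
        using inj_onD[OF J'(5)] mod_hom_closed[OF g] y(1) by simp
      then have "y \<in> f ` carrier P" unfolding fg using y by (simp add: a_kernel_def')
      then obtain x where x: "x \<in> carrier P" "y = f x" by blast
      have "z = \<epsilon>' x"
      proof (rule Z_eqI)
        show "p 0 z = p 0 (\<epsilon>' x)" using x y by (simp add: \<epsilon>'_def B(10) \<epsilon>cl fcl)
        have "q 0 z \<in> carrier (W 0)" "q 0 (\<epsilon>' x) \<in> carrier (W 0)"
          using z x mod_hom_closed[OF e'] by (simp_all only: cl)
        then show "q 0 z = q 0 (\<epsilon>' x)" by simp
      qed (use z x mod_hom_closed[OF e'] in auto)
      then show "z \<in> \<epsilon>' ` carrier P" using x by blast
    qed
    fix n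
    show "dZ n ` carrier (Z n) = a_kernel (Z (Suc n)) (Z (Suc (Suc n))) (dZ (Suc n))"
    proof (intro equalityI subsetI)
      fix z assume "z \<in> dZ n ` carrier (Z n)"
      then show "z \<in> a_kernel (Z (Suc n)) (Z (Suc (Suc n))) (dZ (Suc n))"
        using ddZ by (auto simp: a_kernel_def' cl)
    next
      fix z assume "z \<in> a_kernel (Z (Suc n)) (Z (Suc (Suc n))) (dZ (Suc n))"
      then have z: "z \<in> carrier (Z (Suc n))" and dz: "dZ (Suc n) z = \<zero>\<^bsub>Z (Suc (Suc n))\<^esub>" by (simp_all add: a_kernel_def')
      have "dI (Suc n) (p (Suc n) z) = \<zero>\<^bsub>I (Suc (Suc n))\<^esub>" using pdZ[OF z] dz by (simp add: zeros)
      then obtain x where x: "x \<in> carrier (I n)" "p (Suc n) z = dI n x" using I'(7)[of "p (Suc n) z"] z by (auto simp: cl)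
      have "dW (Suc n) (q (Suc n) z) \<oplus>\<^bsub>W (Suc (Suc n))\<^esub> \<gamma> (Suc n) (dI n x) = \<zero>\<^bsub>W (Suc (Suc n))\<^esub>"
        using qdZ[OF z] dz x by (simp add: zeros del: W_simps dW_simps)
      then have "dW (Suc n) (q (Suc n) z) = dW (Suc n) (\<gamma> n x)"
        using \<gamma>_anti[OF x(1)] W.add.right_cancel[of "\<gamma> (Suc n) (dI n x)" "Suc (Suc n)" "dW (Suc n) (q (Suc n) z)" "dW (Suc n) (\<gamma> n x)"] z x(1)
        by (metis cl(3,5,6,7))
      then have "dW (Suc n) (q (Suc n) z \<ominus>\<^bsub>W (Suc n)\<^esub> \<gamma> n x) = \<zero>\<^bsub>W (Suc (Suc n))\<^esub>"
        using z x by (simp add: mod_hom_minus[OF W W dW] cl W.minus_eq_zero_iff del: W_simps dW_simps)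
      then have u: "dJ n (q (Suc n) z \<ominus>\<^bsub>J n\<^esub> \<gamma> n x) = \<zero>\<^bsub>J (Suc n)\<^esub>"
        by simp
      have uc: "q (Suc n) z \<in> carrier (J n)" "\<gamma> n x \<in> carrier (J n)"
        using cl(3)[OF z] cl(6)[OF x(1)] by simp_all
      \<comment> \<open>The \<open>W\<close>-component of \<open>z\<close> minus
        \<open>\<gamma> n x\<close> is a cocycle of \<open>W (Suc n) = J n\<close>. For
        \<open>n > 0\<close> it is a coboundary by exactness of \<open>J\<close>. For
        \<open>n = 0\<close> it is only known to be \<open>\<eta> v\<close>; surjectivity of
        \<open>g\<close> gives \<open>v = g y\<close>, and adding the cocycle
        \<open>\<epsilon> y\<close> to \<open>x\<close> absorbs it.\<close>
      have "\<exists>x'\<in>carrier (I n). \<exists>y\<in>carrier (W n). dI n x' = p (Suc n) z \<and> dW n y \<oplus>\<^bsub>W (Suc n)\<^esub> \<gamma> n x' = q (Suc n) z"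
      proof (cases n)
        case 0
        obtain v where v: "v \<in> carrier T" "q (Suc n) z \<ominus>\<^bsub>J n\<^esub> \<gamma> n x = \<eta> v"
          using J'(6)[of "q (Suc n) z \<ominus>\<^bsub>J n\<^esub> \<gamma> n x"] u uc 0 by auto
        then obtain y where y: "y \<in> carrier Q" "v = g y" unfolding g_surj[symmetric] by blast
        let ?x = "x \<oplus>\<^bsub>I n\<^esub> \<epsilon> y"
        have ey: "\<epsilon> y \<in> carrier (I n)" using y \<epsilon>cl 0 by simp
        have "dI n (\<epsilon> y) = \<zero>\<^bsub>I (Suc n)\<^esub>" using I'(6)[of "\<epsilon> y"] ey y 0 by auto
        then have "dI n ?x = p (Suc n) z"
          using x ey by (simp add: mod_hom_add[OF I'(4)] cl)
        moreover have "\<gamma> n ?x = q (Suc n) z"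
          using x ey v(2)[symmetric] y uc \<gamma>0[OF y(1)] 0 by (simp add: mod_hom_add[OF \<gamma>_map(1)] J.minus_cancel)
        moreover have "\<zero>\<^bsub>W n\<^esub> \<in> carrier (W n)" "?x \<in> carrier (I n)" using x ey by auto
        moreover have "dW n \<zero>\<^bsub>W n\<^esub> \<oplus>\<^bsub>W (Suc n)\<^esub> \<gamma> n ?x = \<gamma> n ?x"
          using calculation(4) by (simp add: zeros cl del: W_simps dW_simps)
        ultimately show ?thesis by metis
      next
        case (Suc m)
        then obtain y where y: "y \<in> carrier (J m)" "q (Suc n) z \<ominus>\<^bsub>J n\<^esub> \<gamma> n x = dJ m y"
          using J'(7)[of "q (Suc n) z \<ominus>\<^bsub>J n\<^esub> \<gamma> n x" m] u uc by auto
        then have "dW n y \<oplus>\<^bsub>W (Suc n)\<^esub> \<gamma> n x = q (Suc n) z"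
          using uc Suc y(2)[symmetric] by (simp add: J.minus_cancel)
        then show ?thesis using x y Suc by (metis W_simps(2))
      qed
      then obtain x' y where x': "x' \<in> carrier (I n)" "dI n x' = p (Suc n) z"
        and y: "y \<in> carrier (W n)" "dW n y \<oplus>\<^bsub>W (Suc n)\<^esub> \<gamma> n x' = q (Suc n) z" by blast
      define z' where "z' = i n y \<oplus>\<^bsub>Z n\<^esub> j n x'"
      have z': "z' \<in> carrier (Z n)" "p n z' = x'" "q n z' = y"
        using x'(1) y(1) by (simp_all add: z'_def cl mod_hom_add[OF B(5)] mod_hom_add[OF B(6)] B(8-11) del: W_simps)
      have "z = dZ n z'"
        by (rule Z_eqI[of _ "Suc n"]) (use z z' x' y in \<open>simp_all add: cl pdZ qdZ del: W_simps dW_simps\<close>)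
      then show "z \<in> dZ n ` carrier (Z n)" using z' by blast
    qed
  qed
  ultimately show ?thesis using that by blast
qed

section \<open>Enough injectives\<close>

definition divisible_group :: "('d, 'm) monoid_scheme \<Rightarrow> bool" where
  "divisible_group D \<longleftrightarrow> comm_group D \<and> (\<forall>y\<in>carrier D. \<forall>k::nat. k > 0 \<longrightarrow> (\<exists>z\<in>carrier D. z [^]\<^bsub>D\<^esub> k = y))"

text \<open>A partial homomorphism \<open>Q \<rightarrow> D\<close>, given by its graph.\<close>

definition partial_hom :: "('q, 'm) monoid_scheme \<Rightarrow> ('d, 'n) monoid_scheme \<Rightarrow> ('q \<times> 'd) set \<Rightarrow> bool" where
  "partial_hom Q D G \<longleftrightarrow> G \<subseteq> carrier Q \<times> carrier D \<and> (\<one>\<^bsub>Q\<^esub>, \<one>\<^bsub>D\<^esub>) \<in> G \<and>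
     (\<forall>x y x' y'. (x, y) \<in> G \<longrightarrow> (x', y') \<in> G \<longrightarrow> (x \<otimes>\<^bsub>Q\<^esub> x', y \<otimes>\<^bsub>D\<^esub> y') \<in> G) \<and>
     (\<forall>x y. (x, y) \<in> G \<longrightarrow> (inv\<^bsub>Q\<^esub> x, inv\<^bsub>D\<^esub> y) \<in> G) \<and>
     (\<forall>y. (\<one>\<^bsub>Q\<^esub>, y) \<in> G \<longrightarrow> y = \<one>\<^bsub>D\<^esub>)"

lemma partial_homD:
  assumes "partial_hom Q D G"
  shows "(x, y) \<in> G \<Longrightarrow> x \<in> carrier Q" "(x, y) \<in> G \<Longrightarrow> y \<in> carrier D" "(\<one>\<^bsub>Q\<^esub>, \<one>\<^bsub>D\<^esub>) \<in> G"
    "(x, y) \<in> G \<Longrightarrow> (x', y') \<in> G \<Longrightarrow> (x \<otimes>\<^bsub>Q\<^esub> x', y \<otimes>\<^bsub>D\<^esub> y') \<in> G"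
    "(x, y) \<in> G \<Longrightarrow> (inv\<^bsub>Q\<^esub> x, inv\<^bsub>D\<^esub> y) \<in> G" "(\<one>\<^bsub>Q\<^esub>, y) \<in> G \<Longrightarrow> y = \<one>\<^bsub>D\<^esub>"
  using assms unfolding partial_hom_def by blast+

text \<open>\<open>partial_hom\<close> asks for a unique value at the unit only; closure under
  products and inverses spreads this to every argument.\<close>

lemma partial_hom_unique:
  assumes Q: "comm_group Q" and D: "comm_group D" and G: "partial_hom Q D G" and "(x, y) \<in> G" "(x, y') \<in> G"
  shows "y = y'"
proof -
  interpret Q: comm_group Q by fact
  interpret D: comm_group D by fact
  note G' = partial_homD[OF G]
  have c: "x \<in> carrier Q" "y \<in> carrier D" "y' \<in> carrier D" using G' assms(4,5) by blast+
  have "(x \<otimes>\<^bsub>Q\<^esub> inv\<^bsub>Q\<^esub> x, y \<otimes>\<^bsub>D\<^esub> inv\<^bsub>D\<^esub> y') \<in> G"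
    by (rule G'(4)[OF assms(4) G'(5)[OF assms(5)]])
  then have "y \<otimes>\<^bsub>D\<^esub> inv\<^bsub>D\<^esub> y' = \<one>\<^bsub>D\<^esub>" using G'(6) c by simp
  then show ?thesis using c D.inv_equality[of y "inv\<^bsub>D\<^esub> y'"] by simp
qed

lemma partial_hom_int_pow:
  fixes n :: int
  assumes Q: "comm_group Q" and D: "comm_group D" and G: "partial_hom Q D G" and xy: "(x, y) \<in> G"
  shows "(x [^]\<^bsub>Q\<^esub> n, y [^]\<^bsub>D\<^esub> n) \<in> G"
proof -
  interpret Q: comm_group Q by fact
  interpret D: comm_group D by fact
  note G' = partial_homD[OF G]
  have nat: "(x [^]\<^bsub>Q\<^esub> k, y [^]\<^bsub>D\<^esub> k) \<in> G" for k :: nat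
    by (induction k) (use G'(3) G'(4)[OF _ xy] in auto)
  show ?thesis
    unfolding int_pow_def2 by (cases "n < 0") (simp_all only: if_True if_False nat G'(5)[OF nat])
qed

text \<open>The one-step extension in Baer's argument. The exponents \<open>n\<close> for which the
  \<open>n\<close>-th power of \<open>x\<close> already lies in the domain form a subgroup of the
  integers. A value \<open>d\<close> for \<open>x\<close> is admissible once it has the prescribed
  power at a generator \<open>k\<close> of that subgroup, and divisibility supplies such a
  \<open>k\<close>-th root.\<close>

lemma partial_hom_extend:
  assumes Q: "comm_group Q" and D: "divisible_group D" and G: "partial_hom Q D G" and x: "x \<in> carrier Q"
  shows "\<exists>G' d. partial_hom Q D G' \<and> G \<subseteq> G' \<and> (x, d) \<in> G'"
proof -
  have D': "comm_group D" using D by (simp add: divisible_group_def)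
  interpret Q: comm_group Q by fact
  interpret D: comm_group D by fact
  note G' = partial_homD[OF G]
  note uniq = partial_hom_unique[OF Q D' G]
  have "\<exists>d\<in>carrier D. \<forall>n::int. \<forall>y. (x [^]\<^bsub>Q\<^esub> n, y) \<in> G \<longrightarrow> d [^]\<^bsub>D\<^esub> n = y"
  proof (cases "\<exists>k::nat. k > 0 \<and> (\<exists>y. (x [^]\<^bsub>Q\<^esub> int k, y) \<in> G)")
    \<comment> \<open>No nonzero power of \<open>x\<close> lies in the domain, so there is no
      constraint and the unit serves as the value of \<open>x\<close>.\<close>
    case False
    have "n = 0" if "(x [^]\<^bsub>Q\<^esub> n, y) \<in> G" for n :: int and y
    proof (rule ccontr)
      assume "n \<noteq> 0"
      have "(x [^]\<^bsub>Q\<^esub> (-n), inv\<^bsub>D\<^esub> y) \<in> G" using G'(5)[OF that] x by (simp add: Q.int_pow_neg)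
      then show False
        using False that \<open>n \<noteq> 0\<close> by (cases "n > 0") (metis zero_less_imp_eq_int, metis neg_0_less_iff_less linorder_neqE zero_less_imp_eq_int)
    qed
    then have "y = \<one>\<^bsub>D\<^esub>" if "(x [^]\<^bsub>Q\<^esub> n, y) \<in> G" for n :: int and y
      using G'(6)[of y] that by force
    then have "\<one>\<^bsub>D\<^esub> [^]\<^bsub>D\<^esub> n = y" if "(x [^]\<^bsub>Q\<^esub> n, y) \<in> G" for n :: int and y
      unfolding D.int_pow_one using that by blast
    then show ?thesis using D.one_closed by blast
  next
    case True
    define k where "k = (LEAST k::nat. k > 0 \<and> (\<exists>y. (x [^]\<^bsub>Q\<^esub> int k, y) \<in> G))"
    have k: "k > 0" "\<exists>y. (x [^]\<^bsub>Q\<^esub> int k, y) \<in> G"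
      using LeastI_ex[OF True] by (simp_all add: k_def)
    have k_least: "\<not> (\<exists>y. (x [^]\<^bsub>Q\<^esub> int m, y) \<in> G)" if "0 < m" "m < k" for m :: nat
      using not_less_Least[of m "\<lambda>k. k > 0 \<and> (\<exists>y. (x [^]\<^bsub>Q\<^esub> int k, y) \<in> G)"] that by (auto simp: k_def)
    obtain y where y: "(x [^]\<^bsub>Q\<^esub> int k, y) \<in> G" using k by blast
    obtain d where d: "d \<in> carrier D" "d [^]\<^bsub>D\<^esub> k = y"
      using D G'(2)[OF y] k(1) unfolding divisible_group_def by blast
    have "d [^]\<^bsub>D\<^esub> n = z" if z: "(x [^]\<^bsub>Q\<^esub> n, z) \<in> G" for n :: int and z
    proof -
      \<comment> \<open>Division with remainder: the remainder \<open>m\<close> is again an exponent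
        whose power lies in the domain and is smaller than the minimal \<open>k\<close>, so it is
        zero.\<close>
      define t where "t = n div int k"
      define m where "m = nat (n mod int k)"
      have m: "int m = n - int k * t" "m < k"
        using k(1) by (simp_all add: m_def t_def minus_mult_div_eq_mod) (simp add: nat_less_iff)
      have kt: "(x [^]\<^bsub>Q\<^esub> (int k * t), y [^]\<^bsub>D\<^esub> t) \<in> G"
        using partial_hom_int_pow[OF Q D' G y, of t] x by (simp add: Q.int_pow_pow)
      have "(x [^]\<^bsub>Q\<^esub> int m, z \<otimes>\<^bsub>D\<^esub> inv\<^bsub>D\<^esub> (y [^]\<^bsub>D\<^esub> t)) \<in> G"
        using G'(4)[OF z G'(5)[OF kt]] x by (simp add: m(1) Q.int_pow_diff)
      then have "m = 0" using k_least[of m] m(2) by blast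
      then have n: "n = int k * t" using m(1) by simp
      have "z = y [^]\<^bsub>D\<^esub> t" using uniq[OF z kt[folded n]] .
      also have "\<dots> = d [^]\<^bsub>D\<^esub> n"
        using d(1) unfolding d(2)[symmetric] n by (simp add: D.int_pow_pow flip: int_pow_int)
      finally show ?thesis ..
    qed
    then show ?thesis using d(1) by blast
  qed
  then obtain d where d: "d \<in> carrier D" "\<And>(n::int) y. (x [^]\<^bsub>Q\<^esub> n, y) \<in> G \<Longrightarrow> d [^]\<^bsub>D\<^esub> n = y" by blast
  define G2 where "G2 = {(g \<otimes>\<^bsub>Q\<^esub> x [^]\<^bsub>Q\<^esub> n, h \<otimes>\<^bsub>D\<^esub> d [^]\<^bsub>D\<^esub> n) | g h (n::int). (g, h) \<in> G}"
  have G2I: "(g \<otimes>\<^bsub>Q\<^esub> x [^]\<^bsub>Q\<^esub> n, h \<otimes>\<^bsub>D\<^esub> d [^]\<^bsub>D\<^esub> n) \<in> G2" if "(g, h) \<in> G" for g h and n :: int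
    using that by (auto simp: G2_def)
  have sub: "G \<subseteq> G2"
  proof
    fix z assume "z \<in> G"
    then obtain g h where z: "z = (g, h)" "(g, h) \<in> G" by (cases z) auto
    then show "z \<in> G2" using G2I[OF z(2), of 0] G'(1,2)[OF z(2)] by simp
  qed
  have "(x, d) \<in> G2" using G2I[OF G'(3), of 1] x d(1) by simp
  moreover have "partial_hom Q D G2"
    unfolding partial_hom_def
  proof (intro conjI allI impI)
    show "G2 \<subseteq> carrier Q \<times> carrier D" using G'(1,2) x d(1) by (auto simp: G2_def)
    show "(\<one>\<^bsub>Q\<^esub>, \<one>\<^bsub>D\<^esub>) \<in> G2" using sub G'(3) by blast
  next
    fix a b a' b' assume "(a, b) \<in> G2" "(a', b') \<in> G2"
    then obtain g h g' h' and n m :: int where gh: "(g, h) \<in> G" "(g', h') \<in> G"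
      and ab: "a = g \<otimes>\<^bsub>Q\<^esub> x [^]\<^bsub>Q\<^esub> n" "b = h \<otimes>\<^bsub>D\<^esub> d [^]\<^bsub>D\<^esub> n" "a' = g' \<otimes>\<^bsub>Q\<^esub> x [^]\<^bsub>Q\<^esub> m" "b' = h' \<otimes>\<^bsub>D\<^esub> d [^]\<^bsub>D\<^esub> m"
      by (auto simp: G2_def)
    have "a \<otimes>\<^bsub>Q\<^esub> a' = (g \<otimes>\<^bsub>Q\<^esub> g') \<otimes>\<^bsub>Q\<^esub> x [^]\<^bsub>Q\<^esub> (n + m)" "b \<otimes>\<^bsub>D\<^esub> b' = (h \<otimes>\<^bsub>D\<^esub> h') \<otimes>\<^bsub>D\<^esub> d [^]\<^bsub>D\<^esub> (n + m)"
      using G'(1,2)[OF gh(1)] G'(1,2)[OF gh(2)] x d(1)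
      by (simp_all add: ab Q.int_pow_mult D.int_pow_mult Q.m_ac D.m_ac)
    then show "(a \<otimes>\<^bsub>Q\<^esub> a', b \<otimes>\<^bsub>D\<^esub> b') \<in> G2" using G2I[OF G'(4)[OF gh]] by simp
  next
    fix a b assume "(a, b) \<in> G2"
    then obtain g h and n :: int where gh: "(g, h) \<in> G" and ab: "a = g \<otimes>\<^bsub>Q\<^esub> x [^]\<^bsub>Q\<^esub> n" "b = h \<otimes>\<^bsub>D\<^esub> d [^]\<^bsub>D\<^esub> n"
      by (auto simp: G2_def)
    have "inv\<^bsub>Q\<^esub> a = inv\<^bsub>Q\<^esub> g \<otimes>\<^bsub>Q\<^esub> x [^]\<^bsub>Q\<^esub> (-n)" "inv\<^bsub>D\<^esub> b = inv\<^bsub>D\<^esub> h \<otimes>\<^bsub>D\<^esub> d [^]\<^bsub>D\<^esub> (-n)"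
      using G'(1,2)[OF gh] x d(1) by (simp_all add: ab Q.int_pow_neg D.int_pow_neg Q.inv_mult D.inv_mult)
    then show "(inv\<^bsub>Q\<^esub> a, inv\<^bsub>D\<^esub> b) \<in> G2" using G2I[OF G'(5)[OF gh]] by simp
  next
    fix b assume "(\<one>\<^bsub>Q\<^esub>, b) \<in> G2"
    then obtain g h and n :: int where gh: "(g, h) \<in> G" and ab: "\<one>\<^bsub>Q\<^esub> = g \<otimes>\<^bsub>Q\<^esub> x [^]\<^bsub>Q\<^esub> n" "b = h \<otimes>\<^bsub>D\<^esub> d [^]\<^bsub>D\<^esub> n"
      by (auto simp: G2_def)
    note c = G'(1,2)[OF gh]
    \<comment> \<open>If the unit arises from \<open>g\<close> and the \<open>n\<close>-th power of
      \<open>x\<close>, that power is the inverse of \<open>g\<close> and lies in the old domain;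
      compatibility of \<open>d\<close> then makes the values cancel.\<close>
    have "x [^]\<^bsub>Q\<^esub> n = inv\<^bsub>Q\<^esub> g"
      using ab(1)[symmetric] c x Q.inv_equality[of "x [^]\<^bsub>Q\<^esub> n" g] by (simp add: Q.m_comm)
    then have "d [^]\<^bsub>D\<^esub> n = inv\<^bsub>D\<^esub> h" using G'(5)[OF gh] by (intro d(2)) simp
    then show "b = \<one>\<^bsub>D\<^esub>" using c by (simp add: ab(2))
  qed
  ultimately show ?thesis using sub by blast
qed

text \<open>Zorn's lemma on graphs ordered by inclusion: a maximal one is total, since the one-step
  extension at any point must give it back.\<close>

lemma divisible_hom_extend:
  assumes Q: "comm_group Q" and D: "divisible_group D" and G0: "partial_hom Q D G0"
  obtains \<psi> where "\<psi> \<in> hom Q D" "\<And>x y. (x, y) \<in> G0 \<Longrightarrow> \<psi> x = y"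
proof -
  have D': "comm_group D" using D by (simp add: divisible_group_def)
  interpret Q: comm_group Q by fact
  interpret D: comm_group D by fact
  let ?A = "{G. partial_hom Q D G \<and> G0 \<subseteq> G}"
  have "\<exists>M\<in>?A. \<forall>X\<in>?A. M \<subseteq> X \<longrightarrow> X = M"
  proof (rule subset_Zorn_nonempty)
    show "?A \<noteq> {}" using G0 by blast
  next
    fix C assume ne: "C \<noteq> {}" and ch: "subset.chain ?A C"
    have CA: "G \<in> C \<Longrightarrow> partial_hom Q D G \<and> G0 \<subseteq> G" for G
      using ch unfolding subset_chain_def by blast
    note CD = partial_homD[OF CA[THEN conjunct1]]
    have dir: "\<exists>G\<in>C. s \<in> G \<and> t \<in> G" if st: "s \<in> \<Union>C" "t \<in> \<Union>C" for s t
    proof -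
      obtain S T where ST: "S \<in> C" "T \<in> C" "s \<in> S" "t \<in> T" using st by blast
      then have "S \<subseteq> T \<or> T \<subseteq> S" using ch unfolding subset_chain_def by blast
      then show ?thesis using ST by blast
    qed
    have "partial_hom Q D (\<Union>C)"
      unfolding partial_hom_def
    proof (intro conjI allI impI)
      show "\<Union>C \<subseteq> carrier Q \<times> carrier D" using CD(1,2) by auto
      show "(\<one>\<^bsub>Q\<^esub>, \<one>\<^bsub>D\<^esub>) \<in> \<Union>C" using ne CD(3) by auto
      show "(x \<otimes>\<^bsub>Q\<^esub> x', y \<otimes>\<^bsub>D\<^esub> y') \<in> \<Union>C" if "(x, y) \<in> \<Union>C" "(x', y') \<in> \<Union>C" for x y x' y'
        using dir[OF that] CD(4) by blast
      show "(inv\<^bsub>Q\<^esub> x, inv\<^bsub>D\<^esub> y) \<in> \<Union>C" if "(x, y) \<in> \<Union>C" for x y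
        using that CD(5) by blast
      show "y = \<one>\<^bsub>D\<^esub>" if "(\<one>\<^bsub>Q\<^esub>, y) \<in> \<Union>C" for y
        using that CD(6) by blast
    qed
    moreover have "G0 \<subseteq> \<Union>C" using ne CA by blast
    ultimately show "\<Union>C \<in> ?A" by blast
  qed
  then obtain G where GA: "G \<in> ?A" and Gmax: "\<forall>X\<in>?A. G \<subseteq> X \<longrightarrow> X = G" by (rule bexE)
  have G: "partial_hom Q D G" "G0 \<subseteq> G" using GA by simp_all
  have max: "X = G" if "partial_hom Q D X" "G \<subseteq> X" for X
    using Gmax[THEN bspec, of X] that G(2) by simp
  have "\<exists>y. (x, y) \<in> G" if x: "x \<in> carrier Q" for x
  proof -
    obtain X d where X: "partial_hom Q D X" "G \<subseteq> X" "(x, d) \<in> X"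
      using partial_hom_extend[OF Q D G(1) x] by blast
    show ?thesis using X(3) unfolding max[OF X(1,2)] by blast
  qed
  then obtain \<psi> where \<psi>: "\<And>x. x \<in> carrier Q \<Longrightarrow> (x, \<psi> x) \<in> G" by metis
  note G' = partial_homD[OF G(1)]
  note uniq = partial_hom_unique[OF Q D' G(1)]
  have "\<psi> \<in> hom Q D"
  proof (rule homI)
    show "\<psi> x \<in> carrier D" if "x \<in> carrier Q" for x using G'(2)[OF \<psi>[OF that]] .
    show "\<psi> (x \<otimes>\<^bsub>Q\<^esub> y) = \<psi> x \<otimes>\<^bsub>D\<^esub> \<psi> y" if "x \<in> carrier Q" "y \<in> carrier Q" for x y
      using uniq[OF \<psi> G'(4)[OF \<psi>[OF that(1)] \<psi>[OF that(2)]]] that by simp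
  qed
  moreover have "\<psi> x = y" if "(x, y) \<in> G0" for x y
    using uniq[OF \<psi>] G(2) G'(1) that by blast
  ultimately show ?thesis using that by blast
qed

text \<open>This is Hom over the integers from \<open>A\<close> to \<open>D\<close>, with
  \<open>A\<close> acting through the argument; \<open>D\<close> is written
  multiplicatively.\<close>

definition coinduced :: "'a ring \<Rightarrow> ('d, 'm) monoid_scheme \<Rightarrow> ('a, 'a \<Rightarrow> 'd) module" where
  "coinduced A D = \<lparr>carrier = {f \<in> extensional (carrier A). f \<in> hom (add_monoid A) D}, monoid.mult = undefined, one = undefined,
     ring.zero = (\<lambda>a\<in>carrier A. \<one>\<^bsub>D\<^esub>), add = (\<lambda>f g. \<lambda>a\<in>carrier A. f a \<otimes>\<^bsub>D\<^esub> g a),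
     smult = (\<lambda>r f. \<lambda>a\<in>carrier A. f (a \<otimes>\<^bsub>A\<^esub> r))\<rparr>"

lemma coinduced_carrier:
  "f \<in> carrier (coinduced A D) \<longleftrightarrow> f \<in> extensional (carrier A) \<and> (\<forall>a\<in>carrier A. f a \<in> carrier D) \<and>
     (\<forall>a\<in>carrier A. \<forall>b\<in>carrier A. f (a \<oplus>\<^bsub>A\<^esub> b) = f a \<otimes>\<^bsub>D\<^esub> f b)"
  by (auto simp: coinduced_def hom_def)

lemma coinduced_module:
  assumes A: "cring A" and D: "comm_group D"
  shows "module A (coinduced A D)"
proof -
  interpret A: cring A by fact
  interpret D: comm_group D by fact
  let ?E = "coinduced A D"
  have ops: "\<zero>\<^bsub>?E\<^esub> = (\<lambda>a\<in>carrier A. \<one>\<^bsub>D\<^esub>)" "f \<oplus>\<^bsub>?E\<^esub> g = (\<lambda>a\<in>carrier A. f a \<otimes>\<^bsub>D\<^esub> g a)"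
    "r \<odot>\<^bsub>?E\<^esub> f = (\<lambda>a\<in>carrier A. f (a \<otimes>\<^bsub>A\<^esub> r))" for f g r
    by (simp_all add: coinduced_def)
  have eqI: "f = g" if "f \<in> extensional (carrier A)" "g \<in> extensional (carrier A)" "\<And>a. a \<in> carrier A \<Longrightarrow> f a = g a" for f g :: "'a \<Rightarrow> 'b"
    using that by (rule extensionalityI)
  show ?thesis
  proof (rule moduleI)
    show "abelian_group ?E"
    proof (rule abelian_groupI)
      fix f assume f: "f \<in> carrier ?E"
      have "(\<lambda>a\<in>carrier A. inv\<^bsub>D\<^esub> f a) \<in> carrier ?E"
        using f by (auto simp: coinduced_carrier D.inv_mult)
      moreover have "(\<lambda>a\<in>carrier A. inv\<^bsub>D\<^esub> f a) \<oplus>\<^bsub>?E\<^esub> f = \<zero>\<^bsub>?E\<^esub>"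
        unfolding ops by (rule restrict_ext) (use f in \<open>auto simp: coinduced_carrier\<close>)
      ultimately show "\<exists>g\<in>carrier ?E. g \<oplus>\<^bsub>?E\<^esub> f = \<zero>\<^bsub>?E\<^esub>" by blast
      show "\<zero>\<^bsub>?E\<^esub> \<oplus>\<^bsub>?E\<^esub> f = f"
        by (rule eqI) (use f in \<open>auto simp: ops coinduced_carrier\<close>)
    next
      fix f g h assume "f \<in> carrier ?E" "g \<in> carrier ?E" "h \<in> carrier ?E"
      then show "f \<oplus>\<^bsub>?E\<^esub> g \<oplus>\<^bsub>?E\<^esub> h = f \<oplus>\<^bsub>?E\<^esub> (g \<oplus>\<^bsub>?E\<^esub> h)"
        unfolding ops by (intro restrict_ext) (auto simp: coinduced_carrier D.m_assoc)
    next
      fix f g assume "f \<in> carrier ?E" "g \<in> carrier ?E"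
      then show "f \<oplus>\<^bsub>?E\<^esub> g = g \<oplus>\<^bsub>?E\<^esub> f"
        unfolding ops by (intro restrict_ext) (auto simp: coinduced_carrier D.m_comm)
    next
      fix f g assume fg: "f \<in> carrier ?E" "g \<in> carrier ?E"
      then show "f \<oplus>\<^bsub>?E\<^esub> g \<in> carrier ?E"
        unfolding ops by (auto simp: coinduced_carrier D.m_ac)
    qed (simp add: ops coinduced_carrier)
  next
    fix r f assume "r \<in> carrier A" "f \<in> carrier ?E"
    then show "r \<odot>\<^bsub>?E\<^esub> f \<in> carrier ?E"
      unfolding ops by (auto simp: coinduced_carrier A.l_distr)
  next
    fix r s f assume "r \<in> carrier A" "s \<in> carrier A" "f \<in> carrier ?E"
    then show "(r \<oplus>\<^bsub>A\<^esub> s) \<odot>\<^bsub>?E\<^esub> f = r \<odot>\<^bsub>?E\<^esub> f \<oplus>\<^bsub>?E\<^esub> s \<odot>\<^bsub>?E\<^esub> f"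
      "r \<otimes>\<^bsub>A\<^esub> s \<odot>\<^bsub>?E\<^esub> f = r \<odot>\<^bsub>?E\<^esub> (s \<odot>\<^bsub>?E\<^esub> f)"
      unfolding ops by (intro restrict_ext; auto simp: coinduced_carrier A.r_distr A.m_assoc)+
  next
    fix r f g assume "r \<in> carrier A" "f \<in> carrier ?E" "g \<in> carrier ?E"
    then show "r \<odot>\<^bsub>?E\<^esub> (f \<oplus>\<^bsub>?E\<^esub> g) = r \<odot>\<^bsub>?E\<^esub> f \<oplus>\<^bsub>?E\<^esub> r \<odot>\<^bsub>?E\<^esub> g"
      unfolding ops by (intro restrict_ext) (auto simp: coinduced_carrier)
  next
    fix f assume f: "f \<in> carrier ?E"
    show "\<one>\<^bsub>A\<^esub> \<odot>\<^bsub>?E\<^esub> f = f"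
      by (rule eqI) (use f in \<open>auto simp: ops coinduced_carrier\<close>)
  qed (rule A)
qed

text \<open>Homomorphisms into the coinduced module correspond to additive maps into \<open>D\<close>, by evaluation at \<open>1\<close>.\<close>

lemma coinduced_hom:
  assumes M: "module A M" and D: "comm_group D" and \<psi>: "\<psi> \<in> hom (add_monoid M) D"
  shows "(\<lambda>x\<in>carrier M. \<lambda>a\<in>carrier A. \<psi> (a \<odot>\<^bsub>M\<^esub> x)) \<in> mod_hom A M (coinduced A D)"
proof (rule restrict_mod_homI[OF M])
  interpret M: module A M by fact
  interpret D: comm_group D by fact
  have cl: "\<psi> x \<in> carrier D" if "x \<in> carrier M" for x using \<psi> that by (auto simp: hom_def)
  have add: "\<psi> (x \<oplus>\<^bsub>M\<^esub> y) = \<psi> x \<otimes>\<^bsub>D\<^esub> \<psi> y" if "x \<in> carrier M" "y \<in> carrier M" for x y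
    using \<psi> that by (auto simp: hom_def)
  show "(\<lambda>a\<in>carrier A. \<psi> (a \<odot>\<^bsub>M\<^esub> x)) \<in> carrier (coinduced A D)" if "x \<in> carrier M" for x
    using that by (auto simp: coinduced_carrier cl add M.smult_l_distr)
  show "(\<lambda>a\<in>carrier A. \<psi> (a \<odot>\<^bsub>M\<^esub> (x \<oplus>\<^bsub>M\<^esub> y))) =
      (\<lambda>a\<in>carrier A. \<psi> (a \<odot>\<^bsub>M\<^esub> x)) \<oplus>\<^bsub>coinduced A D\<^esub> (\<lambda>a\<in>carrier A. \<psi> (a \<odot>\<^bsub>M\<^esub> y))"
    if "x \<in> carrier M" "y \<in> carrier M" for x y
    using that by (auto simp: coinduced_def add M.smult_r_distr intro!: restrict_ext)
  show "(\<lambda>a\<in>carrier A. \<psi> (a \<odot>\<^bsub>M\<^esub> (r \<odot>\<^bsub>M\<^esub> x))) = r \<odot>\<^bsub>coinduced A D\<^esub> (\<lambda>a\<in>carrier A. \<psi> (a \<odot>\<^bsub>M\<^esub> x))"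
    if "r \<in> carrier A" "x \<in> carrier M" for r x
    using that by (auto simp: coinduced_def M.smult_assoc1 intro!: restrict_ext)
qed

text \<open>By adjunction it suffices to extend the additive map \<open>x -> f x 1\<close> along
  \<open>i\<close>, which divisibility of \<open>D\<close> allows; \<open>coinduced_hom\<close>
  turns the result back into an \<open>A\<close>-linear map.\<close>

lemma coinduced_extend:
  assumes P: "module A P" and Q: "module A Q" and D: "divisible_group D"
    and i: "i \<in> mod_hom A P Q" "inj_on i (carrier P)" and f: "f \<in> mod_hom A P (coinduced A D)"
  shows "\<exists>g\<in>mod_hom A Q (coinduced A D). \<forall>x\<in>carrier P. g (i x) = f x"
proof -
  have D': "comm_group D" using D by (simp add: divisible_group_def)
  interpret P: module A P by fact
  interpret Q: module A Q by fact
  interpret D: comm_group D by fact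
  have E: "module A (coinduced A D)" by (rule coinduced_module[OF P.R.is_cring D'])
  note icl = mod_hom_closed[OF i(1)]
  have fE: "f x \<in> carrier (coinduced A D)" if "x \<in> carrier P" for x by (rule mod_hom_closed[OF f that])
  have fx: "f x \<one>\<^bsub>A\<^esub> \<in> carrier D" if "x \<in> carrier P" for x
    using fE[OF that] by (simp add: coinduced_carrier)
  have fadd: "f (x \<oplus>\<^bsub>P\<^esub> y) \<one>\<^bsub>A\<^esub> = f x \<one>\<^bsub>A\<^esub> \<otimes>\<^bsub>D\<^esub> f y \<one>\<^bsub>A\<^esub>" if "x \<in> carrier P" "y \<in> carrier P" for x y
    using mod_hom_add[OF f that] by (simp add: coinduced_def)
  have f0: "f \<zero>\<^bsub>P\<^esub> \<one>\<^bsub>A\<^esub> = \<one>\<^bsub>D\<^esub>"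
    using mod_hom_zero[OF P E f] by (simp add: coinduced_def)
  define G0 where "G0 = {(i x, f x \<one>\<^bsub>A\<^esub>) | x. x \<in> carrier P}"
  have "partial_hom (add_monoid Q) D G0"
    unfolding partial_hom_def
  proof (intro conjI allI impI)
    show "G0 \<subseteq> carrier (add_monoid Q) \<times> carrier D" using icl fx by (auto simp: G0_def)
    show "(\<one>\<^bsub>add_monoid Q\<^esub>, \<one>\<^bsub>D\<^esub>) \<in> G0"
      using mod_hom_zero[OF P Q i(1)] f0 P.zero_closed by (auto simp: G0_def intro!: exI[of _ "\<zero>\<^bsub>P\<^esub>"])
  next
    fix a b a' b' assume "(a, b) \<in> G0" "(a', b') \<in> G0"
    then obtain x y where "x \<in> carrier P" "y \<in> carrier P" "a = i x" "b = f x \<one>\<^bsub>A\<^esub>" "a' = i y" "b' = f y \<one>\<^bsub>A\<^esub>"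
      by (auto simp: G0_def)
    then show "(a \<otimes>\<^bsub>add_monoid Q\<^esub> a', b \<otimes>\<^bsub>D\<^esub> b') \<in> G0"
      using mod_hom_add[OF i(1)] fadd by (auto simp: G0_def intro!: exI[of _ "x \<oplus>\<^bsub>P\<^esub> y"])
  next
    fix a b assume "(a, b) \<in> G0"
    then obtain x where x: "x \<in> carrier P" "a = i x" "b = f x \<one>\<^bsub>A\<^esub>" by (auto simp: G0_def)
    have "f (\<ominus>\<^bsub>P\<^esub> x) \<one>\<^bsub>A\<^esub> \<otimes>\<^bsub>D\<^esub> f x \<one>\<^bsub>A\<^esub> = \<one>\<^bsub>D\<^esub>"
      using fadd[of "\<ominus>\<^bsub>P\<^esub> x" x] x(1) f0 by (simp add: P.l_neg)
    then have "inv\<^bsub>D\<^esub> b = f (\<ominus>\<^bsub>P\<^esub> x) \<one>\<^bsub>A\<^esub>"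
      unfolding x(3) using x(1) fx by (intro D.inv_equality) auto
    moreover have "inv\<^bsub>add_monoid Q\<^esub> a = i (\<ominus>\<^bsub>P\<^esub> x)"
      using mod_hom_uminus[OF P Q i(1) x(1)] by (simp add: x(2) a_inv_def)
    ultimately show "(inv\<^bsub>add_monoid Q\<^esub> a, inv\<^bsub>D\<^esub> b) \<in> G0"
      using x(1) by (auto simp: G0_def intro!: exI[of _ "\<ominus>\<^bsub>P\<^esub> x"])
  next
    fix b assume "(\<one>\<^bsub>add_monoid Q\<^esub>, b) \<in> G0"
    then obtain x where x: "x \<in> carrier P" "i x = \<zero>\<^bsub>Q\<^esub>" "b = f x \<one>\<^bsub>A\<^esub>" by (auto simp: G0_def)
    then have "x = \<zero>\<^bsub>P\<^esub>" using inj_onD[OF i(2), of x "\<zero>\<^bsub>P\<^esub>"] mod_hom_zero[OF P Q i(1)] by simp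
    then show "b = \<one>\<^bsub>D\<^esub>" using x(3) f0 by simp
  qed
  then obtain \<psi> where \<psi>: "\<psi> \<in> hom (add_monoid Q) D" "\<And>x y. (x, y) \<in> G0 \<Longrightarrow> \<psi> x = y"
    using divisible_hom_extend[OF Q.a_comm_group D] by blast
  have "(\<lambda>a\<in>carrier A. \<psi> (a \<odot>\<^bsub>Q\<^esub> i x)) = f x" if x: "x \<in> carrier P" for x
  proof (rule extensionalityI[of _ "carrier A"])
    show "f x \<in> extensional (carrier A)" using fE[OF x] by (simp add: coinduced_carrier)
    fix a assume a: "a \<in> carrier A"
    have "\<psi> (i (a \<odot>\<^bsub>P\<^esub> x)) = f (a \<odot>\<^bsub>P\<^esub> x) \<one>\<^bsub>A\<^esub>"
      by (rule \<psi>(2)) (use a x in \<open>auto simp: G0_def\<close>)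
    also have "\<dots> = f x a"
      using a mod_hom_smult[OF f a x] by (simp add: coinduced_def)
    finally show "(\<lambda>a\<in>carrier A. \<psi> (a \<odot>\<^bsub>Q\<^esub> i x)) a = f x a"
      using a x by (simp add: mod_hom_smult[OF i(1)])
  qed simp
  then show ?thesis
    by (intro bexI[OF _ coinduced_hom[OF Q D' \<psi>(1)]]) (simp add: icl)
qed

text \<open>\<open>M\<close> is a quotient of the free abelian group on its elements, hence embeds into the quotient of the rational
  vector space on its elements by the same relations.\<close>

definition rational :: "('b \<Rightarrow>\<^sub>0 int) \<Rightarrow> ('b \<Rightarrow>\<^sub>0 rat)" where
  "rational = Poly_Mapping.map rat_of_int"

lemma lookup_rational: "Poly_Mapping.lookup (rational w) b = rat_of_int (Poly_Mapping.lookup w b)"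
  by (simp add: rational_def Poly_Mapping.map.rep_eq when_def)

lemma rational_diff: "rational (v - w) = rational v - rational w"
  and rational_add: "rational (v + w) = rational v + rational w"
  and rational_0: "rational 0 = 0" and rational_inj: "rational v = rational w \<longleftrightarrow> v = w"
  by (auto simp: poly_mapping_eq_iff lookup_rational lookup_minus lookup_add fun_eq_iff)

definition rat_group :: "('b \<Rightarrow>\<^sub>0 rat) monoid" where
  "rat_group = \<lparr>carrier = UNIV, monoid.mult = (+), one = 0\<rparr>"

lemma rat_group_comm_group: "comm_group rat_group"
proof (rule comm_groupI)
  fix x :: "'b \<Rightarrow>\<^sub>0 rat"
  show "\<exists>y\<in>carrier rat_group. y \<otimes>\<^bsub>rat_group\<^esub> x = \<one>\<^bsub>rat_group\<^esub>"
    by (rule bexI[of _ "- x"]) (simp_all add: rat_group_def)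
qed (simp_all add: rat_group_def add_ac)

lemma rat_group_inv: "inv\<^bsub>rat_group\<^esub> x = - x"
proof -
  interpret comm_group "rat_group :: ('b \<Rightarrow>\<^sub>0 rat) monoid" by (rule rat_group_comm_group)
  show ?thesis by (rule inv_equality) (simp_all add: rat_group_def)
qed

lemma rat_group_pow: "Poly_Mapping.lookup (x [^]\<^bsub>rat_group\<^esub> (k::nat)) b = of_nat k * Poly_Mapping.lookup x b"
proof (induction k)
  case (Suc k)
  have "x [^]\<^bsub>rat_group\<^esub> Suc k = x [^]\<^bsub>rat_group\<^esub> k + x" by (simp add: rat_group_def)
  then show ?case using Suc by (simp add: lookup_add algebra_simps)
qed (simp add: rat_group_def)

lemma divisible_embedding:
  fixes M :: "('a, 'b) module"
  assumes M: "module A M"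
  obtains D :: "('b \<Rightarrow>\<^sub>0 rat) set monoid" and j K where "divisible_group D" "j \<in> hom (add_monoid M) D"
    "inj_on j (carrier M)" "carrier D = (\<lambda>v. K #>\<^bsub>rat_group\<^esub> v) ` UNIV"
proof -
  interpret M: module A M by fact
  interpret V: comm_group "rat_group :: ('b \<Rightarrow>\<^sub>0 rat) monoid" by (rule rat_group_comm_group)
  have V: "carrier rat_group = UNIV" "v \<otimes>\<^bsub>rat_group\<^esub> w = v + w" "\<one>\<^bsub>rat_group\<^esub> = 0" for v w :: "'b \<Rightarrow>\<^sub>0 rat"
    by (simp_all add: rat_group_def)
  let ?F = "free_Abelian_group (carrier M)"
  obtain h where h: "h \<in> hom ?F (add_monoid M)" and h_of: "\<And>x. x \<in> carrier M \<Longrightarrow> h (frag_of x) = x"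
    using comm_group.free_Abelian_group_universal[OF M.a_comm_group, of "\<lambda>x. x" "carrier M"] by auto
  interpret h: group_hom ?F "add_monoid M" h
    using h by (simp add: group_hom_def group_hom_axioms_def M.a_group)
  have h_diff: "h (v - w) = h v \<ominus>\<^bsub>M\<^esub> h w" if "v \<in> carrier ?F" "w \<in> carrier ?F" for v w
  proof -
    have "h (v \<otimes>\<^bsub>?F\<^esub> inv\<^bsub>?F\<^esub> w) = h v \<otimes>\<^bsub>add_monoid M\<^esub> inv\<^bsub>add_monoid M\<^esub> h w"
      using that by (simp only: h.hom_mult h.hom_inv h.G.inv_closed)
    then show ?thesis using that by (simp add: a_inv_def a_minus_def)
  qed
  have h_cl: "h v \<in> carrier M" if "v \<in> carrier ?F" for v using h.hom_closed[OF that] by simp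
  have F_diff: "v - w \<in> carrier ?F" if "v \<in> carrier ?F" "w \<in> carrier ?F" for v w
    using that keys_diff[of v w] by auto
  \<comment> \<open>\<open>K\<close> is the group of integral relations of \<open>M\<close>, placed
    among rational combinations. Only the subgroup is taken, not the subspace it spans: then the
    integral vectors in \<open>K\<close> are exactly the relations, so \<open>M\<close> embeds in
    the quotient, which is divisible because rational vectors can be divided.\<close>
  define K where "K = {rational w | w. w \<in> carrier ?F \<and> h w = \<zero>\<^bsub>M\<^esub>}"
  have K0: "0 \<in> K" using h.hom_one rational_0 by (auto simp: K_def intro!: exI[of _ 0])
  have K_diff: "v - w \<in> K" if vw: "v \<in> K" "w \<in> K" for v w
  proof -
    obtain v' w' where "v' \<in> carrier ?F" "w' \<in> carrier ?F" "h v' = \<zero>\<^bsub>M\<^esub>" "h w' = \<zero>\<^bsub>M\<^esub>" "v = rational v'" "w = rational w'"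
      using vw unfolding K_def by blast
    then show ?thesis
      using F_diff[of v' w'] h_diff[of v' w'] unfolding K_def
      by (intro CollectI exI[of _ "v' - w'"]) (simp add: rational_diff M.minus_eq del: carrier_free_Abelian_group_iff)
  qed
  have K_neg: "- v \<in> K" if "v \<in> K" for v using K_diff[OF K0 that] by simp
  have K_add: "v + w \<in> K" if "v \<in> K" "w \<in> K" for v w using K_diff[OF that(1) K_neg[OF that(2)]] by simp
  have K: "subgroup K rat_group"
    by (rule subgroup.intro) (use K0 K_neg K_add in \<open>auto simp: V rat_group_inv\<close>)
  then interpret K: normal K rat_group by (simp add: V.normal_iff_subgroup)
  define D where "D = rat_group Mod K"
  have D: "comm_group D" unfolding D_def by (rule V.abelian_FactGroup[OF K])
  \<comment> \<open>This description is exported because it bounds the size of \<open>D\<close>: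
    every element has a representative among the finitely supported rational functions.\<close>
  have carr: "carrier D = (\<lambda>v. K #>\<^bsub>rat_group\<^esub> v) ` UNIV" by (simp add: D_def carrier_FactGroup V)
  have coset_eq: "K #>\<^bsub>rat_group\<^esub> v = K #>\<^bsub>rat_group\<^esub> w \<longleftrightarrow> v - w \<in> K" for v w :: "'b \<Rightarrow>\<^sub>0 rat"
  proof
    assume "K #>\<^bsub>rat_group\<^esub> v = K #>\<^bsub>rat_group\<^esub> w"
    moreover have "v \<in> K #>\<^bsub>rat_group\<^esub> v" using K0 by (auto simp: r_coset_def V intro!: bexI[of _ 0])
    ultimately obtain k where "k \<in> K" "v = k + w" by (auto simp: r_coset_def V)
    then show "v - w \<in> K" by simp
  next
    assume "v - w \<in> K"
    then have "v \<in> K #>\<^bsub>rat_group\<^esub> w" by (auto simp: r_coset_def V intro!: bexI[of _ "v - w"])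
    then show "K #>\<^bsub>rat_group\<^esub> v = K #>\<^bsub>rat_group\<^esub> w"
      using V.repr_independence[OF _ _ K] by (simp add: V)
  qed
  have "divisible_group D"
    unfolding divisible_group_def
  proof (intro conjI D ballI allI impI)
    fix y and k :: nat assume "y \<in> carrier D" and k: "k > 0"
    then obtain v where y: "y = K #>\<^bsub>rat_group\<^esub> v" by (auto simp: carr)
    define w where "w = Poly_Mapping.map (\<lambda>q. q / of_nat k) v"
    have "w [^]\<^bsub>rat_group\<^esub> k = v"
      using k by (auto simp: poly_mapping_eq_iff fun_eq_iff rat_group_pow w_def Poly_Mapping.map.rep_eq when_def)
    then have "(K #>\<^bsub>rat_group\<^esub> w) [^]\<^bsub>D\<^esub> k = y"
      using K.FactGroup_pow[of w k] by (simp add: D_def y V)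
    then show "\<exists>z\<in>carrier D. z [^]\<^bsub>D\<^esub> k = y" by (auto simp: carr)
  qed
  moreover define j where "j = (\<lambda>x. K #>\<^bsub>rat_group\<^esub> rational (frag_of x))"
  have "j \<in> hom (add_monoid M) D"
  proof (rule homI)
    fix x assume "x \<in> carrier (add_monoid M)"
    then show "j x \<in> carrier D" by (auto simp: j_def carr)
  next
    fix x y assume "x \<in> carrier (add_monoid M)" "y \<in> carrier (add_monoid M)"
    then have x: "x \<in> carrier M" and y: "y \<in> carrier M" by simp_all
    have F: "frag_of (x \<oplus>\<^bsub>M\<^esub> y) \<in> carrier ?F" "frag_of x \<in> carrier ?F" "frag_of y \<in> carrier ?F" using x y by simp_all
    have F1: "frag_of (x \<oplus>\<^bsub>M\<^esub> y) - frag_of x \<in> carrier ?F" by (rule F_diff[OF F(1,2)])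
    have F2: "frag_of (x \<oplus>\<^bsub>M\<^esub> y) - frag_of x - frag_of y \<in> carrier ?F" by (rule F_diff[OF F1 F(3)])
    have "h (frag_of (x \<oplus>\<^bsub>M\<^esub> y) - frag_of x - frag_of y) = \<zero>\<^bsub>M\<^esub>"
      unfolding h_diff[OF F1 F(3)] h_diff[OF F(1,2)] using x y h_of by (simp add: M.minus_cancel M.minus_eq_zero_iff)
    then have "rational (frag_of (x \<oplus>\<^bsub>M\<^esub> y)) - (rational (frag_of x) + rational (frag_of y)) \<in> K"
      using F2 unfolding K_def by (intro CollectI exI[of _ "frag_of (x \<oplus>\<^bsub>M\<^esub> y) - frag_of x - frag_of y"])
        (simp add: rational_diff del: carrier_free_Abelian_group_iff)
    then have "j (x \<oplus>\<^bsub>M\<^esub> y) = K #>\<^bsub>rat_group\<^esub> (rational (frag_of x) + rational (frag_of y))"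
      by (simp add: j_def coset_eq)
    also have "\<dots> = j x \<otimes>\<^bsub>D\<^esub> j y"
      using K.rcos_sum[of "rational (frag_of x)" "rational (frag_of y)"] by (simp add: j_def D_def V)
    finally show "j (x \<otimes>\<^bsub>add_monoid M\<^esub> y) = j x \<otimes>\<^bsub>D\<^esub> j y" by simp
  qed
  moreover have "inj_on j (carrier M)"
  proof (rule inj_onI)
    fix x y assume xy: "x \<in> carrier M" "y \<in> carrier M" "j x = j y"
    then have "rational (frag_of x - frag_of y) \<in> K" by (simp add: j_def coset_eq rational_diff)
    then have "h (frag_of x - frag_of y) = \<zero>\<^bsub>M\<^esub>" unfolding K_def by (auto simp: rational_inj)
    then show "x = y" using xy h_diff[of "frag_of x" "frag_of y"] h_of by (simp add: M.minus_eq_zero_iff)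
  qed
  ultimately show ?thesis using that carr by blast
qed

text \<open>A finitely supported function amounts to a finite set of pairs, and passing to a product
  with the rationals and then to finite subsets does not enlarge an infinite set.\<close>

lemma poly_mapping_rat_lepoll:
  assumes inf: "infinite (UNIV :: 'u set)"
  shows "(UNIV :: ('u \<Rightarrow>\<^sub>0 rat) set) \<lesssim> (UNIV :: 'u set)"
proof -
  have "(UNIV :: ('u \<Rightarrow>\<^sub>0 rat) set) \<lesssim> {f::'u\<Rightarrow>rat. f ` UNIV \<subseteq> UNIV \<and> {x. f x \<noteq> 0} \<subseteq> UNIV \<and> finite {x. f x \<noteq> 0}}"
    unfolding lepoll_def
    by (rule exI[of _ Poly_Mapping.lookup]) (auto simp: poly_mapping_eqI inj_onI)
  also have "\<dots> \<lesssim> Fpow ((UNIV :: 'u set) \<times> (UNIV::rat set))"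
    by (rule lepoll_restricted_funspace)
  also have "\<dots> \<approx> (UNIV :: 'u set) \<times> (UNIV::rat set)"
  proof (rule eqpoll_Fpow, rule notI)
    assume "finite ((UNIV :: 'u set) \<times> (UNIV::rat set))"
    then have "finite (UNIV :: 'u set)" by (rule finite_cartesian_productD1) simp
    with inf show False ..
  qed
  also have "\<dots> \<lesssim> (UNIV :: 'u set)"
  proof -
    have "|UNIV :: rat set| \<le>o |UNIV :: 'u set|"
      by (rule infinite_iff_card_of_countable[THEN iffD1, OF _ _ inf]) (simp_all add: infinite_UNIV_char_0)
    then have "|(UNIV :: 'u set) \<times> (UNIV :: rat set)| \<le>o |UNIV :: 'u set|"
      by (rule card_of_Times_ordLeq_infinite[OF inf card_of_mono1[OF subset_refl]])
    then show ?thesis unfolding lepoll_def card_of_ordLeq .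
  qed
  finally show ?thesis .
qed

text \<open>Elements of a coinduced module are functions on \<open>'a\<close>; this is where the
  injection of \<open>'a \<Rightarrow> 'u\<close> into \<open>'u\<close> enters. The copy in
  \<open>'u\<close> inherits the extension property, and \<open>M\<close> embeds by
  \<open>x -> (a -> j (a x))\<close>, whose value at \<open>1\<close> recovers
  \<open>j x\<close>.\<close>

theorem enough_injectives:
  fixes A :: "'a ring"
  assumes A: "cring A" and inf: "infinite (UNIV :: 'u set)" and le: "(UNIV :: ('a \<Rightarrow> 'u) set) \<lesssim> (UNIV :: 'u set)"
  shows "enough_injectives A TYPE('u)"
  unfolding enough_injectives_def
proof (intro allI impI)
  fix M :: "('a, 'u) module" assume M: "module A M"
  interpret M: module A M by fact
  obtain D :: "('u \<Rightarrow>\<^sub>0 rat) set monoid" and j K where D: "divisible_group D" and j: "j \<in> hom (add_monoid M) D"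
    "inj_on j (carrier M)" and carr: "carrier D = (\<lambda>v. K #>\<^bsub>rat_group\<^esub> v) ` UNIV"
    using divisible_embedding[OF M] by blast
  have D': "comm_group D" using D by (simp add: divisible_group_def)
  let ?E = "coinduced A D"
  have E: "module A ?E" by (rule coinduced_module[OF A D'])
  obtain c1 :: "('u \<Rightarrow>\<^sub>0 rat) \<Rightarrow> 'u" where c1: "inj c1"
    using poly_mapping_rat_lepoll[OF inf] by (auto simp: lepoll_def)
  obtain c2 :: "('a \<Rightarrow> 'u) \<Rightarrow> 'u" where c2: "inj c2" using le by (auto simp: lepoll_def)
  define s where "s y = (SOME v. K #>\<^bsub>rat_group\<^esub> v = y)" for y
  have s: "K #>\<^bsub>rat_group\<^esub> s y = y" if "y \<in> carrier D" for y
    unfolding s_def by (rule someI_ex) (use that carr in auto)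
  \<comment> \<open>Each value in \<open>D\<close> is replaced by a rational representative, coded
    in \<open>'u\<close> by \<open>c1\<close>; the resulting function from \<open>'a\<close> to
    \<open>'u\<close> is coded by \<open>c2\<close>.\<close>
  define e where "e f = c2 (\<lambda>a\<in>carrier A. c1 (s (f a)))" for f
  have inj: "inj_on e (carrier ?E)"
  proof (rule inj_onI)
    fix f g assume f: "f \<in> carrier ?E" and g: "g \<in> carrier ?E" and "e f = e g"
    then have eq: "(\<lambda>a\<in>carrier A. c1 (s (f a))) = (\<lambda>a\<in>carrier A. c1 (s (g a)))"
      using injD[OF c2] by (auto simp: e_def)
    show "f = g"
    proof (rule extensionalityI[of _ "carrier A"])
      fix a assume a: "a \<in> carrier A"
      have "c1 (s (f a)) = c1 (s (g a))" using fun_cong[OF eq, of a] a by simp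
      then have "s (f a) = s (g a)" by (rule injD[OF c1])
      then have "K #>\<^bsub>rat_group\<^esub> s (f a) = K #>\<^bsub>rat_group\<^esub> s (g a)" by (rule arg_cong)
      moreover have "f a \<in> carrier D" "g a \<in> carrier D" using f g a by (simp_all add: coinduced_carrier)
      ultimately show "f a = g a" by (simp only: s)
    qed (use f g in \<open>simp_all add: coinduced_carrier\<close>)
  qed
  define t where "t = restrict e (carrier ?E)"
  obtain N :: "('a, 'u) module" where N: "module A N" and t: "t \<in> mod_hom A ?E N" "bij_betw t (carrier ?E) (carrier N)"
    unfolding t_def by (rule module_transport[OF E inj])
  obtain t' where t': "t' \<in> mod_hom A N ?E" "\<And>x. x \<in> carrier ?E \<Longrightarrow> t' (t x) = x" "\<And>y. y \<in> carrier N \<Longrightarrow> t (t' y) = y"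
    using mod_iso_inverse[OF E N t] by metis
  have "injective_module A N"
    unfolding injective_module_def
  proof (intro conjI N allI impI)
    fix P Q :: "('a, 'u) module" and i f
    assume "module A P \<and> module A Q \<and> i \<in> mod_hom A P Q \<and> inj_on i (carrier P) \<and> f \<in> mod_hom A P N"
    then have P: "module A P" and Q: "module A Q" and i: "i \<in> mod_hom A P Q" "inj_on i (carrier P)" and f: "f \<in> mod_hom A P N"
      by simp_all
    obtain g where g: "g \<in> mod_hom A Q ?E" "\<And>x. x \<in> carrier P \<Longrightarrow> g (i x) = (\<lambda>x\<in>carrier P. t' (f x)) x"
      using coinduced_extend[OF P Q D i mod_hom_comp[OF P f t'(1)]] by blast
    show "\<exists>g\<in>mod_hom A Q N. \<forall>x\<in>carrier P. g (i x) = f x"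
      by (rule bexI[OF _ mod_hom_comp[OF Q g(1) t(1)]])
        (simp add: g(2) mod_hom_closed[OF i(1)] mod_hom_closed[OF f] t'(3))
  qed
  moreover define \<epsilon>0 where "\<epsilon>0 = (\<lambda>x\<in>carrier M. \<lambda>a\<in>carrier A. j (a \<odot>\<^bsub>M\<^esub> x))"
  have \<epsilon>0: "\<epsilon>0 \<in> mod_hom A M ?E" unfolding \<epsilon>0_def by (rule coinduced_hom[OF M D' j(1)])
  have "(\<lambda>x\<in>carrier M. t (\<epsilon>0 x)) \<in> mod_hom A M N" by (rule mod_hom_comp[OF M \<epsilon>0 t(1)])
  moreover have "inj_on (\<lambda>x\<in>carrier M. t (\<epsilon>0 x)) (carrier M)"
  proof (rule inj_onI)
    fix x y assume xy: "x \<in> carrier M" "y \<in> carrier M" "(\<lambda>x\<in>carrier M. t (\<epsilon>0 x)) x = (\<lambda>x\<in>carrier M. t (\<epsilon>0 x)) y"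
    then have "t (\<epsilon>0 x) = t (\<epsilon>0 y)" by simp
    then have "\<epsilon>0 x = \<epsilon>0 y"
      using inj_onD[OF bij_betw_imp_inj_on[OF t(2)]] mod_hom_closed[OF \<epsilon>0] xy by blast
    from fun_cong[OF this, of "\<one>\<^bsub>A\<^esub>"] have "j x = j y" using xy by (simp add: \<epsilon>0_def)
    then show "x = y" using inj_onD[OF j(2)] xy by blast
  qed
  ultimately show "\<exists>(E :: ('a, 'u) module) \<epsilon>. injective_module A E \<and> \<epsilon> \<in> mod_hom A M E \<and> inj_on \<epsilon> (carrier M)"
    by blast
qed

section \<open>Long exact sequences of derived functors\<close>

context additive_functor
begin

text \<open>The cone gives \<open>0 -> J[-1] -> Z -> I -> 0\<close> with \<open>Z\<close> a
  resolution of \<open>P\<close>. Its long exact sequence is a rotation of the wanted one: the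
  connecting map of complexes becomes \<open>b\<close>, and the inclusion of \<open>J[-1]\<close>
  becomes \<open>c\<close>. The terms may be arbitrary copies of unrelated types, since Ext is used
  as it stands and local cohomology through copies in \<open>'u\<close>.\<close>

theorem derived_long_exact_sequence:
  fixes P Q T :: "('a, 'u) module"
    and HP :: "nat \<Rightarrow> ('a, 'p) module" and HQ :: "nat \<Rightarrow> ('a, 'q) module" and HT :: "nat \<Rightarrow> ('a, 't) module"
  assumes inf: "infinite (UNIV :: 'u set)" and enough: "enough_injectives A TYPE('u)"
    and ses: "short_exact A P Q T f g"
    and HP: "\<And>n. module A (HP n)" "\<And>n. mod_iso A (right_derived A F \<Phi> n P) (HP n)"
    and HQ: "\<And>n. module A (HQ n)" "\<And>n. mod_iso A (right_derived A F \<Phi> n Q) (HQ n)"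
    and HT: "\<And>n. module A (HT n)" "\<And>n. mod_iso A (right_derived A F \<Phi> n T) (HT n)"
  obtains a b c where "\<And>n. a n \<in> mod_hom A (HP n) (HQ n)" "\<And>n. b n \<in> mod_hom A (HQ n) (HT n)"
    "\<And>n. c n \<in> mod_hom A (HT n) (HP (Suc n))"
    "\<And>n. a n ` carrier (HP n) = a_kernel (HQ n) (HT n) (b n)"
    "\<And>n. b n ` carrier (HQ n) = a_kernel (HT n) (HP (Suc n)) (c n)"
    "\<And>n. c n ` carrier (HT n) = a_kernel (HP (Suc n)) (HQ (Suc n)) (a (Suc n))"
    "a_kernel (HP 0) (HQ 0) (a 0) = {\<zero>\<^bsub>HP 0\<^esub>}"
proof -
  have P: "module A P" and Q: "module A Q" and T: "module A T"
    using ses by (auto simp: short_exact_def)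
  obtain I dI \<epsilon> where I: "injective_resolution A Q I dI \<epsilon>"
    by (rule injective_resolution_exists[OF enough Q])
  obtain J dJ \<eta> where J: "injective_resolution A T J dJ \<eta>"
    by (rule injective_resolution_exists[OF enough T])
  note I' = injective_resolutionD[OF I] and J' = injective_resolutionD[OF J]
  define W where "W = (\<lambda>n. case n of 0 \<Rightarrow> (J 0)\<lparr>carrier := {\<zero>\<^bsub>J 0\<^esub>}\<rparr> | Suc m \<Rightarrow> J m)"
  define dW where "dW = (\<lambda>n. case n of 0 \<Rightarrow> (\<lambda>x\<in>{\<zero>\<^bsub>J 0\<^esub>}. \<zero>\<^bsub>J 0\<^esub>) | Suc m \<Rightarrow> dJ m)"
  obtain Z dZ \<epsilon>' i p q j where S: "split_ses A W dW Z dZ I dI i p q j"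
    and Z: "injective_resolution A P Z dZ \<epsilon>'"
    by (rule cone_resolution[OF inf ses I J, folded W_def dW_def])
  have W_complex: "is_complex A W dW" by (rule split_ses.W[OF S])
  note W = is_complexD[OF W_complex] and FW = is_complexD[OF F_complex[OF W_complex]]
  interpret FW: module A "F (W k)" for k by (rule F_module[OF W(1)])
  interpret HT: module A "HT k" for k by (rule HT)
  have W0: "carrier (W 0) = {\<zero>\<^bsub>W 0\<^esub>}" by (simp add: W_def)
  have dW0: "dW 0 x = \<zero>\<^bsub>W (Suc 0)\<^esub>" if "x \<in> carrier (W 0)" for x
    using that by (simp add: W_def dW_def)
  have WS: "W (Suc n) = J n" "dW (Suc n) = dJ n" for n by (simp_all add: W_def dW_def)
  \<comment> \<open>The identity of a zero module is a zero map, so an additive functor sends the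
    module to a zero module.\<close>
  have FW0: "z = \<zero>\<^bsub>F (W 0)\<^esub>" if "z \<in> carrier (F (W 0))" for z
  proof -
    have "z = \<Phi> (W 0) (W 0) (\<lambda>x\<in>carrier (W 0). x) z" by (rule F_id'[OF W(1) that, symmetric])
    also have "\<dots> = \<zero>\<^bsub>F (W 0)\<^esub>"
      by (rule F_null[OF W(1) W(1) mod_hom_id[OF W(1)] _ that]) (use W0 in simp)
    finally show ?thesis .
  qed
  then have FW0': "carrier (F (W 0)) = {\<zero>\<^bsub>F (W 0)\<^esub>}" by auto
  have cocyc: "cocyc (FO W) (FD W dW) (Suc n) = cocyc (FO J) (FD J dJ) n" for n
    by (simp add: cocyc_def WS)
  \<comment> \<open>In degree \<open>0\<close> the coboundaries of \<open>J\<close> are zero by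
    convention, whereas in degree \<open>1\<close> of the shifted complex they are the image of a
    zero module: the same set.\<close>
  have cobound: "cobound (FO W) (FD W dW) (Suc n) = cobound (FO J) (FD J dJ) n" for n
  proof (cases n)
    case 0
    have "\<Phi> (W 0) (W (Suc 0)) (dW 0) z = \<zero>\<^bsub>F (W (Suc 0))\<^esub>" if "z \<in> carrier (F (W 0))" for z
      by (rule F_null[OF W(1) W(1) W(2) dW0 that])
    then show ?thesis using 0 FW0' by (simp add: WS)
  next
    case (Suc m)
    then show ?thesis by (simp add: WS)
  qed
  have "\<exists>\<pi>. coh_rep A (FO Z) (FD Z dZ) n (HP n) \<pi>" for n
    using right_derived_coh_rep[OF P Z] coh_rep_iso[OF _ F_complex[OF injective_resolutionD(8)[OF Z]] HP] by blast
  then obtain \<pi>Z where \<pi>Z: "\<And>n. coh_rep A (FO Z) (FD Z dZ) n (HP n) (\<pi>Z n)" by metis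
  have "\<exists>\<pi>. coh_rep A (FO I) (FD I dI) n (HQ n) \<pi>" for n
    using right_derived_coh_rep[OF Q I] coh_rep_iso[OF _ F_complex[OF injective_resolutionD(8)[OF I]] HQ] by blast
  then obtain \<pi>X where \<pi>X: "\<And>n. coh_rep A (FO I) (FD I dI) n (HQ n) (\<pi>X n)" by metis
  have "\<exists>\<pi>. coh_rep A (FO J) (FD J dJ) n (HT n) \<pi>" for n
    using right_derived_coh_rep[OF T J] coh_rep_iso[OF _ F_complex[OF injective_resolutionD(8)[OF J]] HT] by blast
  then obtain \<pi>J where \<pi>J: "\<And>n. coh_rep A (FO J) (FD J dJ) n (HT n) (\<pi>J n)" by metis
  define HW where "HW = (\<lambda>n. case n of 0 \<Rightarrow> (HT 0)\<lparr>carrier := {\<zero>\<^bsub>HT 0\<^esub>}\<rparr> | Suc m \<Rightarrow> HT m)"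
  have HW0: "module A (HW 0)" "carrier (HW 0) = {\<zero>\<^bsub>HW 0\<^esub>}"
    using submodule.submodule_is_module[OF submodule_zero[OF HT(1)] HT(1)] by (simp_all add: HW_def)
  have "\<exists>\<pi>. coh_rep A (FO W) (FD W dW) n (HW n) \<pi>" for n
  proof (cases n)
    case 0
    have z0: "\<zero>\<^bsub>F (W 0)\<^esub> \<in> cocyc (FO W) (FD W dW) 0"
      by (rule submoduleD(2)[OF _ cocyc_submodule[OF F_complex[OF W_complex]]]) (rule FW)
    have cz: "cocyc (FO W) (FD W dW) 0 = {\<zero>\<^bsub>F (W 0)\<^esub>}"
      using FW0 z0 by (auto simp: cocyc_iff)
    have "coh_rep A (FO W) (FD W dW) 0 (HW 0) (\<lambda>x\<in>carrier (cocyc_module (FO W) (FD W dW) 0). \<zero>\<^bsub>HW 0\<^esub>)"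
      unfolding coh_rep_def
      using mod_hom_null[OF cocyc_module[OF F_complex[OF W_complex]] HW0(1), of 0] HW0
      by (simp add: cz)
    then show ?thesis unfolding 0 by (intro exI)
  next
    case (Suc m)
    have "coh_rep A (FO W) (FD W dW) (Suc m) (HT m) (\<pi>J m)"
      using \<pi>J[of m] unfolding coh_rep_def cocyc cobound by (simp add: WS)
    then show ?thesis unfolding Suc by (intro exI) (simp add: HW_def)
  qed
  then obtain \<pi>W where \<pi>W: "\<And>n. coh_rep A (FO W) (FD W dW) n (HW n) (\<pi>W n)" by metis
  obtain f' g' h' where L: "\<And>n. f' n \<in> mod_hom A (HW n) (HP n)" "\<And>n. g' n \<in> mod_hom A (HP n) (HQ n)"
    "\<And>n. h' n \<in> mod_hom A (HQ n) (HW (Suc n))"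
    "\<And>n. f' n ` carrier (HW n) = a_kernel (HP n) (HQ n) (g' n)"
    "\<And>n. g' n ` carrier (HP n) = a_kernel (HQ n) (HW (Suc n)) (h' n)"
    "\<And>n. h' n ` carrier (HQ n) = a_kernel (HW (Suc n)) (HP (Suc n)) (f' (Suc n))"
    by (rule split_ses.long_exact_sequence[OF F_split_ses[OF S] \<pi>W \<pi>Z \<pi>X]) (rule that, assumption+)
  have HWS: "HW (Suc n) = HT n" for n by (simp add: HW_def)
  show ?thesis
  proof (rule that[of g' h' "\<lambda>n. f' (Suc n)"])
    \<comment> \<open>This is exactness at \<open>HP 0\<close>, where the incoming map starts at the
      zero module \<open>HW 0\<close>.\<close>
    show "a_kernel (HP 0) (HQ 0) (g' 0) = {\<zero>\<^bsub>HP 0\<^esub>}"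
      unfolding L(4)[symmetric] HW0(2) using mod_hom_zero[OF HW0(1) HP(1) L(1)] by simp
  qed (use L(2) L(3,5,6)[unfolded HWS] L(1)[of "Suc _"] L(4)[of "Suc _"] in \<open>simp_all add: HWS\<close>)
qed

lemma right_derived_module:
  fixes M :: "('a, 'u) module"
  assumes "enough_injectives A TYPE('u)" "module A M"
  shows "module A (right_derived A F \<Phi> n M)"
proof -
  obtain I d \<epsilon> where "injective_resolution A M I d \<epsilon>"
    by (rule injective_resolution_exists[OF assms])
  then show ?thesis
    using right_derived_coh_rep[OF assms(2)] coh_repD(1) by blast
qed

text \<open>A derived functor is a quotient of a submodule of some \<open>F (I n)\<close>, so it
  fits into the element type of the values of \<open>F\<close>. For torsion that type is the
  universe again.\<close>

lemma right_derived_copy: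
  fixes M :: "('a, 'u) module"
  assumes "enough_injectives A TYPE('u)" "module A M"
  shows "\<exists>H :: ('a, 'v) module. module A H \<and> mod_iso A (right_derived A F \<Phi> n M) H"
proof -
  obtain I d \<epsilon> where I: "injective_resolution A M I d \<epsilon>"
    by (rule injective_resolution_exists[OF assms])
  then obtain \<pi> where \<pi>: "coh_rep A (FO I) (FD I d) n (right_derived A F \<Phi> n M) \<pi>"
    using right_derived_coh_rep[OF assms(2)] by blast
  note Z = cocyc_module[OF F_complex[OF injective_resolutionD(8)[OF I]], of n]
  have "\<pi> ` carrier (cocyc_module (FO I) (FD I d) n) = carrier (right_derived A F \<Phi> n M)"
    using coh_repD(3)[OF \<pi>] by simp
  from module_copy[OF Z coh_repD(1)[OF \<pi>] this] show ?thesis by blast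
qed

lemma right_derived_retract:
  fixes M N :: "('a, 'u) module" and H :: "('a, 'x) module" and H' :: "('a, 'y) module"
  assumes enough: "enough_injectives A TYPE('u)" and M: "module A M" and N: "module A N"
    and f: "f \<in> mod_hom A M N" and g: "g \<in> mod_hom A N M" and gf: "\<And>x. x \<in> carrier M \<Longrightarrow> g (f x) = x"
    and H: "module A H" "mod_iso A (right_derived A F \<Phi> n M) H"
    and H': "module A H'" "mod_iso A (right_derived A F \<Phi> n N) H'"
  obtains a b where "a \<in> mod_hom A H H'" "b \<in> mod_hom A H' H" "\<And>y. y \<in> carrier H \<Longrightarrow> b (a y) = y"
proof -
  obtain I dI \<epsilon> where I: "injective_resolution A M I dI \<epsilon>"
    by (rule injective_resolution_exists[OF enough M])
  obtain J dJ \<eta> where J: "injective_resolution A N J dJ \<eta>"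
    by (rule injective_resolution_exists[OF enough N])
  obtain \<pi> where \<pi>: "coh_rep A (FO I) (FD I dI) n H \<pi>"
    using right_derived_coh_rep[OF M I] coh_rep_iso[OF _ F_complex[OF injective_resolutionD(8)[OF I]] H] by blast
  obtain \<pi>' where \<pi>': "coh_rep A (FO J) (FD J dJ) n H' \<pi>'"
    using right_derived_coh_rep[OF N J] coh_rep_iso[OF _ F_complex[OF injective_resolutionD(8)[OF J]] H'] by blast
  show ?thesis
    by (rule retract_cohomology[OF M N I J f g gf \<pi> \<pi>']) (use that in blast)+
qed

end

section \<open>The torsion functor and the functors Hom(N, -)\<close>

lemma torsion_submodule:
  assumes \<aa>: "ideal \<aa> A" and M: "module A M"
  shows "submodule (carrier (torsion A \<aa> M)) A M"
proof -
  interpret M: module A M by fact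
  interpret IS: comm_monoid "ideals_set A" by (rule M.R.ideals_set_is_comm_monoid)
  have \<aa>c: "\<aa> \<in> carrier (ideals_set A)" using \<aa> by (simp add: ideals_set_def)
  have pow: "ideal (\<aa> [^]\<^bsub>ideals_set A\<^esub> (n::nat)) A" for n
    using IS.nat_pow_closed[OF \<aa>c, of n] by (simp add: ideals_set_def)
  have powc: "r \<in> carrier A" if "r \<in> \<aa> [^]\<^bsub>ideals_set A\<^esub> (n::nat)" for r n
    using ideal.Icarr[OF pow that] .
  \<comment> \<open>Two elements may be killed by different powers of the ideal; the power with
    exponent \<open>n + m\<close> is contained in both and kills their sum.\<close>
  have sub: "\<aa> [^]\<^bsub>ideals_set A\<^esub> (n + m) \<subseteq> \<aa> [^]\<^bsub>ideals_set A\<^esub> n \<inter> \<aa> [^]\<^bsub>ideals_set A\<^esub> m" for n m :: nat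
    unfolding IS.nat_pow_mult[OF \<aa>c, symmetric]
    using M.R.ideal_prod_inter[OF pow pow] by (simp add: ideals_set_def)
  show ?thesis
  proof (rule submoduleI'[OF M])
    show "\<zero>\<^bsub>M\<^esub> \<in> carrier (torsion A \<aa> M)"
      using powc by (auto simp: torsion_def)
  next
    fix x y assume "x \<in> carrier (torsion A \<aa> M)" "y \<in> carrier (torsion A \<aa> M)"
    then obtain n m :: nat where xy: "x \<in> carrier M" "y \<in> carrier M"
      and n: "\<forall>r\<in>\<aa> [^]\<^bsub>ideals_set A\<^esub> n. r \<odot>\<^bsub>M\<^esub> x = \<zero>\<^bsub>M\<^esub>" and m: "\<forall>r\<in>\<aa> [^]\<^bsub>ideals_set A\<^esub> m. r \<odot>\<^bsub>M\<^esub> y = \<zero>\<^bsub>M\<^esub>"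
      by (auto simp: torsion_def)
    have "r \<odot>\<^bsub>M\<^esub> (x \<oplus>\<^bsub>M\<^esub> y) = \<zero>\<^bsub>M\<^esub>" if r: "r \<in> \<aa> [^]\<^bsub>ideals_set A\<^esub> (n + m)" for r
      using n m xy powc[OF r] subsetD[OF sub r] by (simp add: M.smult_r_distr)
    then show "x \<oplus>\<^bsub>M\<^esub> y \<in> carrier (torsion A \<aa> M)"
      using xy by (auto simp: torsion_def)
  next
    fix s x assume s: "s \<in> carrier A" and "x \<in> carrier (torsion A \<aa> M)"
    then obtain n :: nat where x: "x \<in> carrier M" and n: "\<forall>r\<in>\<aa> [^]\<^bsub>ideals_set A\<^esub> n. r \<odot>\<^bsub>M\<^esub> x = \<zero>\<^bsub>M\<^esub>"
      by (auto simp: torsion_def)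
    have "r \<odot>\<^bsub>M\<^esub> (s \<odot>\<^bsub>M\<^esub> x) = \<zero>\<^bsub>M\<^esub>" if r: "r \<in> \<aa> [^]\<^bsub>ideals_set A\<^esub> n" for r
    proof -
      have "r \<odot>\<^bsub>M\<^esub> (s \<odot>\<^bsub>M\<^esub> x) = s \<odot>\<^bsub>M\<^esub> (r \<odot>\<^bsub>M\<^esub> x)"
        using s x powc[OF r] by (simp add: M.smult_assoc1[symmetric] M.R.m_comm)
      then show ?thesis using n r s by simp
    qed
    then show "s \<odot>\<^bsub>M\<^esub> x \<in> carrier (torsion A \<aa> M)"
      using x s by (auto simp: torsion_def)
  qed (auto simp: torsion_def)
qed

lemma torsion_map:
  assumes "ideal \<aa> A" "module A M" "module A N" "f \<in> mod_hom A M N" "x \<in> carrier (torsion A \<aa> M)"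
  shows "f x \<in> carrier (torsion A \<aa> N)"
proof -
  interpret M: module A M by fact
  interpret IS: comm_monoid "ideals_set A" by (rule M.R.ideals_set_is_comm_monoid)
  have "\<aa> \<in> carrier (ideals_set A)" using assms(1) by (simp add: ideals_set_def)
  then have pow: "ideal (\<aa> [^]\<^bsub>ideals_set A\<^esub> (n::nat)) A" for n
    using IS.nat_pow_closed[of \<aa> n] by (simp add: ideals_set_def)
  obtain n :: nat where x: "x \<in> carrier M" and n: "\<And>r. r \<in> \<aa> [^]\<^bsub>ideals_set A\<^esub> n \<Longrightarrow> r \<odot>\<^bsub>M\<^esub> x = \<zero>\<^bsub>M\<^esub>"
    using assms(5) by (auto simp: torsion_def)
  have "r \<odot>\<^bsub>N\<^esub> f x = \<zero>\<^bsub>N\<^esub>" if r: "r \<in> \<aa> [^]\<^bsub>ideals_set A\<^esub> n" for r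
    using mod_hom_smult[OF assms(4) ideal.Icarr[OF pow r] x] n[OF r] mod_hom_zero[OF assms(2-4)] by simp
  then show ?thesis
    using mod_hom_closed[OF assms(4) x] by (auto simp: torsion_def)
qed

lemma torsion_functor:
  fixes \<aa> :: "'a set"
  assumes \<aa>: "ideal \<aa> A"
  shows "additive_functor A (torsion A \<aa> :: ('a, 'u) module \<Rightarrow> ('a, 'u) module)
    (\<lambda>E E' h. restrict h (carrier (torsion A \<aa> E)))"
proof (rule additive_functor.intro)
  fix M N K :: "('a, 'u) module" and f g :: "'u \<Rightarrow> 'u" and z :: 'u
  have eq: "torsion A \<aa> M = M\<lparr>carrier := carrier (torsion A \<aa> M)\<rparr>" for M :: "('a, 'u) module"
    by (simp add: torsion_def)
  have add: "add (torsion A \<aa> M) = add M" for M :: "('a, 'u) module" by (simp add: torsion_def)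
  have sub: "carrier (torsion A \<aa> M) \<subseteq> carrier M" for M :: "('a, 'u) module" by (auto simp: torsion_def)
  show "module A (torsion A \<aa> M)" if "module A M"
    by (subst eq) (rule submodule.submodule_is_module[OF torsion_submodule[OF \<aa> that] that])
  show "restrict f (carrier (torsion A \<aa> M)) \<in> mod_hom A (torsion A \<aa> M) (torsion A \<aa> N)"
    if "module A M" "module A N" "f \<in> mod_hom A M N"
    by (subst (2) eq, subst (3) eq, rule mod_hom_submodule)
      (use that sub torsion_map[OF \<aa> that] torsion_submodule[OF \<aa>] in auto)
  show "restrict (\<lambda>x\<in>carrier M. x) (carrier (torsion A \<aa> M)) z = z" if "z \<in> carrier (torsion A \<aa> M)"
    using that sub by auto
  show "restrict (\<lambda>x\<in>carrier M. g (f x)) (carrier (torsion A \<aa> M)) z =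
     restrict g (carrier (torsion A \<aa> N)) (restrict f (carrier (torsion A \<aa> M)) z)"
    if "module A M" "module A N" "f \<in> mod_hom A M N" "z \<in> carrier (torsion A \<aa> M)"
    using that sub torsion_map[OF \<aa> that] by auto
  show "restrict (\<lambda>x\<in>carrier M. f x \<oplus>\<^bsub>N\<^esub> g x) (carrier (torsion A \<aa> M)) z =
      restrict f (carrier (torsion A \<aa> M)) z \<oplus>\<^bsub>torsion A \<aa> N\<^esub> restrict g (carrier (torsion A \<aa> M)) z"
    if "z \<in> carrier (torsion A \<aa> M)"
    using that sub by (auto simp: add)
qed

lemma hom_module_module:
  assumes N: "module A N" and M: "module A M"
  shows "module A (hom_module A N M)"
proof -
  interpret N: module A N by fact
  interpret M: module A M by fact
  have smult: "(\<lambda>x\<in>carrier N. r \<odot>\<^bsub>M\<^esub> f x) \<in> mod_hom A N M" if r: "r \<in> carrier A" and f: "f \<in> mod_hom A N M" for r f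
  proof (rule restrict_mod_homI[OF N])
    fix s x assume s: "s \<in> carrier A" and x: "x \<in> carrier N"
    show "r \<odot>\<^bsub>M\<^esub> f (s \<odot>\<^bsub>N\<^esub> x) = s \<odot>\<^bsub>M\<^esub> (r \<odot>\<^bsub>M\<^esub> f x)"
      using r s x by (simp add: mod_hom_smult[OF f] mod_hom_closed[OF f] M.smult_assoc1[symmetric] N.R.m_comm)
  qed (use r in \<open>simp_all add: mod_hom_closed[OF f] mod_hom_add[OF f] M.smult_r_distr\<close>)
  have ext: "f \<in> extensional (carrier N)" and cl: "x \<in> carrier N \<Longrightarrow> f x \<in> carrier M" if "f \<in> mod_hom A N M" for f x
    using that by (auto simp: mod_hom_def PiE_def)
  have eqI: "f = g" if "f \<in> extensional (carrier N)" "g \<in> extensional (carrier N)" "\<And>x. x \<in> carrier N \<Longrightarrow> f x = g x" for f g :: "'b \<Rightarrow> 'c"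
    using that by (rule extensionalityI)
  show ?thesis
  proof (rule moduleI)
    show "cring A" by (rule N.R.is_cring)
    show "abelian_group (hom_module A N M)"
    proof (rule abelian_groupI)
      fix f assume f: "f \<in> carrier (hom_module A N M)"
      then have f': "f \<in> mod_hom A N M" by (simp add: hom_module_def)
      show "\<exists>g\<in>carrier (hom_module A N M). g \<oplus>\<^bsub>hom_module A N M\<^esub> f = \<zero>\<^bsub>hom_module A N M\<^esub>"
        by (rule bexI[of _ "\<lambda>x\<in>carrier N. (\<ominus>\<^bsub>A\<^esub> \<one>\<^bsub>A\<^esub>) \<odot>\<^bsub>M\<^esub> f x"])
          (use smult[OF _ f', of "\<ominus>\<^bsub>A\<^esub> \<one>\<^bsub>A\<^esub>"] cl[OF f'] in
            \<open>auto simp: hom_module_def M.smult_l_minus M.l_neg intro!: restrict_ext\<close>)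
      show "\<zero>\<^bsub>hom_module A N M\<^esub> \<oplus>\<^bsub>hom_module A N M\<^esub> f = f"
        by (rule eqI) (use cl[OF f'] ext[OF f'] in \<open>auto simp: hom_module_def\<close>)
    next
      fix f g h assume "f \<in> carrier (hom_module A N M)" "g \<in> carrier (hom_module A N M)" "h \<in> carrier (hom_module A N M)"
      then show "f \<oplus>\<^bsub>hom_module A N M\<^esub> g \<oplus>\<^bsub>hom_module A N M\<^esub> h = f \<oplus>\<^bsub>hom_module A N M\<^esub> (g \<oplus>\<^bsub>hom_module A N M\<^esub> h)"
        by (auto simp: hom_module_def cl M.a_assoc intro!: restrict_ext)
    next
      fix f g assume "f \<in> carrier (hom_module A N M)" "g \<in> carrier (hom_module A N M)"
      then show "f \<oplus>\<^bsub>hom_module A N M\<^esub> g \<in> carrier (hom_module A N M)"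
         "f \<oplus>\<^bsub>hom_module A N M\<^esub> g = g \<oplus>\<^bsub>hom_module A N M\<^esub> f"
        by (auto simp: hom_module_def cl M.a_comm mod_hom_sum[OF N M] intro!: restrict_ext)
    qed (simp add: hom_module_def mod_hom_null[OF N M])
  next
    fix r f assume "r \<in> carrier A" "f \<in> carrier (hom_module A N M)"
    then show "r \<odot>\<^bsub>hom_module A N M\<^esub> f \<in> carrier (hom_module A N M)"
      by (simp add: hom_module_def smult)
  next
    fix r s f assume "r \<in> carrier A" "s \<in> carrier A" "f \<in> carrier (hom_module A N M)"
    then show "(r \<oplus>\<^bsub>A\<^esub> s) \<odot>\<^bsub>hom_module A N M\<^esub> f = r \<odot>\<^bsub>hom_module A N M\<^esub> f \<oplus>\<^bsub>hom_module A N M\<^esub> s \<odot>\<^bsub>hom_module A N M\<^esub> f"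
      "r \<otimes>\<^bsub>A\<^esub> s \<odot>\<^bsub>hom_module A N M\<^esub> f = r \<odot>\<^bsub>hom_module A N M\<^esub> (s \<odot>\<^bsub>hom_module A N M\<^esub> f)"
      by (auto simp: hom_module_def cl M.smult_l_distr M.smult_assoc1 intro!: restrict_ext)
  next
    fix r f g assume "r \<in> carrier A" "f \<in> carrier (hom_module A N M)" "g \<in> carrier (hom_module A N M)"
    then show "r \<odot>\<^bsub>hom_module A N M\<^esub> (f \<oplus>\<^bsub>hom_module A N M\<^esub> g) = r \<odot>\<^bsub>hom_module A N M\<^esub> f \<oplus>\<^bsub>hom_module A N M\<^esub> r \<odot>\<^bsub>hom_module A N M\<^esub> g"
      by (auto simp: hom_module_def cl M.smult_r_distr intro!: restrict_ext)
  next
    fix f assume f: "f \<in> carrier (hom_module A N M)"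
    then have f': "f \<in> mod_hom A N M" by (simp add: hom_module_def)
    show "\<one>\<^bsub>A\<^esub> \<odot>\<^bsub>hom_module A N M\<^esub> f = f"
      by (rule eqI) (use cl[OF f'] ext[OF f'] in \<open>auto simp: hom_module_def\<close>)
  qed
qed

lemma hom_functor:
  fixes N :: "('a, 'x) module"
  assumes N: "module A N"
  shows "additive_functor A (hom_module A N :: ('a, 'u) module \<Rightarrow> ('a, 'x \<Rightarrow> 'u) module)
    (\<lambda>E E' h. \<lambda>f\<in>mod_hom A N E. compose (carrier N) h f)"
proof -
  have carr: "carrier (hom_module A N M) = mod_hom A N M" for M :: "('a, 'u) module"
    by (simp add: hom_module_def)
  have comp: "compose (carrier N) h f \<in> mod_hom A N K" if "f \<in> mod_hom A N M" "h \<in> mod_hom A M K"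
    for f h and M K :: "('a, 'u) module"
    using mod_hom_comp[OF N that] by (simp add: compose_def)
  interpret N: module A N by fact
  have cl: "x \<in> carrier N \<Longrightarrow> f x \<in> carrier M" if "f \<in> mod_hom A N M" for f x and M :: "('a, 'u) module"
    using that by (rule mod_hom_closed)
  show ?thesis
  proof (rule additive_functor.intro)
    fix M K L :: "('a, 'u) module" and f g :: "'u \<Rightarrow> 'u" and z :: "'x \<Rightarrow> 'u"
    show "module A (hom_module A N M)" if "module A M" by (rule hom_module_module[OF N that])
    show "(\<lambda>h\<in>mod_hom A N M. compose (carrier N) f h) \<in> mod_hom A (hom_module A N M) (hom_module A N K)"
      if "module A M" "module A K" "f \<in> mod_hom A M K"
      unfolding carr[symmetric]
      by (rule restrict_mod_homI[OF hom_module_module[OF N that(1)]])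
        (use comp[OF _ that(3)] cl mod_hom_add[OF that(3)] mod_hom_smult[OF that(3)] in
          \<open>auto simp: hom_module_def compose_def intro!: restrict_ext\<close>)
    assume z: "z \<in> carrier (hom_module A N M)"
    then have z': "z \<in> mod_hom A N M" by (simp add: carr)
    have ext: "z \<in> extensional (carrier N)" using z' by (auto simp: mod_hom_def PiE_def)
    show "(\<lambda>f\<in>mod_hom A N M. compose (carrier N) (\<lambda>x\<in>carrier M. x) f) z = z"
      by (rule extensionalityI[of _ "carrier N"]) (use z' ext cl[OF z'] in \<open>auto simp: compose_def\<close>)
    show "(\<lambda>h\<in>mod_hom A N M. compose (carrier N) (\<lambda>x\<in>carrier M. g (f x)) h) z =
        (\<lambda>h\<in>mod_hom A N K. compose (carrier N) g h) ((\<lambda>h\<in>mod_hom A N M. compose (carrier N) f h) z)"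
      if "f \<in> mod_hom A M K"
      using z' comp[OF z' that] cl[OF z'] by (auto simp: compose_def intro!: restrict_ext)
    show "(\<lambda>h\<in>mod_hom A N M. compose (carrier N) (\<lambda>x\<in>carrier M. f x \<oplus>\<^bsub>K\<^esub> g x) h) z =
        (\<lambda>h\<in>mod_hom A N M. compose (carrier N) f h) z \<oplus>\<^bsub>hom_module A N K\<^esub> (\<lambda>h\<in>mod_hom A N M. compose (carrier N) g h) z"
      using z' cl[OF z'] by (auto simp: compose_def hom_module_def intro!: restrict_ext)
  qed
qed

section \<open>Finitely generated modules and support\<close>

text \<open>The span is built by adding one multiple of a generator at a time, so that statements
  about linear combinations go by rule induction instead of through finite sums.\<close>

inductive_set mspan :: "'a ring \<Rightarrow> ('a, 'x) module \<Rightarrow> 'x set \<Rightarrow> 'x set" for A M S where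
  zero: "\<zero>\<^bsub>M\<^esub> \<in> mspan A M S"
| step: "x \<in> mspan A M S \<Longrightarrow> s \<in> S \<Longrightarrow> r \<in> carrier A \<Longrightarrow> x \<oplus>\<^bsub>M\<^esub> r \<odot>\<^bsub>M\<^esub> s \<in> mspan A M S"

lemma mspan_le:
  assumes M: "module A M" and N: "submodule N A M" and S: "S \<subseteq> N"
  shows "mspan A M S \<subseteq> N"
proof
  fix x assume "x \<in> mspan A M S"
  then show "x \<in> N"
    by induction (use submoduleD[OF M N] S in auto)
qed

lemma mspan_submodule:
  assumes M: "module A M" and S: "S \<subseteq> carrier M"
  shows "submodule (mspan A M S) A M"
proof -
  interpret M: module A M by fact
  have le: "mspan A M S \<subseteq> carrier M"
    by (rule mspan_le[OF M M.carrier_is_submodule S])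
  show ?thesis
  proof (rule submoduleI'[OF M le mspan.zero])
    fix x y assume x: "x \<in> mspan A M S" and y: "y \<in> mspan A M S"
    from y show "x \<oplus>\<^bsub>M\<^esub> y \<in> mspan A M S"
    proof induction
      case zero
      show ?case using x le by auto
    next
      case (step y s r)
      have "x \<oplus>\<^bsub>M\<^esub> (y \<oplus>\<^bsub>M\<^esub> r \<odot>\<^bsub>M\<^esub> s) = x \<oplus>\<^bsub>M\<^esub> y \<oplus>\<^bsub>M\<^esub> r \<odot>\<^bsub>M\<^esub> s"
        using x step le S by (intro M.a_assoc[symmetric]) auto
      then show ?case using step by (simp add: mspan.step)
    qed
  next
    fix t x assume t: "t \<in> carrier A" and x: "x \<in> mspan A M S"
    from x show "t \<odot>\<^bsub>M\<^esub> x \<in> mspan A M S"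
    proof induction
      case zero
      show ?case using t by (simp add: mspan.zero)
    next
      case (step x s r)
      have "t \<odot>\<^bsub>M\<^esub> (x \<oplus>\<^bsub>M\<^esub> r \<odot>\<^bsub>M\<^esub> s) = t \<odot>\<^bsub>M\<^esub> x \<oplus>\<^bsub>M\<^esub> (t \<otimes>\<^bsub>A\<^esub> r) \<odot>\<^bsub>M\<^esub> s"
        using t step le S by (simp add: subset_iff M.smult_r_distr M.smult_assoc1)
      then show ?case using step t by (simp add: mspan.step)
    qed
  qed
qed

lemma mspan_gen:
  assumes M: "module A M" and S: "S \<subseteq> carrier M" and s: "s \<in> S"
  shows "s \<in> mspan A M S"
proof -
  interpret M: module A M by fact
  have "\<zero>\<^bsub>M\<^esub> \<oplus>\<^bsub>M\<^esub> \<one>\<^bsub>A\<^esub> \<odot>\<^bsub>M\<^esub> s \<in> mspan A M S"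
    by (rule mspan.step[OF mspan.zero s]) simp
  then show ?thesis using S s by auto
qed

lemma mspan_mono:
  assumes "S \<subseteq> S'"
  shows "mspan A M S \<subseteq> mspan A M S'"
proof
  fix x assume "x \<in> mspan A M S"
  then show "x \<in> mspan A M S'"
    by induction (use assms in \<open>auto intro: mspan.intros\<close>)
qed

lemma fin_gen_iff_mspan:
  assumes M: "module A M"
  shows "fin_gen_module A M \<longleftrightarrow> (\<exists>S. finite S \<and> S \<subseteq> carrier M \<and> carrier M \<subseteq> mspan A M S)"
proof -
  interpret M: module A M by fact
  have 1: "(\<Oplus>\<^bsub>M\<^esub>s\<in>F. c s \<odot>\<^bsub>M\<^esub> s) \<in> mspan A M S"
    if S: "finite F" "F \<subseteq> S" "S \<subseteq> carrier M" "c \<in> S \<rightarrow> carrier A" for c S F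
    using S(1,2)
  proof induction
    case empty
    show ?case by (simp add: mspan.zero)
  next
    case (insert s F)
    have c: "c s \<odot>\<^bsub>M\<^esub> s \<in> carrier M" "(\<lambda>s. c s \<odot>\<^bsub>M\<^esub> s) \<in> F \<rightarrow> carrier M"
      using insert S by (auto simp: Pi_iff subset_iff)
    have "(\<Oplus>\<^bsub>M\<^esub>s\<in>insert s F. c s \<odot>\<^bsub>M\<^esub> s) = (\<Oplus>\<^bsub>M\<^esub>s\<in>F. c s \<odot>\<^bsub>M\<^esub> s) \<oplus>\<^bsub>M\<^esub> c s \<odot>\<^bsub>M\<^esub> s"
      using insert c by (simp add: M.a_comm)
    then show ?case using insert S by (auto intro!: mspan.step)
  qed
  have 2: "\<exists>c. c \<in> S \<rightarrow> carrier A \<and> x = (\<Oplus>\<^bsub>M\<^esub>s\<in>S. c s \<odot>\<^bsub>M\<^esub> s)"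
    if S: "finite S" "S \<subseteq> carrier M" and x: "x \<in> mspan A M S" for S x
    using x
  proof induction
    case zero
    have "(\<Oplus>\<^bsub>M\<^esub>s\<in>S. \<zero>\<^bsub>A\<^esub> \<odot>\<^bsub>M\<^esub> s) = \<zero>\<^bsub>M\<^esub>"
      using S by (intro M.add.finprod_one_eqI) auto
    then show ?case by (intro exI[of _ "\<lambda>_. \<zero>\<^bsub>A\<^esub>"]) auto
  next
    case (step x t r)
    then obtain c where c: "c \<in> S \<rightarrow> carrier A" "x = (\<Oplus>\<^bsub>M\<^esub>s\<in>S. c s \<odot>\<^bsub>M\<^esub> s)" by blast
    define c' where "c' = c(t := c t \<oplus>\<^bsub>A\<^esub> r)"
    have f: "(\<lambda>s. c s \<odot>\<^bsub>M\<^esub> s) \<in> S \<rightarrow> carrier M" "(\<lambda>s. r \<odot>\<^bsub>M\<^esub> s) \<in> S \<rightarrow> carrier M"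
      "(\<lambda>s. if t = s then r \<odot>\<^bsub>M\<^esub> s else \<zero>\<^bsub>M\<^esub>) \<in> S \<rightarrow> carrier M"
      using c S step by (auto simp: Pi_iff subset_iff)
    have "(\<Oplus>\<^bsub>M\<^esub>s\<in>S. c' s \<odot>\<^bsub>M\<^esub> s) = (\<Oplus>\<^bsub>M\<^esub>s\<in>S. c s \<odot>\<^bsub>M\<^esub> s \<oplus>\<^bsub>M\<^esub> (if t = s then r \<odot>\<^bsub>M\<^esub> s else \<zero>\<^bsub>M\<^esub>))"
      using c S step f by (intro M.add.finprod_cong') (auto simp: c'_def Pi_iff subset_iff M.smult_l_distr)
    also have "\<dots> = x \<oplus>\<^bsub>M\<^esub> r \<odot>\<^bsub>M\<^esub> t"
      using f step S c(2) M.finsum_singleton[of t S "\<lambda>s. r \<odot>\<^bsub>M\<^esub> s"] by (simp add: M.finsum_addf)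
    finally have "x \<oplus>\<^bsub>M\<^esub> r \<odot>\<^bsub>M\<^esub> t = (\<Oplus>\<^bsub>M\<^esub>s\<in>S. c' s \<odot>\<^bsub>M\<^esub> s)" ..
    moreover have "c' \<in> S \<rightarrow> carrier A" using c step by (auto simp: c'_def Pi_iff)
    ultimately show ?case by blast
  qed
  show ?thesis
    unfolding fin_gen_module_def
  proof (intro iffI; elim exE conjE)
    fix S assume S: "finite S" "S \<subseteq> carrier M" "\<forall>x\<in>carrier M. \<exists>c. c \<in> S \<rightarrow> carrier A \<and> x = (\<Oplus>\<^bsub>M\<^esub>s\<in>S. c s \<odot>\<^bsub>M\<^esub> s)"
    have "carrier M \<subseteq> mspan A M S"
    proof
      fix x assume "x \<in> carrier M"
      then obtain c where c: "c \<in> S \<rightarrow> carrier A" "x = (\<Oplus>\<^bsub>M\<^esub>s\<in>S. c s \<odot>\<^bsub>M\<^esub> s)" using S(3) by auto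
      show "x \<in> mspan A M S" unfolding c(2) by (rule 1[OF S(1) subset_refl S(2) c(1)])
    qed
    then show "\<exists>S. finite S \<and> S \<subseteq> carrier M \<and> carrier M \<subseteq> mspan A M S" using S by blast
  next
    fix S assume S: "finite S" "S \<subseteq> carrier M" "carrier M \<subseteq> mspan A M S"
    then show "\<exists>S. finite S \<and> S \<subseteq> carrier M \<and> (\<forall>x\<in>carrier M. \<exists>c. c \<in> S \<rightarrow> carrier A \<and> x = (\<Oplus>\<^bsub>M\<^esub>s\<in>S. c s \<odot>\<^bsub>M\<^esub> s))"
      using 2[OF S(1,2) subsetD[OF S(3)]] by (intro exI[of _ S]) simp
  qed
qed

lemma mspan_image:
  assumes M: "module A M" and N: "module A N" and f: "f \<in> mod_hom A M N" and S: "S \<subseteq> carrier M"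
    and x: "x \<in> mspan A M S"
  shows "f x \<in> mspan A N (f ` S)"
  using x
proof induction
  case zero
  show ?case using mod_hom_zero[OF M N f] by (simp add: mspan.zero)
next
  case (step x s r)
  interpret M: module A M by fact
  have "x \<in> carrier M" "s \<in> carrier M"
    using step submoduleD(1)[OF M mspan_submodule[OF M S]] S by auto
  then have "f (x \<oplus>\<^bsub>M\<^esub> r \<odot>\<^bsub>M\<^esub> s) = f x \<oplus>\<^bsub>N\<^esub> r \<odot>\<^bsub>N\<^esub> f s"
    using step by (simp add: mod_hom_add[OF f] mod_hom_smult[OF f])
  then show ?case using step by (auto intro: mspan.step)
qed

text \<open>As \<open>U\<close> and \<open>V\<close> are closed under subtraction, this is the ideal
  of all \<open>r\<close> with \<open>r s\<close> in \<open>U + V\<close>. With \<open>V\<close> the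
  span of the other generators it collects the coefficients at \<open>s\<close> of elements of
  \<open>U\<close>, the analogue of leading coefficients in Hilbert's basis theorem.\<close>

lemma conductor_ideal:
  assumes M: "module A M" and U: "submodule U A M" and V: "submodule V A M" and s: "s \<in> carrier M"
  shows "ideal {r \<in> carrier A. \<exists>u\<in>U. \<exists>v\<in>V. u = v \<oplus>\<^bsub>M\<^esub> r \<odot>\<^bsub>M\<^esub> s} A" (is "ideal ?J A")
proof -
  interpret M: module A M by fact
  note U' = submoduleD[OF M U] and V' = submoduleD[OF M V]
  have add: "r \<oplus>\<^bsub>A\<^esub> r' \<in> ?J" if rr: "r \<in> ?J" "r' \<in> ?J" for r r'
  proof -
    obtain u v u' v' where uv: "r \<in> carrier A" "r' \<in> carrier A" "u \<in> U" "v \<in> V" "u' \<in> U" "v' \<in> V"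
      "u = v \<oplus>\<^bsub>M\<^esub> r \<odot>\<^bsub>M\<^esub> s" "u' = v' \<oplus>\<^bsub>M\<^esub> r' \<odot>\<^bsub>M\<^esub> s" using rr by auto
    have "u \<oplus>\<^bsub>M\<^esub> u' = (v \<oplus>\<^bsub>M\<^esub> v') \<oplus>\<^bsub>M\<^esub> (r \<oplus>\<^bsub>A\<^esub> r') \<odot>\<^bsub>M\<^esub> s"
      using uv(1,2,4,6) subsetD[OF V'(1)] s unfolding uv(7,8) by (simp add: M.smult_l_distr M.add.m_ac)
    then show ?thesis using uv U'(3) V'(3) by blast
  qed
  have mult: "t \<otimes>\<^bsub>A\<^esub> r \<in> ?J" if r: "r \<in> ?J" and t: "t \<in> carrier A" for r t
  proof -
    obtain u v where uv: "r \<in> carrier A" "u \<in> U" "v \<in> V" "u = v \<oplus>\<^bsub>M\<^esub> r \<odot>\<^bsub>M\<^esub> s" using r by auto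
    have "t \<odot>\<^bsub>M\<^esub> u = t \<odot>\<^bsub>M\<^esub> v \<oplus>\<^bsub>M\<^esub> (t \<otimes>\<^bsub>A\<^esub> r) \<odot>\<^bsub>M\<^esub> s"
      using uv(1,3) subsetD[OF V'(1)] s t unfolding uv(4) by (simp add: M.smult_r_distr M.smult_assoc1)
    then show ?thesis using uv t U'(4) V'(4) by blast
  qed
  have zero: "\<zero>\<^bsub>A\<^esub> \<in> ?J"
    using U'(2) V'(2) s by (auto intro!: bexI[of _ "\<zero>\<^bsub>M\<^esub>"])
  show ?thesis
  proof (rule idealI)
    show "subgroup ?J (add_monoid A)"
    proof (rule subgroup.intro)
      fix r assume "r \<in> ?J"
      then have "(\<ominus>\<^bsub>A\<^esub> \<one>\<^bsub>A\<^esub>) \<otimes>\<^bsub>A\<^esub> r \<in> ?J" by (rule mult) simp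
      then have "\<ominus>\<^bsub>A\<^esub> r \<in> ?J" using \<open>r \<in> ?J\<close> by (simp add: M.R.l_minus)
      then show "inv\<^bsub>add_monoid A\<^esub> r \<in> ?J" by (simp add: a_inv_def)
    qed (use add zero in auto)
    show "r \<otimes>\<^bsub>A\<^esub> t \<in> ?J" if "r \<in> ?J" "t \<in> carrier A" for r t
      using mult[OF that] that M.R.m_comm[of r t] by auto
  qed (use mult M.R.ring_axioms in auto)
qed

lemma submodule_inter:
  assumes M: "module A M" and U: "submodule U A M" and V: "submodule V A M"
  shows "submodule (U \<inter> V) A M"
  by (rule submoduleI'[OF M]) (use submoduleD[OF M U] submoduleD[OF M V] in auto)

lemma mspan_insert:
  assumes M: "module A M" and S: "S \<subseteq> carrier M" and s: "s \<in> carrier M" and x: "x \<in> mspan A M (insert s S)"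
  shows "\<exists>v\<in>mspan A M S. \<exists>r\<in>carrier A. x = v \<oplus>\<^bsub>M\<^esub> r \<odot>\<^bsub>M\<^esub> s"
  using x
proof induction
  case zero
  interpret M: module A M by fact
  show ?case
    by (rule bexI[OF _ mspan.zero], rule bexI[of _ "\<zero>\<^bsub>A\<^esub>"]) (use s in auto)
next
  case (step x t r)
  interpret M: module A M by fact
  note V = subsetD[OF submoduleD(1)[OF M mspan_submodule[OF M S]]]
  obtain v q where v: "v \<in> mspan A M S" and q: "q \<in> carrier A" and x: "x = v \<oplus>\<^bsub>M\<^esub> q \<odot>\<^bsub>M\<^esub> s"
    using step by blast
  show ?case
  proof (cases "t = s")
    case True
    have "x \<oplus>\<^bsub>M\<^esub> r \<odot>\<^bsub>M\<^esub> t = v \<oplus>\<^bsub>M\<^esub> (q \<oplus>\<^bsub>A\<^esub> r) \<odot>\<^bsub>M\<^esub> s"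
      using V[OF v] q step s by (simp add: x True M.smult_l_distr M.a_assoc)
    then show ?thesis using v q step by blast
  next
    case False
    then have t: "t \<in> S" "t \<in> carrier M" using step S by auto
    have "x \<oplus>\<^bsub>M\<^esub> r \<odot>\<^bsub>M\<^esub> t = (v \<oplus>\<^bsub>M\<^esub> r \<odot>\<^bsub>M\<^esub> t) \<oplus>\<^bsub>M\<^esub> q \<odot>\<^bsub>M\<^esub> s"
      using V[OF v] q step s t by (simp add: x M.add.m_ac)
    moreover have "v \<oplus>\<^bsub>M\<^esub> r \<odot>\<^bsub>M\<^esub> t \<in> mspan A M S" using v t step by (simp add: mspan.step)
    ultimately show ?thesis using q by blast
  qed
qed

text \<open>Hilbert's argument: the last coordinates of elements of \<open>N\<close> form a finitely generated ideal.\<close>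

lemma noetherian_submodule:
  assumes A: "noetherian_ring A" and M: "module A M" and S: "finite S" "S \<subseteq> carrier M"
    and N: "submodule N A M" "N \<subseteq> mspan A M S"
  shows "\<exists>B. finite B \<and> B \<subseteq> N \<and> N \<subseteq> mspan A M B"
  using S N
proof (induction S arbitrary: N)
  case empty
  have "N \<subseteq> {\<zero>\<^bsub>M\<^esub>}"
    using empty.prems(3) mspan_le[OF M submodule_zero[OF M], of "{}"] by auto
  then show ?case by (intro exI[of _ "{}"]) (auto intro: mspan.zero)
next
  case (insert s S)
  interpret A: noetherian_ring A by fact
  interpret M: module A M by fact
  have s: "s \<in> carrier M" and S: "S \<subseteq> carrier M" using insert by auto
  let ?V = "mspan A M S"
  have V: "submodule ?V A M" by (rule mspan_submodule[OF M S])
  note N' = submoduleD[OF M \<open>submodule N A M\<close>] and V' = submoduleD[OF M V]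
  define J where "J = {r \<in> carrier A. \<exists>u\<in>N. \<exists>v\<in>?V. u = v \<oplus>\<^bsub>M\<^esub> r \<odot>\<^bsub>M\<^esub> s}"
  have "ideal J A" unfolding J_def by (rule conductor_ideal[OF M insert.prems(2) V s])
  then obtain G where G: "G \<subseteq> carrier A" "finite G" "J = genideal A G"
    using A.finetely_gen by blast
  have "\<forall>g\<in>G. \<exists>u\<in>N. \<exists>v\<in>?V. u = v \<oplus>\<^bsub>M\<^esub> g \<odot>\<^bsub>M\<^esub> s"
    using A.genideal_self[OF G(1)] unfolding G(3)[symmetric] J_def by blast
  then obtain u v where uv: "\<And>g. g \<in> G \<Longrightarrow> u g \<in> N" "\<And>g. g \<in> G \<Longrightarrow> v g \<in> ?V"
     "\<And>g. g \<in> G \<Longrightarrow> u g = v g \<oplus>\<^bsub>M\<^esub> g \<odot>\<^bsub>M\<^esub> s" by metis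
  have uG: "u ` G \<subseteq> carrier M" using uv(1) N'(1) by auto
  have U: "submodule (mspan A M (u ` G)) A M" by (rule mspan_submodule[OF M uG])
  note U' = submoduleD[OF M U]
  \<comment> \<open>The chosen elements \<open>u g\<close> realise generators of \<open>J\<close> as
    coefficients at \<open>s\<close>. The coefficients realised by their span form an ideal, so they
    exhaust \<open>J\<close>.\<close>
  have "G \<subseteq> {r \<in> carrier A. \<exists>y\<in>mspan A M (u ` G). \<exists>w\<in>?V. y = w \<oplus>\<^bsub>M\<^esub> r \<odot>\<^bsub>M\<^esub> s}"
  proof
    fix g assume g: "g \<in> G"
    have "u g \<in> mspan A M (u ` G)" by (rule mspan_gen[OF M uG]) (use g in simp)
    then show "g \<in> {r \<in> carrier A. \<exists>y\<in>mspan A M (u ` G). \<exists>w\<in>?V. y = w \<oplus>\<^bsub>M\<^esub> r \<odot>\<^bsub>M\<^esub> s}"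
      using subsetD[OF G(1) g] uv(2,3)[OF g] by blast
  qed
  then have J_le: "J \<subseteq> {r \<in> carrier A. \<exists>y\<in>mspan A M (u ` G). \<exists>w\<in>?V. y = w \<oplus>\<^bsub>M\<^esub> r \<odot>\<^bsub>M\<^esub> s}"
    unfolding G(3) by (rule A.genideal_minimal[OF conductor_ideal[OF M U V s]])
  obtain B where B: "finite B" "B \<subseteq> N \<inter> ?V" "N \<inter> ?V \<subseteq> mspan A M B"
    using insert.IH[OF S submodule_inter[OF M insert.prems(2) V]] by auto
  have C: "B \<union> u ` G \<subseteq> carrier M" using B(2) uG N'(1) by auto
  note C' = submoduleD[OF M mspan_submodule[OF M C]]
  have "x \<in> mspan A M (B \<union> u ` G)" if x: "x \<in> N" for x
  proof -
    obtain w r where w: "w \<in> ?V" "r \<in> carrier A" "x = w \<oplus>\<^bsub>M\<^esub> r \<odot>\<^bsub>M\<^esub> s"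
      using mspan_insert[OF M S s] x insert.prems(3) by blast
    then have "r \<in> J" using x by (auto simp: J_def)
    then obtain y w' where y: "y \<in> mspan A M (u ` G)" "w' \<in> ?V" "y = w' \<oplus>\<^bsub>M\<^esub> r \<odot>\<^bsub>M\<^esub> s"
      using J_le by blast
    have yN: "y \<in> N" using mspan_le[OF M insert.prems(2), of "u ` G"] uv(1) y(1) by blast
    have carr: "w \<in> carrier M" "w' \<in> carrier M" "r \<odot>\<^bsub>M\<^esub> s \<in> carrier M" "x \<in> carrier M" "y \<in> carrier M"
      using w y V'(1) s x yN N'(1) by auto
    \<comment> \<open>Here \<open>y\<close> lies in that span and has the same coefficient at
      \<open>s\<close> as \<open>x\<close>. The difference therefore lies both in \<open>N\<close>
      and in the span of \<open>S\<close>, where the induction hypothesis has provided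
      generators.\<close>
    have "x \<ominus>\<^bsub>M\<^esub> y = w \<ominus>\<^bsub>M\<^esub> w'"
    proof -
      have "x \<ominus>\<^bsub>M\<^esub> y = w \<oplus>\<^bsub>M\<^esub> (r \<odot>\<^bsub>M\<^esub> s \<oplus>\<^bsub>M\<^esub> \<ominus>\<^bsub>M\<^esub> (r \<odot>\<^bsub>M\<^esub> s)) \<oplus>\<^bsub>M\<^esub> \<ominus>\<^bsub>M\<^esub> w'"
        using carr(1-3) unfolding w(3) y(3) by (simp add: M.minus_eq M.minus_add M.add.m_ac)
      then show ?thesis using carr(1-3) by (simp add: M.r_neg M.minus_eq)
    qed
    then have "x \<ominus>\<^bsub>M\<^esub> y \<in> mspan A M B"
      using N'(6)[OF x yN] V'(6)[OF w(1) y(2)] B(3) by auto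
    then have "x \<ominus>\<^bsub>M\<^esub> y \<in> mspan A M (B \<union> u ` G)" using mspan_mono[of B "B \<union> u ` G"] by blast
    moreover have "y \<in> mspan A M (B \<union> u ` G)" using mspan_mono[of "u ` G" "B \<union> u ` G"] y(1) by blast
    ultimately have "(x \<ominus>\<^bsub>M\<^esub> y) \<oplus>\<^bsub>M\<^esub> y \<in> mspan A M (B \<union> u ` G)" by (rule C'(3))
    then show ?thesis using carr by (simp add: M.minus_cancel)
  qed
  then show ?case
    using B G(2) uv(1) by (intro exI[of _ "B \<union> u ` G"]) auto
qed

text \<open>The image of \<open>g\<close> is a submodule of a finitely generated module over a
  noetherian ring, hence finitely generated; lifts of its generators together with the images of
  generators of \<open>X\<close> generate the middle term.\<close>

lemma fin_gen_exact_middle: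
  assumes A: "noetherian_ring A" and X: "module A X" and Y: "module A Y" and Z: "module A Z"
    and f: "f \<in> mod_hom A X Y" and g: "g \<in> mod_hom A Y Z" and ex: "f ` carrier X = a_kernel Y Z g"
    and fgX: "fin_gen_module A X" and fgZ: "fin_gen_module A Z"
  shows "fin_gen_module A Y"
proof -
  interpret Y: module A Y by fact
  interpret Z: module A Z by fact
  obtain S where S: "finite S" "S \<subseteq> carrier X" "carrier X \<subseteq> mspan A X S"
    using fgX fin_gen_iff_mspan[OF X] by blast
  obtain R where R: "finite R" "R \<subseteq> carrier Z" "carrier Z \<subseteq> mspan A Z R"
    using fgZ fin_gen_iff_mspan[OF Z] by blast
  have sub: "submodule (g ` carrier Y) A Z" by (rule submodule_image[OF Y Z g])
  have "g ` carrier Y \<subseteq> mspan A Z R" using R(3) mod_hom_closed[OF g] by blast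
  then obtain B where B: "finite B" "B \<subseteq> g ` carrier Y" "g ` carrier Y \<subseteq> mspan A Z B"
    using noetherian_submodule[OF A Z R(1,2) sub] by blast
  obtain T where T: "finite T" "T \<subseteq> carrier Y" "B = g ` T"
    using finite_subset_image[OF B(1,2)] by blast
  define G where "G = T \<union> f ` S"
  have G: "finite G" "G \<subseteq> carrier Y" using T S mod_hom_closed[OF f] by (auto simp: G_def)
  note G' = submoduleD[OF Y mspan_submodule[OF Y G(2)]]
  have lift: "\<exists>t\<in>mspan A Y T. g t = z" if "z \<in> mspan A Z (g ` T)" for z
    using that
  proof induction
    case zero
    show ?case using mod_hom_zero[OF Y Z g] mspan.zero by metis
  next
    case (step z b r)
    then obtain t b' where t: "t \<in> mspan A Y T" "g t = z" "b' \<in> T" "b = g b'" by blast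
    have c: "t \<in> carrier Y" "b' \<in> carrier Y"
      using t T(2) submoduleD(1)[OF Y mspan_submodule[OF Y T(2)]] by auto
    have "g (t \<oplus>\<^bsub>Y\<^esub> r \<odot>\<^bsub>Y\<^esub> b') = z \<oplus>\<^bsub>Z\<^esub> r \<odot>\<^bsub>Z\<^esub> b"
      using t c step by (simp add: mod_hom_add[OF g] mod_hom_smult[OF g])
    then show ?case using t step mspan.step by metis
  qed
  have "y \<in> mspan A Y G" if y: "y \<in> carrier Y" for y
  proof -
    obtain t where t: "t \<in> mspan A Y T" "g t = g y" using lift B(3) T(3) y by blast
    have tc: "t \<in> carrier Y" using t submoduleD(1)[OF Y mspan_submodule[OF Y T(2)]] by auto
    have "g (y \<ominus>\<^bsub>Y\<^esub> t) = \<zero>\<^bsub>Z\<^esub>"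
      using y tc t mod_hom_closed[OF g] by (simp add: mod_hom_minus[OF Y Z g] Z.minus_eq_zero_iff)
    then have "y \<ominus>\<^bsub>Y\<^esub> t \<in> f ` carrier X" unfolding ex using y tc by (simp add: a_kernel_def')
    then obtain x where x: "x \<in> carrier X" "y \<ominus>\<^bsub>Y\<^esub> t = f x" by auto
    have "y \<ominus>\<^bsub>Y\<^esub> t \<in> mspan A Y (f ` S)"
      unfolding x(2) by (rule mspan_image[OF X Y f S(2) subsetD[OF S(3) x(1)]])
    then have "y \<ominus>\<^bsub>Y\<^esub> t \<in> mspan A Y G" "t \<in> mspan A Y G"
      using t(1) mspan_mono[of "f ` S" G A Y] mspan_mono[of T G A Y] by (auto simp: G_def)
    then have "(y \<ominus>\<^bsub>Y\<^esub> t) \<oplus>\<^bsub>Y\<^esub> t \<in> mspan A Y G" by (rule G'(3))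
    then show ?thesis using y tc by (simp add: Y.minus_cancel)
  qed
  then show ?thesis unfolding fin_gen_iff_mspan[OF Y] using G by blast
qed

text \<open>A fraction \<open>x/s\<close> is zero exactly when some \<open>u\<close> outside
  \<open>p\<close> kills \<open>x\<close>, so the localization is nonzero exactly when some element
  escapes all such \<open>u\<close>.\<close>

lemma supp_iff:
  assumes M: "module A M"
  shows "p \<in> supp A M \<longleftrightarrow> primeideal p A \<and> (\<exists>x\<in>carrier M. \<forall>u\<in>carrier A - p. u \<odot>\<^bsub>M\<^esub> x \<noteq> \<zero>\<^bsub>M\<^esub>)"
proof (cases "primeideal p A")
  case False
  then show ?thesis by (simp add: supp_def)
next
  case True
  interpret M: module A M by fact
  interpret p: primeideal p A by fact
  let ?S = "carrier A - p"
  have one: "\<one>\<^bsub>A\<^esub> \<in> ?S"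
    using p.one_imp_carrier p.I_notcarr by auto
  have mult: "u \<otimes>\<^bsub>A\<^esub> v \<in> ?S" if "u \<in> ?S" "v \<in> ?S" for u v
    using p.I_prime[of u v] that by auto
  let ?R = "fraction_rel M ?S"
  show ?thesis
  proof (cases "\<exists>x\<in>carrier M. \<forall>u\<in>?S. u \<odot>\<^bsub>M\<^esub> x \<noteq> \<zero>\<^bsub>M\<^esub>")
    case True
    then obtain x where x: "x \<in> carrier M" "\<And>u. u \<in> ?S \<Longrightarrow> u \<odot>\<^bsub>M\<^esub> x \<noteq> \<zero>\<^bsub>M\<^esub>" by blast
    have "?R `` {(x, \<one>\<^bsub>A\<^esub>)} \<in> localization M ?S"
      using x one by (auto simp: localization_def quotient_def)
    moreover have "?R `` {(x, \<one>\<^bsub>A\<^esub>)} \<noteq> ?R `` {(\<zero>\<^bsub>M\<^esub>, \<one>\<^bsub>A\<^esub>)}"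
    proof
      assume eq: "?R `` {(x, \<one>\<^bsub>A\<^esub>)} = ?R `` {(\<zero>\<^bsub>M\<^esub>, \<one>\<^bsub>A\<^esub>)}"
      have "(x, \<one>\<^bsub>A\<^esub>) \<in> ?R `` {(x, \<one>\<^bsub>A\<^esub>)}" using x one by (auto simp: fraction_rel_def)
      then have "(x, \<one>\<^bsub>A\<^esub>) \<in> ?R `` {(\<zero>\<^bsub>M\<^esub>, \<one>\<^bsub>A\<^esub>)}" unfolding eq .
      then obtain u where "u \<in> ?S" "u \<odot>\<^bsub>M\<^esub> (\<one>\<^bsub>A\<^esub> \<odot>\<^bsub>M\<^esub> \<zero>\<^bsub>M\<^esub>) = u \<odot>\<^bsub>M\<^esub> (\<one>\<^bsub>A\<^esub> \<odot>\<^bsub>M\<^esub> x)"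
        by (auto simp: fraction_rel_def)
      then show False using x by auto
    qed
    ultimately show ?thesis
      using True \<open>primeideal p A\<close> by (auto simp: supp_def)
  next
    case False
    then have k: "\<exists>u\<in>?S. u \<odot>\<^bsub>M\<^esub> x = \<zero>\<^bsub>M\<^esub>" if "x \<in> carrier M" for x
      using that by blast
    \<comment> \<open>A product of annihilators of \<open>x\<close> and \<open>y\<close> kills both
      sides of the relation and still lies outside \<open>p\<close>, so all fractions fall into a
      single class.\<close>
    have rel: "((x, s), (y, t)) \<in> ?R" if xy: "x \<in> carrier M" "y \<in> carrier M" "s \<in> ?S" "t \<in> ?S" for x y s t
    proof -
      obtain u v where u: "u \<in> ?S" "u \<odot>\<^bsub>M\<^esub> x = \<zero>\<^bsub>M\<^esub>" and v: "v \<in> ?S" "v \<odot>\<^bsub>M\<^esub> y = \<zero>\<^bsub>M\<^esub>"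
        using k[OF xy(1)] k[OF xy(2)] by blast
      have "(u \<otimes>\<^bsub>A\<^esub> v) \<odot>\<^bsub>M\<^esub> (t \<odot>\<^bsub>M\<^esub> x) = (v \<otimes>\<^bsub>A\<^esub> t) \<odot>\<^bsub>M\<^esub> (u \<odot>\<^bsub>M\<^esub> x)"
        using u(1) v(1) xy by (simp add: M.smult_assoc1[symmetric] M.R.m_ac)
      moreover have "(u \<otimes>\<^bsub>A\<^esub> v) \<odot>\<^bsub>M\<^esub> (s \<odot>\<^bsub>M\<^esub> y) = (u \<otimes>\<^bsub>A\<^esub> s) \<odot>\<^bsub>M\<^esub> (v \<odot>\<^bsub>M\<^esub> y)"
        using u(1) v(1) xy by (simp add: M.smult_assoc1[symmetric] M.R.m_ac)
      ultimately have "(u \<otimes>\<^bsub>A\<^esub> v) \<odot>\<^bsub>M\<^esub> (t \<odot>\<^bsub>M\<^esub> x) = (u \<otimes>\<^bsub>A\<^esub> v) \<odot>\<^bsub>M\<^esub> (s \<odot>\<^bsub>M\<^esub> y)"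
        using u v xy by simp
      then show ?thesis using mult[OF u(1) v(1)] xy by (auto simp: fraction_rel_def)
    qed
    have cls: "?R `` {(x, s)} = carrier M \<times> ?S" if "x \<in> carrier M" "s \<in> ?S" for x s
    proof (rule Set.set_eqI)
      fix z show "z \<in> ?R `` {(x, s)} \<longleftrightarrow> z \<in> carrier M \<times> ?S"
        using rel[OF that(1) _ that(2)] by (cases z) (auto simp: fraction_rel_def)
    qed
    have "localization M ?S = {?R `` {(\<zero>\<^bsub>M\<^esub>, \<one>\<^bsub>A\<^esub>)}}"
    proof (intro equalityI subsetI)
      fix c assume "c \<in> localization M ?S"
      then show "c \<in> {?R `` {(\<zero>\<^bsub>M\<^esub>, \<one>\<^bsub>A\<^esub>)}}"
        unfolding localization_def quotient_def using cls one by auto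
    next
      fix c assume "c \<in> {?R `` {(\<zero>\<^bsub>M\<^esub>, \<one>\<^bsub>A\<^esub>)}}"
      then show "c \<in> localization M ?S"
        unfolding localization_def quotient_def using one by auto
    qed
    then show ?thesis using False by (simp add: supp_def)
  qed
qed

lemma supp_extension:
  assumes ses: "short_exact A P Q T f g"
  shows "supp A Q \<subseteq> supp A P \<union> supp A T"
proof
  fix p assume "p \<in> supp A Q"
  have P: "module A P" and Q: "module A Q" and T: "module A T" and f: "f \<in> mod_hom A P Q" and g: "g \<in> mod_hom A Q T"
    and fg: "f ` carrier P = a_kernel Q T g"
    using ses by (auto simp: short_exact_def)
  interpret P: module A P by fact
  interpret Q: module A Q by fact
  obtain x where p: "primeideal p A" and x: "x \<in> carrier Q" "\<And>u. u \<in> carrier A - p \<Longrightarrow> u \<odot>\<^bsub>Q\<^esub> x \<noteq> \<zero>\<^bsub>Q\<^esub>"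
    using \<open>p \<in> supp A Q\<close> supp_iff[OF Q] by blast
  interpret p: primeideal p A by fact
  show "p \<in> supp A P \<union> supp A T"
  \<comment> \<open>Either \<open>g x\<close> is a witness for \<open>T\<close>, or some
    \<open>u\<close> outside \<open>p\<close> moves \<open>x\<close> into the image of
    \<open>P\<close>. In the second case the preimage is a witness for \<open>P\<close>, because
    products of elements outside \<open>p\<close> stay outside \<open>p\<close>.\<close>
  proof (cases "\<forall>u\<in>carrier A - p. u \<odot>\<^bsub>T\<^esub> g x \<noteq> \<zero>\<^bsub>T\<^esub>")
    case True
    then show ?thesis using p mod_hom_closed[OF g x(1)] by (auto simp: supp_iff[OF T])
  next
    case False
    then obtain u where u: "u \<in> carrier A - p" "u \<odot>\<^bsub>T\<^esub> g x = \<zero>\<^bsub>T\<^esub>" by blast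
    then have "u \<odot>\<^bsub>Q\<^esub> x \<in> f ` carrier P"
      unfolding fg using x(1) by (auto simp: a_kernel_def' mod_hom_smult[OF g])
    then obtain y where y: "y \<in> carrier P" "u \<odot>\<^bsub>Q\<^esub> x = f y" by blast
    have "v \<odot>\<^bsub>P\<^esub> y \<noteq> \<zero>\<^bsub>P\<^esub>" if v: "v \<in> carrier A - p" for v
    proof
      assume "v \<odot>\<^bsub>P\<^esub> y = \<zero>\<^bsub>P\<^esub>"
      then have "v \<odot>\<^bsub>Q\<^esub> (u \<odot>\<^bsub>Q\<^esub> x) = \<zero>\<^bsub>Q\<^esub>"
        using mod_hom_smult[OF f _ y(1), of v] v mod_hom_zero[OF P Q f] y(2) by simp
      then have "(v \<otimes>\<^bsub>A\<^esub> u) \<odot>\<^bsub>Q\<^esub> x = \<zero>\<^bsub>Q\<^esub>" using u v x(1) by (simp add: Q.smult_assoc1)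
      moreover have "v \<otimes>\<^bsub>A\<^esub> u \<in> carrier A - p" using p.I_prime[of v u] u v by auto
      ultimately show False using x(2) by blast
    qed
    then show ?thesis using p y by (auto simp: supp_iff[OF P])
  qed
qed

section \<open>Ext from the quotient by the ideal, and extensions of cofinite modules\<close>

lemma self_module_module:
  assumes "cring A"
  shows "module A (self_module A)"
proof -
  interpret A: cring A by fact
  show ?thesis
  proof (rule moduleI)
    show "abelian_group (self_module A)"
    proof (rule abelian_groupI)
      fix x assume "x \<in> carrier (self_module A)"
      then show "\<exists>y\<in>carrier (self_module A). y \<oplus>\<^bsub>self_module A\<^esub> x = \<zero>\<^bsub>self_module A\<^esub>"
        by (intro bexI[of _ "\<ominus>\<^bsub>A\<^esub> x"]) (auto simp: self_module_def ring.defs module.defs A.l_neg)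
    qed (auto simp: self_module_def ring.defs module.defs A.add.m_ac)
  qed (auto simp: self_module_def ring.defs module.defs A.l_distr A.r_distr A.m_assoc assms)
qed

lemma ideal_submodule:
  assumes "cring A" "ideal \<aa> A"
  shows "submodule \<aa> A (self_module A)"
proof -
  interpret ideal \<aa> A by fact
  show ?thesis
    by (rule submoduleI'[OF self_module_module[OF assms(1)]])
      (use a_subset I_l_closed in \<open>auto simp: self_module_def ring.defs module.defs\<close>)
qed

lemma Ext_functor:
  assumes "cring A" "ideal \<aa> A"
  shows "additive_functor A (hom_module A (quotient_module (self_module A) \<aa>) :: ('a, 'u) module \<Rightarrow> ('a, 'a set \<Rightarrow> 'u) module)
    (\<lambda>E E' h. \<lambda>f\<in>mod_hom A (quotient_module (self_module A) \<aa>) E.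
      compose (carrier (quotient_module (self_module A) \<aa>)) h f)"
  by (rule hom_functor[OF quotient_module(1)[OF self_module_module[OF assms(1)] ideal_submodule[OF assms]]])

lemma mod_iso_refl: "module A M \<Longrightarrow> mod_iso A M M"
  using mod_hom_id[of A M] unfolding mod_iso_def
  by (intro bexI[of _ "\<lambda>x\<in>carrier M. x"]) (auto simp: bij_betw_def inj_on_def)

theorem M_cof_extension:
  fixes A :: "'a ring" and P Q T :: "('a, 'u) module"
  assumes inf: "infinite (UNIV :: 'u set)" and enough: "enough_injectives A TYPE('u)"
    and A: "cring A" "noetherian_ring A" and \<aa>: "ideal \<aa> A"
    and ses: "short_exact A P Q T f g" and PT: "P \<in> M_cof A \<aa>" "T \<in> M_cof A \<aa>"
  shows "Q \<in> M_cof A \<aa>"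
proof -
  have P: "module A P" and Q: "module A Q" and T: "module A T"
    using ses by (auto simp: short_exact_def)
  let ?N = "quotient_module (self_module A) \<aa>"
  interpret additive_functor A "hom_module A ?N :: ('a, 'u) module \<Rightarrow> ('a, 'a set \<Rightarrow> 'u) module"
    "\<lambda>E E' h. \<lambda>f\<in>mod_hom A ?N E. compose (carrier ?N) h f"
    by (rule Ext_functor[OF A(1) \<aa>])
  note mods = right_derived_module[OF enough]
  note isos = mod_iso_refl[OF mods]
  let ?E = "right_derived A (hom_module A ?N :: ('a, 'u) module \<Rightarrow> ('a, 'a set \<Rightarrow> 'u) module)
    (\<lambda>E E' h. \<lambda>f\<in>mod_hom A ?N E. compose (carrier ?N) h f)"
  have Ext: "Ext_module A i ?N M = ?E i M" for i and M :: "('a, 'u) module"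
    by (simp add: Ext_module_def)
  have "fin_gen_module A (Ext_module A i ?N Q)" for i
  proof -
    \<comment> \<open>Only the exact pieces \<open>Ext^i P -> Ext^i Q -> Ext^i T\<close> enter; each
      stays within one degree.\<close>
    obtain a b where a: "\<And>n. a n \<in> mod_hom A (?E n P) (?E n Q)"
      and b: "\<And>n. b n \<in> mod_hom A (?E n Q) (?E n T)"
      and ab: "\<And>n. a n ` carrier (?E n P) = a_kernel (?E n Q) (?E n T) (b n)"
      by (rule derived_long_exact_sequence[OF inf enough ses mods[OF P] isos[OF P] mods[OF Q] isos[OF Q] mods[OF T] isos[OF T]])
        (rule that, assumption+)
    have "fin_gen_module A (?E i P)" "fin_gen_module A (?E i T)"
      using PT by (auto simp: M_cof_def Ext)
    then show ?thesis
      unfolding Ext by (rule fin_gen_exact_middle[OF A(2) mods[OF P] mods[OF Q] mods[OF T] a b ab])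
  qed
  moreover have "supp A Q \<subseteq> vanishing A \<aa>"
    using supp_extension[OF ses] PT by (auto simp: M_cof_def)
  ultimately show ?thesis using Q by (simp add: M_cof_def)
qed

section \<open>Cofinite modules\<close>

lemma abelian_subcategory_module:
  assumes "abelian_subcategory A \<C>" "M \<in> \<C>"
  shows "module A M"
  using subsetD[OF assms(1)[unfolded abelian_subcategory_def, THEN conjunct1] assms(2)] by simp

lemma abelian_subcategoryD:
  fixes M N K :: "('a, 'u) module"
  assumes ab: "abelian_subcategory A \<C>" and M: "M \<in> \<C>" and N: "N \<in> \<C>" and f: "f \<in> mod_hom A M N"
  shows "module A K \<Longrightarrow> k \<in> mod_hom A K M \<Longrightarrow> inj_on k (carrier K) \<Longrightarrow> k ` carrier K = a_kernel M N f \<Longrightarrow> K \<in> \<C>"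
    and "module A K \<Longrightarrow> q \<in> mod_hom A N K \<Longrightarrow> q ` carrier N = carrier K \<Longrightarrow> a_kernel N K q = f ` carrier M \<Longrightarrow> K \<in> \<C>"
proof -
  note D = ab[unfolded abelian_subcategory_def, THEN conjunct2, THEN bspec, OF M, THEN bspec, OF N, THEN bspec, OF f]
  show "module A K \<Longrightarrow> k \<in> mod_hom A K M \<Longrightarrow> inj_on k (carrier K) \<Longrightarrow> k ` carrier K = a_kernel M N f \<Longrightarrow> K \<in> \<C>"
    using D[THEN conjunct1, THEN spec[of _ K], THEN spec[of _ k]] by simp
  show "module A K \<Longrightarrow> q \<in> mod_hom A N K \<Longrightarrow> q ` carrier N = carrier K \<Longrightarrow> a_kernel N K q = f ` carrier M \<Longrightarrow> K \<in> \<C>"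
    using D[THEN conjunct2, THEN spec[of _ K], THEN spec[of _ q]] by simp
qed

text \<open>\<open>abelian_subcategory\<close> admits every module that is a kernel up to
  isomorphism, and a copy of \<open>M\<close> is a kernel of the zero endomorphism of
  \<open>M\<close>.\<close>

lemma abelian_subcategory_iso:
  fixes M N :: "('a, 'u) module"
  assumes ab: "abelian_subcategory A \<C>" and M: "M \<in> \<C>" and N: "module A N" and iso: "mod_iso A M N"
  shows "N \<in> \<C>"
proof -
  have M': "module A M" by (rule abelian_subcategory_module[OF ab M])
  obtain f where f: "f \<in> mod_hom A N M" "bij_betw f (carrier N) (carrier M)"
    using mod_iso_sym[OF M' N iso] by (auto simp: mod_iso_def)
  have ker: "f ` carrier N = a_kernel M M (\<lambda>x\<in>carrier M. \<zero>\<^bsub>M\<^esub>)"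
    using f(2) by (auto simp: bij_betw_def a_kernel_def')
  have inj: "inj_on f (carrier N)" using f(2) by (simp add: bij_betw_def)
  show ?thesis
    by (rule abelian_subcategoryD(1)[OF ab M M mod_hom_null[OF M' M'] N f(1) inj ker])
qed

text \<open>Exactness turns the sequence into \<open>0 -> coker f -> H -> ker k -> 0\<close>; both
  ends belong to the class as cokernel and kernel of its morphisms, and \<open>ext\<close> yields
  the middle.\<close>

lemma exact_middle_mem:
  fixes A :: "'a ring" and X Y H Z W :: "('a, 'u) module"
  assumes ab: "abelian_subcategory A \<C>"
    and ext: "\<forall>(P :: ('a, 'u) module) (Q :: ('a, 'u) module) (T :: ('a, 'u) module) f g.
      short_exact A P Q T f g \<and> P \<in> \<C> \<and> T \<in> \<C> \<longrightarrow> Q \<in> \<C>"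
    and mem: "X \<in> \<C>" "Y \<in> \<C>" "Z \<in> \<C>" "W \<in> \<C>" and H: "module A H"
    and f: "f \<in> mod_hom A X Y" and g: "g \<in> mod_hom A Y H" and h: "h \<in> mod_hom A H Z" and k: "k \<in> mod_hom A Z W"
    and fg: "f ` carrier X = a_kernel Y H g" and gh: "g ` carrier Y = a_kernel H Z h" and hk: "h ` carrier H = a_kernel Z W k"
  shows "H \<in> \<C>"
proof -
  have X: "module A X" and Y: "module A Y" and Z: "module A Z" and W: "module A W"
    by (rule abelian_subcategory_module[OF ab], rule mem)+
  interpret Y: module A Y by fact
  obtain C :: "('a, 'u) module" and q where C: "module A C" and q: "q \<in> mod_hom A Y C" "q ` carrier Y = carrier C"
    and q0: "\<And>x. x \<in> carrier Y \<Longrightarrow> q x = \<zero>\<^bsub>C\<^esub> \<longleftrightarrow> x \<in> f ` carrier X"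
    by (rule cokernel_exists[OF Y submodule_image[OF X Y f]]) blast
  interpret C: module A C by fact
  interpret H: module A H by fact
  have f_le: "f ` carrier X \<subseteq> carrier Y" using mod_hom_closed[OF f] by blast
  have "a_kernel Y C q = f ` carrier X" using q0 f_le by (auto simp: a_kernel_def')
  then have "C \<in> \<C>"
    by (rule abelian_subcategoryD(2)[OF ab mem(1,2) f C q])
  define K where "K = Z\<lparr>carrier := a_kernel Z W k\<rparr>"
  have subK: "submodule (a_kernel Z W k) A Z" by (rule submodule_kernel[OF Z W k])
  have K: "module A K" unfolding K_def by (rule submodule.submodule_is_module[OF subK Z])
  have inc: "(\<lambda>x\<in>carrier K. x) \<in> mod_hom A K Z"
    by (rule restrict_mod_homI[OF K]) (use submoduleD(1)[OF Z subK] in \<open>auto simp: K_def\<close>)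
  have "inj_on (\<lambda>x\<in>carrier K. x) (carrier K)" "(\<lambda>x\<in>carrier K. x) ` carrier K = a_kernel Z W k"
    by (auto simp: inj_on_def K_def)
  then have "K \<in> \<C>"
    by (rule abelian_subcategoryD(1)[OF ab mem(3,4) k K inc])
  have g0: "g x = \<zero>\<^bsub>H\<^esub> \<longleftrightarrow> x \<in> f ` carrier X" if "x \<in> carrier Y" for x
    unfolding fg using that by (simp add: a_kernel_def')
  have "\<exists>g'\<in>mod_hom A C H. \<forall>y\<in>carrier Y. g' (q y) = g y"
    by (rule mod_hom_factor[OF Y C H q g]) (simp add: q0 g0)
  then obtain g' where g': "g' \<in> mod_hom A C H" "\<And>y. y \<in> carrier Y \<Longrightarrow> g' (q y) = g y" by blast
  have "short_exact A C H K g' h"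
    unfolding short_exact_def
  proof (intro conjI C H K g'(1))
    show "h \<in> mod_hom A H K" "h ` carrier H = carrier K"
      using h hk by (auto simp: mod_hom_def K_def PiE_def Pi_def)
    show "inj_on g' (carrier C)"
    proof (rule inj_onI)
      fix x y assume xy: "x \<in> carrier C" "y \<in> carrier C" "g' x = g' y"
      obtain z where z: "z \<in> carrier Y" "q z = x \<ominus>\<^bsub>C\<^esub> y"
        using q(2) C.minus_closed[OF xy(1,2)] by (metis imageE)
      have "g' (x \<ominus>\<^bsub>C\<^esub> y) = \<zero>\<^bsub>H\<^esub>"
        using xy mod_hom_closed[OF g'(1)] by (simp add: mod_hom_minus[OF C H g'(1)] H.minus_eq_zero_iff)
      then have "g z = \<zero>\<^bsub>H\<^esub>"
        using g'(2)[OF z(1)] z(2) by simp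
      then have "x \<ominus>\<^bsub>C\<^esub> y = \<zero>\<^bsub>C\<^esub>" unfolding z(2)[symmetric] using z(1) by (simp add: q0 g0)
      then show "x = y" using xy by (simp add: C.minus_eq_zero_iff)
    qed
    have "g' ` carrier C = g ` carrier Y"
      unfolding q(2)[symmetric] image_image using g'(2) by (rule image_cong[OF refl])
    also have "\<dots> = a_kernel H K h" unfolding gh by (simp add: a_kernel_def' K_def)
    finally show "g' ` carrier C = a_kernel H K h" .
  qed
  then show ?thesis using ext \<open>C \<in> \<C>\<close> \<open>K \<in> \<C>\<close> by blast
qed

text \<open>The projection is read off from the bijection, and its linearity comes from uniqueness
  of the two components.\<close>

lemma direct_sum_retract:
  assumes P: "module A P" and Q: "module A Q" and M: "module A M" and sum: "is_direct_sum A P Q M"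
  obtains i p where "i \<in> mod_hom A P M" "p \<in> mod_hom A M P" "\<And>x. x \<in> carrier P \<Longrightarrow> p (i x) = x"
proof -
  interpret P: module A P by fact
  interpret Q: module A Q by fact
  interpret M: module A M by fact
  obtain i j where i: "i \<in> mod_hom A P M" and j: "j \<in> mod_hom A Q M"
    and bij: "bij_betw (\<lambda>(x, y). i x \<oplus>\<^bsub>M\<^esub> j y) (carrier P \<times> carrier Q) (carrier M)"
    using sum by (auto simp: is_direct_sum_def)
  note cl = mod_hom_closed[OF i] mod_hom_closed[OF j]
  have uniq: "x = x'" if "x \<in> carrier P" "y \<in> carrier Q" "x' \<in> carrier P" "y' \<in> carrier Q"
    "i x \<oplus>\<^bsub>M\<^esub> j y = i x' \<oplus>\<^bsub>M\<^esub> j y'" for x y x' y'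
    using inj_onD[OF bij_betw_imp_inj_on[OF bij], of "(x, y)" "(x', y')"] that by auto
  have "\<exists>x y. x \<in> carrier P \<and> y \<in> carrier Q \<and> i x \<oplus>\<^bsub>M\<^esub> j y = m" if "m \<in> carrier M" for m
    using that bij_betw_imp_surj_on[OF bij, symmetric] by auto
  then obtain a b where ab: "\<And>m. m \<in> carrier M \<Longrightarrow> a m \<in> carrier P" "\<And>m. m \<in> carrier M \<Longrightarrow> b m \<in> carrier Q"
    "\<And>m. m \<in> carrier M \<Longrightarrow> i (a m) \<oplus>\<^bsub>M\<^esub> j (b m) = m" by metis
  have "restrict a (carrier M) \<in> mod_hom A M P"
  proof (rule restrict_mod_homI[OF M])
    fix m n assume m: "m \<in> carrier M" and n: "n \<in> carrier M"
    have "i (a m \<oplus>\<^bsub>P\<^esub> a n) \<oplus>\<^bsub>M\<^esub> j (b m \<oplus>\<^bsub>Q\<^esub> b n) = (i (a m) \<oplus>\<^bsub>M\<^esub> j (b m)) \<oplus>\<^bsub>M\<^esub> (i (a n) \<oplus>\<^bsub>M\<^esub> j (b n))"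
      using m n ab(1,2) by (simp add: mod_hom_add[OF i] mod_hom_add[OF j] cl M.add.m_ac)
    also have "\<dots> = i (a (m \<oplus>\<^bsub>M\<^esub> n)) \<oplus>\<^bsub>M\<^esub> j (b (m \<oplus>\<^bsub>M\<^esub> n))" using m n by (simp add: ab(3))
    finally show "a (m \<oplus>\<^bsub>M\<^esub> n) = a m \<oplus>\<^bsub>P\<^esub> a n"
      by (intro uniq[symmetric]) (use m n ab(1,2) in auto)
  next
    fix r m assume r: "r \<in> carrier A" and m: "m \<in> carrier M"
    have "i (r \<odot>\<^bsub>P\<^esub> a m) \<oplus>\<^bsub>M\<^esub> j (r \<odot>\<^bsub>Q\<^esub> b m) = r \<odot>\<^bsub>M\<^esub> (i (a m) \<oplus>\<^bsub>M\<^esub> j (b m))"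
      using r m ab(1,2) by (simp add: mod_hom_smult[OF i] mod_hom_smult[OF j] cl M.smult_r_distr)
    also have "\<dots> = i (a (r \<odot>\<^bsub>M\<^esub> m)) \<oplus>\<^bsub>M\<^esub> j (b (r \<odot>\<^bsub>M\<^esub> m))" using r m by (simp add: ab(3))
    finally show "a (r \<odot>\<^bsub>M\<^esub> m) = r \<odot>\<^bsub>P\<^esub> a m"
      by (intro uniq[symmetric]) (use r m ab(1,2) in auto)
  qed (rule ab(1))
  moreover have "restrict a (carrier M) (i x) = x" if x: "x \<in> carrier P" for x
  proof -
    have "i (a (i x)) \<oplus>\<^bsub>M\<^esub> j (b (i x)) = i x \<oplus>\<^bsub>M\<^esub> j \<zero>\<^bsub>Q\<^esub>"
      using x cl by (simp add: ab(3) mod_hom_zero[OF Q M j])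
    then have "a (i x) = x" by (rule uniq[rotated 4]) (use x cl ab in auto)
    then show ?thesis using x cl by simp
  qed
  ultimately show ?thesis using that i by blast
qed

text \<open>The zero submodule is a kernel of the identity of \<open>M\<close>.\<close>

lemma zero_module_mem:
  fixes M :: "('a, 'u) module"
  assumes ab: "abelian_subcategory A \<C>" and M: "M \<in> \<C>"
  shows "M\<lparr>carrier := {\<zero>\<^bsub>M\<^esub>}\<rparr> \<in> \<C>"
proof -
  let ?O = "M\<lparr>carrier := {\<zero>\<^bsub>M\<^esub>}\<rparr>"
  have M': "module A M" by (rule abelian_subcategory_module[OF ab M])
  interpret M: module A M by fact
  have O: "module A ?O" by (rule submodule.submodule_is_module[OF submodule_zero[OF M'] M'])
  have "(\<lambda>x\<in>carrier ?O. \<zero>\<^bsub>M\<^esub>) ` carrier ?O = a_kernel M M (\<lambda>x\<in>carrier M. x)"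
    by (auto simp: a_kernel_def')
  moreover have "inj_on (\<lambda>x\<in>carrier ?O. \<zero>\<^bsub>M\<^esub>) (carrier ?O)" by (simp add: inj_on_def)
  ultimately show ?thesis
    by (rule abelian_subcategoryD(1)[OF ab M M mod_hom_id[OF M'] O mod_hom_null[OF O M'], rotated])
qed

theorem L_cof_thick:
  fixes A :: "'a ring" and \<aa> :: "'a set"
  assumes inf: "infinite (UNIV :: 'u set)" and enough: "enough_injectives A TYPE('u)"
    and A: "cring A" "noetherian_ring A" and \<aa>: "ideal \<aa> A"
    and ab: "abelian_subcategory A (M_cof A \<aa> :: ('a, 'u) module set)"
  shows "thick_subcategory A (L_cof A \<aa> :: ('a, 'u) module set)"
proof -
  let ?C = "M_cof A \<aa> :: ('a, 'u) module set"
  let ?R = "right_derived A (torsion A \<aa> :: ('a, 'u) module \<Rightarrow> ('a, 'u) module)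
    (\<lambda>E E' h. restrict h (carrier (torsion A \<aa> E)))"
  interpret additive_functor A "torsion A \<aa> :: ('a, 'u) module \<Rightarrow> ('a, 'u) module"
    "\<lambda>E E' h. restrict h (carrier (torsion A \<aa> E))"
    by (rule torsion_functor[OF \<aa>])
  have lc: "local_cohomology A \<aa> i M = ?R i M" for i and M :: "('a, 'u) module"
    by (simp add: local_cohomology_def)
  \<comment> \<open>The premise on \<open>M\<close> stands inside the existential so that a total
    choice of copies of local cohomology can be extracted.\<close>
  have "\<exists>H :: ('a, 'u) module. module A M \<longrightarrow> module A H \<and> mod_iso A (?R n M) H" for n and M :: "('a, 'u) module"
    using right_derived_copy[OF enough] by blast
  then obtain H :: "('a, 'u) module \<Rightarrow> nat \<Rightarrow> ('a, 'u) module"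
    where H: "\<And>M n. module A M \<Longrightarrow> module A (H M n)" "\<And>M n. module A M \<Longrightarrow> mod_iso A (?R n M) (H M n)"
    by metis
  have C_module: "module A M" if "M \<in> ?C" for M using that by (simp add: M_cof_def)
  \<comment> \<open>\<open>L_cof\<close> asks for some cofinite copy in each degree; closure under
    isomorphism turns this into a property of the chosen copies \<open>H M n\<close>, between which
    the exact sequences run.\<close>
  have L_iff: "M \<in> L_cof A \<aa> \<longleftrightarrow> module A M \<and> (\<forall>n. H M n \<in> ?C)" for M :: "('a, 'u) module"
  proof (intro iffI conjI allI)
    assume M: "M \<in> L_cof A \<aa>"
    then show M': "module A M" by (simp add: L_cof_def)
    fix n
    obtain K where K: "K \<in> ?C" "mod_iso A K (?R n M)" using M by (auto simp: L_cof_def lc)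
    have "mod_iso A K (H M n)"
      by (rule mod_iso_comp[OF C_module[OF K(1)] right_derived_module[OF enough M'] K(2) H(2)[OF M']])
    then show "H M n \<in> ?C"
      by (rule abelian_subcategory_iso[OF ab K(1) H(1)[OF M']])
  next
    assume M: "module A M \<and> (\<forall>n. H M n \<in> ?C)"
    then have "mod_iso A (H M n) (?R n M)" for n
      using mod_iso_sym[OF right_derived_module[OF enough] H(1) H(2)] by blast
    then show "M \<in> L_cof A \<aa>" using M by (auto simp: L_cof_def lc)
  qed
  have ext: "\<forall>(P :: ('a, 'u) module) (Q :: ('a, 'u) module) (T :: ('a, 'u) module) f g.
      short_exact A P Q T f g \<and> P \<in> ?C \<and> T \<in> ?C \<longrightarrow> Q \<in> ?C"
    using M_cof_extension[OF inf enough A \<aa>] by blast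
  note middle = exact_middle_mem[OF ab ext]
  have summand: "P \<in> L_cof A \<aa>" if M: "M \<in> L_cof A \<aa>" and P: "module A P" and Q: "module A Q"
    and sum: "is_direct_sum A P Q M" for M P Q :: "('a, 'u) module"
  proof -
    have M': "module A M" and HM: "\<And>n. H M n \<in> ?C" using M by (simp_all add: L_iff)
    obtain i p where ip: "i \<in> mod_hom A P M" "p \<in> mod_hom A M P" "\<And>x. x \<in> carrier P \<Longrightarrow> p (i x) = x"
      using direct_sum_retract[OF P Q M' sum] by blast
    have "H P n \<in> ?C" for n
    proof -
      obtain a b where a: "a \<in> mod_hom A (H P n) (H M n)" and b: "b \<in> mod_hom A (H M n) (H P n)"
        and ba: "\<And>y. y \<in> carrier (H P n) \<Longrightarrow> b (a y) = y"
        by (rule right_derived_retract[OF enough P M' ip H(1)[OF P, of n] H(2)[OF P, of n] H(1)[OF M', of n] H(2)[OF M', of n]])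
          (assumption, rule that, assumption+)
      interpret HM: module A "H M n" by (rule H(1)[OF M'])
      \<comment> \<open>\<open>b\<close> after \<open>a\<close> is the identity, so \<open>a\<close>
        after \<open>b\<close> is idempotent with the same image as \<open>a\<close>; that image is
        the kernel of the complementary map, the identity minus \<open>a\<close> after
        \<open>b\<close>.\<close>
      define e where "e = (\<lambda>y\<in>carrier (H M n). (\<lambda>y\<in>carrier (H M n). y) y \<ominus>\<^bsub>H M n\<^esub> (\<lambda>y\<in>carrier (H M n). a (b y)) y)"
      have e: "e \<in> mod_hom A (H M n) (H M n)"
        unfolding e_def by (intro mod_hom_diff mod_hom_id mod_hom_comp[OF H(1)[OF M'] b a] H(1)[OF M'])
      have cl: "\<And>y. y \<in> carrier (H P n) \<Longrightarrow> a y \<in> carrier (H M n)" "\<And>y. y \<in> carrier (H M n) \<Longrightarrow> b y \<in> carrier (H P n)"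
        using mod_hom_closed[OF a] mod_hom_closed[OF b] by auto
      have e0: "e y = \<zero>\<^bsub>H M n\<^esub> \<longleftrightarrow> y = a (b y)" if "y \<in> carrier (H M n)" for y
        using that by (simp add: e_def cl HM.minus_eq_zero_iff)
      have "a ` carrier (H P n) = a_kernel (H M n) (H M n) e"
      proof (intro equalityI subsetI)
        fix y assume "y \<in> a ` carrier (H P n)"
        then obtain x where "x \<in> carrier (H P n)" "y = a x" by blast
        then show "y \<in> a_kernel (H M n) (H M n) e" by (simp add: a_kernel_def' e0 cl ba)
      next
        fix y assume "y \<in> a_kernel (H M n) (H M n) e"
        then have y: "y \<in> carrier (H M n)" "e y = \<zero>\<^bsub>H M n\<^esub>" by (simp_all add: a_kernel_def')
        then have "y = a (b y)" using e0 by blast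
        then show "y \<in> a ` carrier (H P n)" using cl(2)[OF y(1)] by (rule image_eqI)
      qed
      moreover have "inj_on a (carrier (H P n))" using ba by (rule inj_on_inverseI)
      ultimately show ?thesis
        by (rule abelian_subcategoryD(1)[OF ab HM HM e H(1)[OF P] a, rotated])
    qed
    then show ?thesis using P by (simp add: L_iff)
  qed
  have "(P \<in> L_cof A \<aa> \<and> T \<in> L_cof A \<aa> \<longrightarrow> Q \<in> L_cof A \<aa>) \<and>
      (Q \<in> L_cof A \<aa> \<and> T \<in> L_cof A \<aa> \<longrightarrow> P \<in> L_cof A \<aa>) \<and>
      (P \<in> L_cof A \<aa> \<and> Q \<in> L_cof A \<aa> \<longrightarrow> T \<in> L_cof A \<aa>)"
    if ses: "short_exact A P Q T f g" for P Q T :: "('a, 'u) module" and f g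
  proof -
    have P: "module A P" and Q: "module A Q" and T: "module A T"
      using ses by (auto simp: short_exact_def)
    obtain a b c where a: "\<And>n. a n \<in> mod_hom A (H P n) (H Q n)" and b: "\<And>n. b n \<in> mod_hom A (H Q n) (H T n)"
      and c: "\<And>n. c n \<in> mod_hom A (H T n) (H P (Suc n))"
      and ex: "\<And>n. a n ` carrier (H P n) = a_kernel (H Q n) (H T n) (b n)"
        "\<And>n. b n ` carrier (H Q n) = a_kernel (H T n) (H P (Suc n)) (c n)"
        "\<And>n. c n ` carrier (H T n) = a_kernel (H P (Suc n)) (H Q (Suc n)) (a (Suc n))"
        "a_kernel (H P 0) (H Q 0) (a 0) = {\<zero>\<^bsub>H P 0\<^esub>}"
      by (rule derived_long_exact_sequence[OF inf enough ses H(1)[OF P] H(2)[OF P] H(1)[OF Q] H(2)[OF Q] H(1)[OF T] H(2)[OF T]])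
        (rule that, assumption+)
    text \<open>In degree \<open>0\<close> the five-term sequence is extended to the left by zero modules.\<close>
    define Z0 where "Z0 = (H T 0)\<lparr>carrier := {\<zero>\<^bsub>H T 0\<^esub>}\<rparr>"
    have Z0': "module A Z0" "carrier Z0 = {\<zero>\<^bsub>Z0\<^esub>}"
      using submodule.submodule_is_module[OF submodule_zero H(1)[OF T]] H(1)[OF T] by (simp_all add: Z0_def)
    have HPQ: "H Q n \<in> ?C" if "\<And>n. H P n \<in> ?C" "\<And>n. H T n \<in> ?C" for n
    proof (cases n)
      case 0
      have OC: "Z0 \<in> ?C" unfolding Z0_def by (rule zero_module_mem[OF ab that(2)])
      have O0: "(\<lambda>x\<in>carrier Z0. \<zero>\<^bsub>H P 0\<^esub>) ` carrier Z0 = a_kernel (H P 0) (H Q 0) (a 0)"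
        unfolding ex(4) Z0'(2) by simp
      show ?thesis
        unfolding 0 by (rule middle[OF OC that(1) that(2) that(1) H(1)[OF Q] mod_hom_null[OF Z0'(1) H(1)[OF P]] a b c O0 ex(1,2)])
    next
      case (Suc m)
      show ?thesis
        unfolding Suc by (rule middle[OF that(2) that(1) that(2) that(1) H(1)[OF Q] c a b c ex(3,1,2)])
    qed
    have HQT: "H P n \<in> ?C" if "\<And>n. H Q n \<in> ?C" "\<And>n. H T n \<in> ?C" for n
    proof (cases n)
      case 0
      have OC: "Z0 \<in> ?C" unfolding Z0_def by (rule zero_module_mem[OF ab that(2)])
      have O0: "(\<lambda>x\<in>carrier Z0. \<zero>\<^bsub>Z0\<^esub>) ` carrier Z0 = a_kernel Z0 (H P 0) (\<lambda>x\<in>carrier Z0. \<zero>\<^bsub>H P 0\<^esub>)"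
        using Z0'(2) by (auto simp: a_kernel_def')
      have O1: "(\<lambda>x\<in>carrier Z0. \<zero>\<^bsub>H P 0\<^esub>) ` carrier Z0 = a_kernel (H P 0) (H Q 0) (a 0)"
        unfolding ex(4) Z0'(2) by simp
      show ?thesis
        unfolding 0 by (rule middle[OF OC OC that(1) that(2) H(1)[OF P] mod_hom_null[OF Z0'(1) Z0'(1)]
              mod_hom_null[OF Z0'(1) H(1)[OF P]] a b O0 O1 ex(1)])
    next
      case (Suc m)
      show ?thesis
        unfolding Suc by (rule middle[OF that(1) that(2) that(1) that(2) H(1)[OF P] b c a b ex(2,3,1)])
    qed
    \<comment> \<open>The five-term window around \<open>H T n\<close> starts at
      \<open>H P n\<close>, in the same degree, so degree \<open>0\<close> is not special
      here.\<close>
    have HPT: "H T n \<in> ?C" if "\<And>n. H P n \<in> ?C" "\<And>n. H Q n \<in> ?C" for n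
      by (rule middle[OF that(1) that(2) that(1) that(2) H(1)[OF T] a b c a ex(1,2,3)])
    show ?thesis
      using HPQ HQT HPT P Q T by (simp add: L_iff)
  qed
  note two_of_three = this
  show ?thesis
    unfolding thick_subcategory_def
  proof (intro conjI[OF _ conjI] ballI allI impI)
    show "L_cof A \<aa> \<subseteq> {M :: ('a, 'u) module. module A M}"
      unfolding L_cof_def by (rule subsetI, drule CollectD, rule CollectI, erule conjunct1)
  next
    fix M P Q :: "('a, 'u) module"
    assume "M \<in> L_cof A \<aa>" "module A P \<and> module A Q \<and> is_direct_sum A P Q M"
    then show "P \<in> L_cof A \<aa>" by (elim conjE) (rule summand)
  next
    fix P Q T :: "('a, 'u) module" and f g :: "'u \<Rightarrow> 'u"
    assume ses: "short_exact A P Q T f g"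
    show "Q \<in> L_cof A \<aa>" if "P \<in> L_cof A \<aa> \<and> T \<in> L_cof A \<aa>"
      by (rule two_of_three[OF ses, THEN conjunct1, THEN mp, OF that])
    show "P \<in> L_cof A \<aa>" if "Q \<in> L_cof A \<aa> \<and> T \<in> L_cof A \<aa>"
      by (rule two_of_three[OF ses, THEN conjunct2, THEN conjunct1, THEN mp, OF that])
    show "T \<in> L_cof A \<aa>" if "P \<in> L_cof A \<aa> \<and> Q \<in> L_cof A \<aa>"
      by (rule two_of_three[OF ses, THEN conjunct2, THEN conjunct2, THEN mp, OF that])
  qed
qed

theorem proposition3p4:
  fixes A :: "'a ring" and \<aa> :: "'a set"
  assumes "infinite (UNIV :: 'u set)"
    and "(UNIV :: ('a \<Rightarrow> 'u) set) \<lesssim> (UNIV :: 'u set)"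
    and "cring A" and "noetherian_ring A"
    and "ideal \<aa> A"
    and "abelian_subcategory A (M_cof A \<aa> :: ('a, 'u) module set)"
  shows "thick_subcategory A (L_cof A \<aa> :: ('a, 'u) module set)"
  by (rule L_cof_thick[OF assms(1) enough_injectives[OF assms(3,1,2)] assms(3-6)])

end
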